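(* The spatial version of Bennett's spherical eight-bar linkage (defined in the context, a compound of six Bennett isograms with bodies $\Gamma_0,\dots,\Gamma_3,\Delta_0,\dots,\Delta_3$ and associated lines $g_0,\dots,g_3,h_0,\dots,h_3$) is continuously flexible with exactly one degree of freedom. In each (non-aligned) pose, the axes of symmetry $s_1,\dots,s_6$ of the six contained Bennett isograms have a common perpendicular $n$, i.e., there is a line $n$ that meets each of $s_1,\dots,s_6$ orthogonally. For each $i=1,2,3$, the helical displacement about $n$ which maps the oriented line $g_0$ to the oriented line $g_i$ simultaneously maps the oriented line $h_i$ to the oriented line $h_0$. Moreover, there is a line $t$ with respect to which the common perpendiculars between $n$ and $g_0,\dots,g_3$ are respectively symmetric to the common perpendiculars between $n$ and $h_0,\dots,h_3$; that is, for every $i\in\{0,1,2,3\}$ the reflection in $t$ interchanges the common perpendicular of $n$ and $g_i$ with the common perpendicular of $n$ and $h_i$.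
   Context: Everything takes place in Euclidean 3-space. The reflection in a line is the rotation about it through $180^\circ$ (halfturn). A helical displacement about a line $n$ is a rotation about $n$ composed with a translation along $n$. Bennett isogram. A flexible closed chain of four rigid bodies and four revolute joints (hinges) $I_1,\dots,I_4$ (a 4R loop) in which the common perpendiculars of consecutive hinges form a closed skew isogram $P_1P_2P_3P_4$: $P_k\in I_k$, the line $P_kP_{k+1}$ is the common perpendicular of $I_k$ and $I_{k+1}$ (indices mod 4), and opposite sides have equal lengths, $\overline{P_1P_2}=\overline{P_3P_4}=a$ and $\overline{P_2P_3}=\overline{P_4P_1}=b$. Opposite sides also have equal twist angles between their hinges, $\alpha$ for sides of length $a$ and $\beta$ for sides of length $b$, and $a:b=\sin\alpha:\sin\beta$. In each spatial (non-aligned) pose there is a unique line $s$, the axis of symmetry of the isogram, such that the reflection in $s$ interchanges opposite vertices, opposite sides and opposite hinges. The spatial 8-bar linkage. It has eight rigid bodies $\Gamma_0,\dots,\Gamma_3$, $\Delta_0,\dots,\Delta_3$ and twelve hinges $I_{ij}$, $i,j\in\{0,1,2,3\}$, $i\ne j$, where $I_{ij}$ is a revolute joint connecting $\Gamma_i$ with $\Delta_j$. A line $g_i$ is attached to $\Gamma_i$ and a line $h_j$ is attached to $\Delta_j$. For $i\neq j$ the lines $g_i$ and $h_j$ meet at a point $R_{ij}$, and the hinge $I_{ij}$ passes through $R_{ij}$ orthogonally to $g_i$ and $h_j$. Thus $g_i$ is the common perpendicular of the three hinges on $\Gamma_i$, and $h_j$ that of the three hinges on $\Delta_j$. The linkage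 is the union of six Bennett isograms: whenever $\{i,j,k,l\}=\{0,1,2,3\}$, the loop with bodies $\Gamma_i,\Delta_l,\Gamma_j,\Delta_k$ and hinges $I_{ik},I_{il},I_{jl},I_{jk}$ is a Bennett isogram with vertices $R_{ik},R_{il},R_{jl},R_{jk}$ and sides on $g_i,h_l,g_j,h_k$. A pose is a placement of the bodies compatible with all hinges, considered up to rigid motions; non-aligned means that $g_i\neq h_j$ for all $i\ne j$ (in aligned poses the isograms collapse). The linkage is considered in a non-aligned pose. Continuously flexible with one degree of freedom means that the bodies admit a continuous one-parameter relative motion preserving all hinges, and the set of poses near a non-aligned pose is one-dimensional. Axes and line reflections. $s_1,\dots,s_6$ are the axes of symmetry of the Bennett isograms with sides on the following lines, and $\sigma_1,\dots,\sigma_6$ are the reflections in these axes: $s_1$: $g_0,g_3,h_1,h_2$; $s_2$: $g_0,g_1,h_2,h_3$; $s_3$: $g_0,g_2,h_1,h_3$; $s_4$: $g_1,g_2,h_3,h_0$; $s_5$: $g_2,g_3,h_1,h_0$; $s_6$: $g_1,g_3,h_2,h_0$. Orientations. An overline on an oriented line denotes reversal of orientation. Choose orientations of $g_0$ and $h_1$ arbitrarily and orient the remaining lines by $\overline{g_3}=\sigma_1(g_0)$, $\overline{g_1}=\sigma_2(g_0)$, $\overline{g_2}=\sigma_3(g_0)$, $\overline{h_2}=\sigma_1(h_1)$, $\overline{h_3}=\sigma_3(h_1)$, $\overline{h_0}=\sigma_5(h_1)$.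
   Formalization: Equal lengths of opposite sides are read as signed lengths for one fixed choice of orientations of the eight lines g_i, h_j, common to all six isograms; with unsigned lengths other compounds of six Bennett isograms exist for which the helical claim fails. *)

theory Defs
  imports "HOL-Analysis.Analysis"
begin

section \<open>Lines and motions in Euclidean 3-space\<close>

type_synonym space = "real^3"

definition line :: "space set \<Rightarrow> bool" where
  "line L \<longleftrightarrow> (\<exists>a b. a \<noteq> b \<and> L = affine hull {a, b})"

definition meets_orthogonally :: "space set \<Rightarrow> space set \<Rightarrow> bool" where
  "meets_orthogonally L M \<longleftrightarrow> L \<inter> M \<noteq> {} \<and>
     (\<forall>x\<in>L. \<forall>y\<in>L. \<forall>z\<in>M. \<forall>w\<in>M. (x - y) \<bullet> (z - w) = 0)"

text \<open>The two lines are allowed to intersect; they only have to be non-parallel for the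
  common perpendicular to be unique.\<close>

definition is_common_perpendicular :: "space set \<Rightarrow> space set \<Rightarrow> space set \<Rightarrow> bool" where
  "is_common_perpendicular c L M \<longleftrightarrow> line c \<and> meets_orthogonally c L \<and> meets_orthogonally c M"

definition common_perpendicular :: "space set \<Rightarrow> space set \<Rightarrow> space set" where
  "common_perpendicular L M = (THE c. is_common_perpendicular c L M)"

definition rigid_motion :: "(space \<Rightarrow> space) \<Rightarrow> bool" where
  "rigid_motion f \<longleftrightarrow> (\<exists>Q v. rotation_matrix Q \<and> f = (\<lambda>x. Q *v x + v))"

text \<open>The reflection in a line (rotation about it through 180 degrees).\<close>

definition halfturn :: "space set \<Rightarrow> space \<Rightarrow> space" where
  "halfturn s x = 2 *\<^sub>R closest_point s x - x"

definition rotation_about :: "space set \<Rightarrow> (space \<Rightarrow> space) \<Rightarrow> bool" where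
  "rotation_about n r \<longleftrightarrow> rigid_motion r \<and> (\<forall>x\<in>n. r x = x)"

definition helical_displacement :: "space set \<Rightarrow> (space \<Rightarrow> space) \<Rightarrow> bool" where
  "helical_displacement n f \<longleftrightarrow>
     (\<exists>r v. rotation_about n r \<and> (\<forall>x\<in>n. x + v \<in> n) \<and> f = (\<lambda>x. r x + v))"

definition unit_direction :: "space set \<Rightarrow> space \<Rightarrow> bool" where
  "unit_direction L u \<longleftrightarrow> norm u = 1 \<and> (\<forall>x\<in>L. x + u \<in> L)"

text \<open>An oriented line is a line together with one of its two unit direction vectors.\<close>

type_synonym oline = "space set \<times> space"

definition orientation_of :: "space set \<Rightarrow> oline \<Rightarrow> bool" where
  "orientation_of L G \<longleftrightarrow> fst G = L \<and> unit_direction L (snd G)"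

definition reversed :: "oline \<Rightarrow> oline" where
  "reversed G = (fst G, - snd G)"

text \<open>The linear part of an affine map \<^term>\<open>f\<close> sends \<^term>\<open>u\<close> to \<^term>\<open>f u - f 0\<close>.\<close>

definition move_oline :: "(space \<Rightarrow> space) \<Rightarrow> oline \<Rightarrow> oline" where
  "move_oline f G = (f ` fst G, f (snd G) - f 0)"


section \<open>Bennett isograms\<close>

text \<open>The index type \<^typ>\<open>4\<close> has the elements 0, 1, 2, 3 with arithmetic modulo 4. Vertices and
  hinges of a closed chain are indexed cyclically by it.\<close>

definition quad :: "'a \<Rightarrow> 'a \<Rightarrow> 'a \<Rightarrow> 'a \<Rightarrow> 4 \<Rightarrow> 'a" where
  "quad a b c d = (\<lambda>k. if k = 0 then a else if k = 1 then b else if k = 2 then c else d)"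

definition side :: "(4 \<Rightarrow> space) \<Rightarrow> 4 \<Rightarrow> space set" where
  "side P k = affine hull {P k, P (k + 1)}"

text \<open>The angle of the rotation about the line \<^term>\<open>PQ\<close>, directed from \<^term>\<open>P\<close> to
  \<^term>\<open>Q\<close>, that takes the direction of the hinge \<^term>\<open>I\<close> to that of the hinge
  \<^term>\<open>J\<close> (both hinges being orthogonal to \<^term>\<open>PQ\<close>). As the hinges carry no orientation,
  it is determined modulo \<^term>\<open>pi\<close>, and is taken in the interval from 0 to \<^term>\<open>pi\<close>.\<close>

definition twist_angle :: "space \<Rightarrow> space \<Rightarrow> space set \<Rightarrow> space set \<Rightarrow> real \<Rightarrow> bool" where
  "twist_angle P Q I J \<alpha> \<longleftrightarrow> 0 \<le> \<alpha> \<and> \<alpha> < pi \<and>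
     (\<exists>d e. unit_direction I d \<and> unit_direction J e \<and>
        e = cos \<alpha> *\<^sub>R d + sin \<alpha> *\<^sub>R cross3 ((Q - P) /\<^sub>R norm (Q - P)) d)"

definition bennett_isogram :: "(4 \<Rightarrow> space) \<Rightarrow> (4 \<Rightarrow> space set) \<Rightarrow> bool" where
  "bennett_isogram P I \<longleftrightarrow>
     (\<forall>k. line (I k) \<and> P k \<in> I k \<and> P k \<noteq> P (k + 1) \<and>
          is_common_perpendicular (side P k) (I k) (I (k + 1))) \<and>
     aff_dim (range P) = 3 \<and>
     (\<exists>a b \<alpha> \<beta>.
        dist (P 0) (P 1) = a \<and> dist (P 2) (P 3) = a \<and>
        dist (P 1) (P 2) = b \<and> dist (P 3) (P 0) = b \<and>
        twist_angle (P 0) (P 1) (I 0) (I 1) \<alpha> \<and> twist_angle (P 2) (P 3) (I 2) (I 3) \<alpha> \<and>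
        twist_angle (P 1) (P 2) (I 1) (I 2) \<beta> \<and> twist_angle (P 3) (P 0) (I 3) (I 0) \<beta> \<and>
        a * sin \<beta> = b * sin \<alpha>)"

definition is_isogram_axis :: "(4 \<Rightarrow> space) \<Rightarrow> (4 \<Rightarrow> space set) \<Rightarrow> space set \<Rightarrow> bool" where
  "is_isogram_axis P I s \<longleftrightarrow> line s \<and>
     (\<forall>k. halfturn s (P k) = P (k + 2) \<and>
          halfturn s ` side P k = side P (k + 2) \<and>
          halfturn s ` I k = I (k + 2))"

definition isogram_axis :: "(4 \<Rightarrow> space) \<Rightarrow> (4 \<Rightarrow> space set) \<Rightarrow> space set" where
  "isogram_axis P I = (THE s. is_isogram_axis P I s)"


section \<open>The spatial eight-bar linkage\<close>

text \<open>The geometry of the eight bodies is given by the position of the lines \<^term>\<open>g i\<close>,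
  \<^term>\<open>h j\<close>, of the points \<^term>\<open>R i j\<close> and of the hinges \<^term>\<open>I i j\<close> in a non-aligned
  reference pose. The values of \<^term>\<open>R\<close> and \<^term>\<open>I\<close> on the diagonal are irrelevant.

  \<open>loop X i l j k\<close> lists the values of \<^term>\<open>X\<close> along the closed chain with the bodies
  \<open>\<Gamma>\<^sub>i, \<Delta>\<^sub>l, \<Gamma>\<^sub>j, \<Delta>\<^sub>k\<close>; its consecutive sides lie on \<^term>\<open>g i\<close>, \<^term>\<open>h l\<close>,
  \<^term>\<open>g j\<close>, \<^term>\<open>h k\<close>.\<close>

definition loop :: "(4 \<Rightarrow> 4 \<Rightarrow> 'a) \<Rightarrow> 4 \<Rightarrow> 4 \<Rightarrow> 4 \<Rightarrow> 4 \<Rightarrow> 4 \<Rightarrow> 'a" where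
  "loop X i l j k = quad (X i k) (X i l) (X j l) (X j k)"

text \<open>Lengths on the lines \<^term>\<open>g i\<close>, \<^term>\<open>h j\<close> are signed: with respect to suitable
  orientations (directions \<^term>\<open>u i\<close>, \<^term>\<open>w j\<close>) of the eight lines, opposite sides of every
  isogram have the same signed length. For a single isogram this is no restriction. For the compound
  it is one: six Bennett isograms for which the unsigned lengths fit together in one pose, but for
  which no such orientations exist, can form a rigid structure instead of a linkage.\<close>

definition coherent_sides :: "(4 \<Rightarrow> 4 \<Rightarrow> space) \<Rightarrow> bool" where
  "coherent_sides R \<longleftrightarrow>
     (\<exists>u w :: 4 \<Rightarrow> space. (\<forall>i. norm (u i) = 1 \<and> norm (w i) = 1) \<and>
        (\<forall>i j k l. {i, j, k, l} = UNIV \<longrightarrow>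
           (\<exists>a. R i l - R i k = a *\<^sub>R u i \<and> R j l - R j k = a *\<^sub>R u j) \<and>
           (\<exists>b. R j k - R i k = b *\<^sub>R w k \<and> R j l - R i l = b *\<^sub>R w l)))"

definition eight_bar_linkage ::
  "(4 \<Rightarrow> space set) \<Rightarrow> (4 \<Rightarrow> space set) \<Rightarrow> (4 \<Rightarrow> 4 \<Rightarrow> space) \<Rightarrow> (4 \<Rightarrow> 4 \<Rightarrow> space set) \<Rightarrow> bool" where
  "eight_bar_linkage g h R I \<longleftrightarrow>
     (\<forall>i. line (g i) \<and> line (h i)) \<and>
     (\<forall>i j. i \<noteq> j \<longrightarrow>
        g i \<noteq> h j \<and> R i j \<in> g i \<inter> h j \<and>
        line (I i j) \<and> R i j \<in> I i j \<and>
        meets_orthogonally (I i j) (g i) \<and> meets_orthogonally (I i j) (h j)) \<and>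
     (\<forall>i j k l. {i, j, k, l} = UNIV \<longrightarrow> bennett_isogram (loop R i l j k) (loop I i l j k)) \<and>
     coherent_sides R"

text \<open>A placement moves the body \<open>\<Gamma>\<^sub>i\<close> by \<^term>\<open>A i\<close> and the body \<open>\<Delta>\<^sub>j\<close> by
  \<^term>\<open>B j\<close> out of the reference pose. A revolute joint admits exactly the relative rotations
  about the hinge, so the two motions have to agree at every point of the hinge.\<close>

type_synonym placement = "(4 \<Rightarrow> space \<Rightarrow> space) \<times> (4 \<Rightarrow> space \<Rightarrow> space)"

definition pose :: "(4 \<Rightarrow> 4 \<Rightarrow> space set) \<Rightarrow> placement \<Rightarrow> bool" where
  "pose I = (\<lambda>(A, B). (\<forall>i. rigid_motion (A i) \<and> rigid_motion (B i)) \<and>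
     (\<forall>i j. i \<noteq> j \<longrightarrow> (\<forall>x\<in>I i j. A i x = B j x)))"

definition non_aligned :: "(4 \<Rightarrow> space set) \<Rightarrow> (4 \<Rightarrow> space set) \<Rightarrow> placement \<Rightarrow> bool" where
  "non_aligned g h = (\<lambda>(A, B). \<forall>i j. i \<noteq> j \<longrightarrow> A i ` g i \<noteq> B j ` h j)"

text \<open>Poses up to rigid motions: every class has exactly one member in which \<open>\<Gamma>\<^sub>0\<close> stays in its
  reference position. Placements carry the topology of pointwise convergence.\<close>

definition relative_placement :: "placement \<Rightarrow> placement" where
  "relative_placement = (\<lambda>(A, B). (\<lambda>i. inv (A 0) \<circ> A i, \<lambda>j. inv (A 0) \<circ> B j))"

definition relative_poses :: "(4 \<Rightarrow> 4 \<Rightarrow> space set) \<Rightarrow> placement set" where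
  "relative_poses I = relative_placement ` {p. pose I p}"

text \<open>A continuous motion starting at the given pose that never repeats a relative position of the
  bodies.\<close>

definition continuously_flexible :: "(4 \<Rightarrow> 4 \<Rightarrow> space set) \<Rightarrow> placement \<Rightarrow> bool" where
  "continuously_flexible I p \<longleftrightarrow>
     (\<exists>q :: real \<Rightarrow> placement. continuous_on {0..1} q \<and> q 0 = p \<and>
        (\<forall>t\<in>{0..1}. pose I (q t)) \<and> inj_on (relative_placement \<circ> q) {0..1})"

definition poses_locally_one_dimensional :: "(4 \<Rightarrow> 4 \<Rightarrow> space set) \<Rightarrow> placement \<Rightarrow> bool" where
  "poses_locally_one_dimensional I p \<longleftrightarrow>
     (\<exists>U. openin (top_of_set (relative_poses I)) U \<and> relative_placement p \<in> U \<and>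
        U homeomorphic {0<..<1::real})"

end

theory Submission
  imports Defs
begin

text \<open>With signed coordinates \<open>a\<^sub>k\<close> on the lines \<open>g\<^sub>i\<close> and \<open>b\<^sub>i\<close> on the lines \<open>h\<^sub>k\<close>, the vertices of the
  linkage are \<open>R\<^sub>i\<^sub>k = p\<^sub>i + a\<^sub>k u\<^sub>i = q\<^sub>k + b\<^sub>i w\<^sub>k\<close> for \<open>i \<noteq> k\<close> with unit vectors \<open>u\<^sub>i\<close>, \<open>w\<^sub>k\<close>.
    The closed chains amount to
  \<open>(a\<^sub>l - a\<^sub>k) (u\<^sub>i - u\<^sub>j) = (b\<^sub>j - b\<^sub>i) (w\<^sub>k - w\<^sub>l)\<close> whenever \<open>i, j, k, l\<close> are distinct. Hence the
  angle \<open>\<theta>\<^sub>i\<^sub>k\<close> between \<open>u\<^sub>i\<close> and \<open>w\<^sub>k\<close> takes only three values, and the twist angles depend only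
    on the ratios of the
  numbers \<open>tan (\<theta>\<^sub>i\<^sub>k / 2)\<close>. Multiplying all of them by a common factor \<open>t > 0\<close> gives the
    one-parameter motion, and every
  pose with the same signs of \<open>sin \<theta>\<^sub>i\<^sub>k\<close> arises in this way.

  For the geometry of one pose, the closing conditions show that the vectors \<open>u\<^sub>i\<close> have the same
  component along a common normal direction \<open>N\<close>, and likewise the \<open>w\<^sub>k\<close>. In the plane orthogonal to \<open>N\<close>,
  read as the complex plane with suitable real axis, \<open>u\<^sub>i\<close> points in the direction \<open>z\<^sub>i\<close> and \<open>w\<^sub>i\<close>
    in the direction
  of the conjugate of \<open>z\<^sub>i\<close>, where \<open>z\<^sub>0 z\<^sub>1 z\<^sub>2 z\<^sub>3 = 1\<close>, and \<open>a\<^sub>k\<close>, \<open>b\<^sub>i\<close> are affine functions of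
    \<open>Re (c z\<^sub>k)\<close> and
  \<open>Re (cnj c z\<^sub>i)\<close>. This yields an explicit axis \<open>n\<close> in direction \<open>N\<close> from which all \<open>g\<^sub>i\<close> have
    the same signed
  distance, with feet at heights \<open>H\<^sub>i\<close> of sum zero, while the feet of the \<open>h\<^sub>i\<close> have the heights \<open>-H\<^sub>i\<close>.\<close>

text \<open>Two obstacles shape the proof. One is to exclude further poses nearby. On one body, the
  twist between two hinges gives an equation in x and 1/x, where x is the ratio of the half-angle
  tangents of the two joints; alone it may have two positive solutions. A neighbouring body of the
  same isogram gives the same equation with the length ratio r replaced by 1/r, and the two together
  determine x. So a single parameter t is left, and the poses it describes are cut out by strict
  inequalities for signed sines, hence form an open set with t as a global coordinate. The other
  obstacle is to show that the bodies stay rigid along the flex. An algebraic identity keeps the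
  cosines of all twists. Their sines are then fixed up to sign, and the sign cannot jump because the
  flex is continuous on the connected set t > 0 and is the identity at t = 1. Every relation needed
  among the lengths \<open>a\<close>, \<open>b\<close> is read off from a pose that exists, instead
  of being derived from the sine rule of the isograms; the pose under consideration always serves as
  the new reference.\<close>

unbundle cross3_syntax

section \<open>Lines\<close>

definition pline :: "space \<Rightarrow> space \<Rightarrow> space set" where
  "pline p d = range (\<lambda>t. p + t *\<^sub>R d)"

lemma pline_base [simp]: "p \<in> pline p d"
  unfolding pline_def by (rule image_eqI[of _ _ 0]) auto

lemma mem_plineI: "x = p + t *\<^sub>R d \<Longrightarrow> x \<in> pline p d"
  unfolding pline_def by auto

lemma mem_plineE:
  assumes "x \<in> pline p d"
  obtains t where "x = p + t *\<^sub>R d"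
  using assms unfolding pline_def by auto

lemma pline_scale: "c \<noteq> 0 \<Longrightarrow> pline p (c *\<^sub>R d) = pline p d"
proof -
  assume c: "c \<noteq> 0"
  show ?thesis
  proof (intro equalityI subsetI)
    fix x assume "x \<in> pline p (c *\<^sub>R d)"
    then obtain t where "x = p + t *\<^sub>R c *\<^sub>R d" by (rule mem_plineE)
    then show "x \<in> pline p d" by (intro mem_plineI[of _ _ "t * c"]) simp
  next
    fix x assume "x \<in> pline p d"
    then obtain t where "x = p + t *\<^sub>R d" by (rule mem_plineE)
    then show "x \<in> pline p (c *\<^sub>R d)" using c by (intro mem_plineI[of _ _ "t / c"]) simp
  qed
qed

lemma pline_shift: "x \<in> pline p d \<Longrightarrow> pline p d = pline x d"
proof -
  assume "x \<in> pline p d"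
  then obtain s where x: "x = p + s *\<^sub>R d" by (rule mem_plineE)
  show ?thesis
  proof (intro equalityI subsetI)
    fix y assume "y \<in> pline p d"
    then obtain t where "y = p + t *\<^sub>R d" by (rule mem_plineE)
    then show "y \<in> pline x d" by (intro mem_plineI[of _ _ "t - s"]) (simp add: x algebra_simps)
  next
    fix y assume "y \<in> pline x d"
    then obtain t where "y = x + t *\<^sub>R d" by (rule mem_plineE)
    then show "y \<in> pline p d" by (intro mem_plineI[of _ _ "t + s"]) (simp add: x algebra_simps)
  qed
qed

lemma affine_hull_pline: "affine hull {a, b} = pline a (b - a)"
  unfolding affine_hull_2_alt pline_def by simp

lemma line_pline: "d \<noteq> 0 \<Longrightarrow> line (pline p d)"
  unfolding line_def by (rule exI[of _ p], rule exI[of _ "p + d"]) (simp add: affine_hull_pline)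

lemma lineE:
  assumes "line L"
  obtains p d where "norm d = 1" "L = pline p d"
proof -
  from assms obtain a b where ab: "a \<noteq> b" "L = affine hull {a, b}" unfolding line_def by auto
  have "L = pline a ((1 / norm (b - a)) *\<^sub>R (b - a))"
    using ab by (subst pline_scale) (auto simp: affine_hull_pline)
  moreover have "norm ((1 / norm (b - a)) *\<^sub>R (b - a)) = 1" using ab by simp
  ultimately show ?thesis by (intro that) auto
qed

lemma line_pline_through:
  assumes "line L" "x \<in> L"
  obtains d where "norm d = 1" "L = pline x d"
proof -
  obtain p d where "norm d = 1" "L = pline p d" using assms(1) by (rule lineE)
  then show ?thesis using pline_shift[of x p d] assms(2) that by auto
qed

lemma line_two_points:
  assumes "line L" "x \<in> L" "y \<in> L" "x \<noteq> y"
  shows "L = pline x (y - x)"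
proof -
  obtain d where d: "norm d = 1" "L = pline x d" using assms(1,2) by (rule line_pline_through)
  then obtain t where t: "y = x + t *\<^sub>R d" using assms(3) by (auto elim: mem_plineE)
  then have "t \<noteq> 0" using assms(4) by auto
  then show ?thesis using d t pline_scale[of t x d] by simp
qed

lemma meets_orthogonally_pline:
  "meets_orthogonally (pline p d) (pline q e) \<longleftrightarrow> pline p d \<inter> pline q e \<noteq> {} \<and> d \<bullet> e = 0"
proof
  assume *: "meets_orthogonally (pline p d) (pline q e)"
  have "((p + d) - p) \<bullet> ((q + e) - q) = 0"
    using * mem_plineI[of "p + d" p 1 d] mem_plineI[of "q + e" q 1 e] pline_base[of p d]
      pline_base[of q e]
    unfolding meets_orthogonally_def by (metis scaleR_one)
  then show "pline p d \<inter> pline q e \<noteq> {} \<and> d \<bullet> e = 0"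
    using * unfolding meets_orthogonally_def by simp
next
  assume *: "pline p d \<inter> pline q e \<noteq> {} \<and> d \<bullet> e = 0"
  have "(x - y) \<bullet> (z - w) = 0"
    if "x \<in> pline p d" "y \<in> pline p d" "z \<in> pline q e" "w \<in> pline q e" for x y z w
  proof -
    obtain a b s t where "x = p + a *\<^sub>R d" "y = p + b *\<^sub>R d" "z = q + s *\<^sub>R e" "w = q + t *\<^sub>R e"
      using \<open>x \<in> _\<close> \<open>y \<in> _\<close> \<open>z \<in> _\<close> \<open>w \<in> _\<close> by (metis mem_plineE)
    then have "x - y = (a - b) *\<^sub>R d" "z - w = (s - t) *\<^sub>R e" by (simp_all add: algebra_simps)
    then show ?thesis using * by simp
  qed
  then show "meets_orthogonally (pline p d) (pline q e)"
    using * unfolding meets_orthogonally_def by auto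
qed

lemma unit_direction_pline:
  assumes "norm d = 1"
  shows "unit_direction (pline p d) u \<longleftrightarrow> u = d \<or> u = - d"
proof
  assume u: "unit_direction (pline p d) u"
  then have "p + u \<in> pline p d" unfolding unit_direction_def by simp
  then obtain t where "p + u = p + t *\<^sub>R d" by (rule mem_plineE)
  then have t: "u = t *\<^sub>R d" by simp
  moreover have "\<bar>t\<bar> = 1" using u assms unfolding unit_direction_def t by simp
  ultimately show "u = d \<or> u = - d" by (auto simp: abs_if split: if_splits)
next
  assume u: "u = d \<or> u = - d"
  then obtain c where c: "u = c *\<^sub>R d" "\<bar>c\<bar> = 1" by (metis abs_1 abs_minus_cancel scaleR_one
    scaleR_minus_left)
  have "x + u \<in> pline p d" if x: "x \<in> pline p d" for x
  proof -
    obtain t where "x = p + t *\<^sub>R d" using x by (rule mem_plineE)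
    then show ?thesis using c by (intro mem_plineI[of _ _ "t + c"]) (simp add: algebra_simps)
  qed
  then show "unit_direction (pline p d) u" using u assms unfolding unit_direction_def by auto
qed

lemma closest_point_pline:
  assumes "norm d = 1"
  shows "closest_point (pline p d) x = p + ((x - p) \<bullet> d) *\<^sub>R d"
proof -
  let ?c = "p + ((x - p) \<bullet> d) *\<^sub>R d"
  have conv: "convex (pline p d)" "closed (pline p d)"
    using affine_hull_pline[of p "p + d"] affine_imp_convex[OF affine_affine_hull, of "{p, p + d}"]
      closed_affine_hull[of "{p, p + d}"] by simp_all
  have "dist x ?c \<le> dist x y" if y: "y \<in> pline p d" for y
  proof -
    obtain t where t: "y = p + t *\<^sub>R d" using y by (rule mem_plineE)
    have dd: "d \<bullet> d = 1" using assms by (simp add: norm_eq_1)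
    have "(dist x y)\<^sup>2 = (dist x ?c)\<^sup>2 + (t - (x - p) \<bullet> d)\<^sup>2"
      unfolding dist_norm power2_norm_eq_inner t using dd
      by (simp add: inner_diff_left inner_diff_right inner_add_left inner_add_right inner_commute
          power2_eq_square algebra_simps)
    then have "(dist x ?c)\<^sup>2 \<le> (dist x y)\<^sup>2" by simp
    then show ?thesis by (rule power2_le_imp_le) simp
  qed
  then show ?thesis
    using conv by (intro closest_point_unique[symmetric]) (auto intro: mem_plineI)
qed

lemma halfturn_pline:
  assumes "norm d = 1"
  shows "halfturn (pline p d) x = 2 *\<^sub>R p + (2 * ((x - p) \<bullet> d)) *\<^sub>R d - x"
  unfolding halfturn_def closest_point_pline[OF assms] by (simp add: scaleR_add_right)

lemma midpoint_mem_axis: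
  assumes "line s" "halfturn s x = y"
  shows "(1/2) *\<^sub>R (x + y) \<in> s"
proof -
  obtain p d where s: "norm d = 1" "s = pline p d" using assms(1) by (rule lineE)
  have "(1/2) *\<^sub>R (x + y) = closest_point s x" using assms(2) unfolding halfturn_def by auto
  also have "\<dots> \<in> s" using s by (auto simp: closest_point_pline intro: mem_plineI)
  finally show ?thesis .
qed

section \<open>Rigid motions\<close>

text \<open>For a rigid motion this is its rotation. Expressed by \<open>f\<close> alone, it unfolds
  to the vector part of \<open>move_oline\<close>.\<close>

definition lin :: "(space \<Rightarrow> space) \<Rightarrow> space \<Rightarrow> space" where
  "lin f v = f v - f 0"

lemma rigid_motionE:
  assumes "rigid_motion f"
  obtains Q where "rotation_matrix Q" "lin f = (*v) Q"
proof -
  obtain Q v where Q: "rotation_matrix Q" "f = (\<lambda>x. Q *v x + v)"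
    using assms unfolding rigid_motion_def by blast
  show ?thesis by (rule that[of Q]) (auto simp: Q lin_def)
qed

lemma rigid_motion_eq:
  assumes "rigid_motion f"
  shows "f (x + y) = f x + lin f y"
proof -
  obtain Q where Q: "rotation_matrix Q" "lin f = (*v) Q"
    using assms by (rule rigid_motionE)
  have "lin f (x + y) = lin f x + lin f y" unfolding Q(2) by (rule matrix_vector_right_distrib)
  then show ?thesis by (simp add: lin_def algebra_simps)
qed

lemma rigid_motion_point: "rigid_motion f \<Longrightarrow> f x = f y + lin f (x - y)"
  using rigid_motion_eq[of f y "x - y"] by simp

lemma lin_linear:
  assumes "rigid_motion f"
  shows "linear (lin f)"
proof -
  obtain Q where Q: "rotation_matrix Q" "lin f = (*v) Q"
    using assms by (rule rigid_motionE)
  show ?thesis unfolding Q(2) by simp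
qed

lemma lin_cross:
  assumes "rigid_motion f"
  shows "lin f (x \<times> y) = lin f x \<times> lin f y"
proof -
  obtain Q where Q: "rotation_matrix Q" "lin f = (*v) Q"
    using assms by (rule rigid_motionE)
  show ?thesis unfolding Q(2) using cross_rotation_matrix[OF Q(1)] by simp
qed

lemma lin_inner:
  assumes "rigid_motion f"
  shows "lin f x \<bullet> lin f y = x \<bullet> y"
proof -
  obtain Q where Q: "rotation_matrix Q" "lin f = (*v) Q"
    using assms by (rule rigid_motionE)
  have "orthogonal_transformation ((*v) Q)"
    using Q(1) by (simp add: orthogonal_transformation_matrix rotation_matrix_def)
  then show ?thesis unfolding Q(2) by (simp add: orthogonal_transformation_def)
qed

lemma lin_norm: "rigid_motion f \<Longrightarrow> norm (lin f x) = norm x"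
  by (simp add: norm_eq_sqrt_inner lin_inner)

text \<open>An orthogonal matrix multiplies cross products by its determinant. A map that respects
  them exactly must have determinant 1, because some cross product has a nonzero image.\<close>

lemma lin_rotation_matrix:
  fixes L :: "space \<Rightarrow> space"
  assumes "linear L" "\<And>x y. L x \<bullet> L y = x \<bullet> y" "\<And>x y. L (x \<times> y) = L x \<times> L y"
  shows "rotation_matrix (matrix L)" "L x = matrix L *v x"
proof -
  show eq: "L x = matrix L *v x" for x using assms(1) by (simp add: matrix_works)
  have orth: "orthogonal_matrix (matrix L)"
    using assms(1,2) orthogonal_transformation_matrix[of L] by (simp add: orthogonal_transformation_def)
  let ?e = "axis 1 1 :: space" and ?f = "axis 2 1 :: space"
  have "L ?e \<times> L ?f = det (matrix L) *\<^sub>R L (?e \<times> ?f)"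
    using cross_orthogonal_matrix[OF orth, of ?e ?f] by (simp add: eq)
  then have "(1 - det (matrix L)) *\<^sub>R L (?e \<times> ?f) = 0"
    using assms(3) by (simp add: algebra_simps)
  moreover have "L (?e \<times> ?f) \<noteq> 0"
  proof
    assume "L (?e \<times> ?f) = 0"
    then have "(?e \<times> ?f) \<bullet> (?e \<times> ?f) = 0" using assms(2)[of "?e \<times> ?f" "?e \<times> ?f"] by simp
    then show False by (simp add: cross_basis)
  qed
  ultimately show "rotation_matrix (matrix L)" using orth by (simp add: rotation_matrix_def)
qed

lemma rigid_motionI:
  assumes "linear L" "\<And>x y. L x \<bullet> L y = x \<bullet> y" "\<And>x y. L (x \<times> y) = L x \<times> L y"
    and "\<And>x. f x = L x + v"
  shows "rigid_motion f"
proof -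
  have "f = (\<lambda>x. matrix L *v x + v)"
    by (rule ext) (simp only: assms(4) lin_rotation_matrix(2)[OF assms(1-3), symmetric])
  then show ?thesis
    unfolding rigid_motion_def using lin_rotation_matrix(1)[OF assms(1-3)] by blast
qed

lemma rigid_motion_id: "rigid_motion id"
  by (rule rigid_motionI[of id id 0]) (simp_all add: linear_id)

lemma lin_compose: "rigid_motion f \<Longrightarrow> rigid_motion g \<Longrightarrow> lin (f \<circ> g) x = lin f (lin g x)"
proof -
  assume f: "rigid_motion f" and g: "rigid_motion g"
  have "lin (f \<circ> g) x = f (g x) - f (g 0)" by (simp add: lin_def)
  also have "\<dots> = lin f (g x - g 0)"
    by (subst rigid_motion_point[OF f, of "g x" "g 0"]) simp
  finally show ?thesis by (simp only: lin_def[of g])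
qed

lemma rigid_motion_compose: "rigid_motion f \<Longrightarrow> rigid_motion g \<Longrightarrow> rigid_motion (f \<circ> g)"
proof -
  assume f: "rigid_motion f" and g: "rigid_motion g"
  show ?thesis
  proof (rule rigid_motionI)
    show "linear (\<lambda>x. lin f (lin g x))"
      using linear_compose[OF lin_linear[OF g] lin_linear[OF f]] by (simp add: o_def)
    show "(f \<circ> g) x = lin f (lin g x) + (f \<circ> g) 0" for x
      unfolding lin_compose[OF f g, symmetric] by (simp add: lin_def)
  qed (simp_all add: lin_inner lin_cross f g)
qed

lemma rigid_motion_bij: "rigid_motion f \<Longrightarrow> bij f"
proof -
  assume f: "rigid_motion f"
  have inj: "inj (lin f)"
  proof (rule injI)
    fix x y assume "lin f x = lin f y"
    then have "lin f (x - y) = 0" using linear_diff[OF lin_linear[OF f]] by simp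
    then have "norm (x - y) = 0" using lin_norm[OF f, of "x - y"] by simp
    then show "x = y" by simp
  qed
  then have "bij (lin f)"
    using linear_injective_imp_surjective[OF lin_linear[OF f]] by (simp add: bij_def)
  moreover have "bij (\<lambda>y. y + f 0)"
    by (rule bij_betw_byWitness[of _ "\<lambda>y. y - f 0"]) auto
  ultimately have "bij ((\<lambda>y. y + f 0) \<circ> lin f)" by (rule bij_comp)
  moreover have "f = (\<lambda>y. y + f 0) \<circ> lin f" by (rule ext) (simp add: lin_def)
  ultimately show ?thesis by simp
qed

lemma rigid_motion_inv: "rigid_motion f \<Longrightarrow> rigid_motion (inv f)"
proof -
  assume f: "rigid_motion f"
  obtain Q where Q: "rotation_matrix Q" "lin f = (*v) Q"
    using f by (rule rigid_motionE)
  have fx: "f x = Q *v x + f 0" for x using fun_cong[OF Q(2), of x] by (simp add: lin_def algebra_simps)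
  have oQ: "orthogonal_matrix Q" using Q(1) by (simp add: rotation_matrix_def)
  have QT: "rotation_matrix (transpose Q)"
    using Q(1) by (simp add: rotation_matrix_def orthogonal_matrix_transpose)
  have "inv f y = transpose Q *v y + - (transpose Q *v f 0)" for y
  proof -
    have "f (transpose Q *v y + - (transpose Q *v f 0)) = y"
      using oQ by (subst fx)
        (simp add: matrix_vector_mult_diff_distrib matrix_vector_mul_assoc orthogonal_matrix_def
          del: transpose_matrix_vector)
    then show ?thesis by (rule inv_f_eq[OF bij_is_inj[OF rigid_motion_bij[OF f]]])
  qed
  then have "inv f = (\<lambda>y. transpose Q *v y + - (transpose Q *v f 0))" by (rule ext)
  then show ?thesis unfolding rigid_motion_def using QT by (intro exI conjI)
qed

lemma rigid_motion_image_pline: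
  "rigid_motion f \<Longrightarrow> f ` pline p d = pline (f p) (lin f d)"
  unfolding pline_def
  by (simp add: image_image rigid_motion_eq linear_scale[OF lin_linear])

section \<open>Orthonormal frames\<close>

text \<open>The third vector is always \<open>e \<times> f\<close>, so every frame is right-handed
  and a map between frames is a rotation, never a reflection.\<close>

definition frame :: "space \<Rightarrow> space \<Rightarrow> bool" where
  "frame e f \<longleftrightarrow> norm e = 1 \<and> norm f = 1 \<and> e \<bullet> f = 0"

lemma frame_inner:
  assumes "frame e f"
  shows "e \<bullet> e = 1" "f \<bullet> f = 1" "e \<bullet> f = 0" "f \<bullet> e = 0" "e \<bullet> (e \<times> f) = 0" "f \<bullet> (e \<times> f) = 0"
    "(e \<times> f) \<bullet> e = 0" "(e \<times> f) \<bullet> f = 0" "(e \<times> f) \<bullet> (e \<times> f) = 1"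
  using assms by (auto simp: frame_def norm_eq_1 inner_commute dot_cross_self dot_cross)

lemma frame_cross:
  assumes "frame e f"
  shows "f \<times> (e \<times> f) = e" "(e \<times> f) \<times> e = f" "e \<times> (e \<times> f) = - f" "(e \<times> f) \<times> f = - e"
proof -
  show "f \<times> (e \<times> f) = e" using frame_inner[OF assms] by (simp add: Lagrange)
  show "e \<times> (e \<times> f) = - f" using frame_inner[OF assms] by (simp add: Lagrange)
  show "(e \<times> f) \<times> e = f"
    using frame_inner[OF assms] by (subst cross_skew) (simp add: Lagrange)
  show "(e \<times> f) \<times> f = - e"
    using frame_inner[OF assms] by (subst cross_skew) (simp add: Lagrange)
qed

text \<open>The error vector \<open>y\<close> is orthogonal to all three frame vectors. By the
  Lagrange formula its cross product with \<open>e \<times> f\<close> vanishes too, and a vector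
  that is orthogonal and parallel to a nonzero vector is zero.\<close>

lemma frame_expand:
  assumes "frame e f"
  shows "x = (x \<bullet> e) *\<^sub>R e + (x \<bullet> f) *\<^sub>R f + (x \<bullet> (e \<times> f)) *\<^sub>R (e \<times> f)"
proof -
  define y where "y = x - ((x \<bullet> e) *\<^sub>R e + (x \<bullet> f) *\<^sub>R f + (x \<bullet> (e \<times> f)) *\<^sub>R (e \<times> f))"
  have y: "y \<bullet> e = 0" "y \<bullet> f = 0" "y \<bullet> (e \<times> f) = 0"
    unfolding y_def using frame_inner[OF assms] by (simp_all add: inner_diff_left inner_add_left)
  have "y \<times> (e \<times> f) = 0" using y by (simp add: Lagrange)
  then have "y = 0 \<or> e \<times> f = 0" using y(3) norm_and_cross_eq_0 by blast
  moreover have "e \<times> f \<noteq> 0" using frame_inner(9)[OF assms] by auto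
  ultimately show ?thesis unfolding y_def by simp
qed

definition frame_map :: "space \<Rightarrow> space \<Rightarrow> space \<Rightarrow> space \<Rightarrow> space \<Rightarrow> space" where
  "frame_map e f e' f' x = (x \<bullet> e) *\<^sub>R e' + (x \<bullet> f) *\<^sub>R f' + (x \<bullet> (e \<times> f)) *\<^sub>R (e' \<times> f')"

lemma frame_map_linear: "linear (frame_map e f e' f')"
  by (rule linearI) (simp_all add: frame_map_def inner_add_left algebra_simps)

lemma frame_map_basis:
  assumes "frame e f"
  shows "frame_map e f e' f' e = e'" "frame_map e f e' f' f = f'"
    "frame_map e f e' f' (e \<times> f) = e' \<times> f'"
  using frame_inner[OF assms] by (simp_all add: frame_map_def)

lemma frame_map_id: "frame e f \<Longrightarrow> frame_map e f e f x = x"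
  using frame_expand[of e f x] by (simp add: frame_map_def)

lemma frame_map_inner:
  assumes "frame e f" "frame e' f'"
  shows "frame_map e f e' f' x \<bullet> frame_map e f e' f' y = x \<bullet> y"
proof -
  have "x \<bullet> y = (x \<bullet> e) * (y \<bullet> e) + (x \<bullet> f) * (y \<bullet> f) + (x \<bullet> (e \<times> f)) * (y \<bullet> (e \<times> f))"
    by (subst frame_expand[OF assms(1), of y]) (simp add: inner_add_right)
  then show ?thesis
    unfolding frame_map_def using frame_inner[OF assms(2)]
    by (simp add: inner_add_left inner_add_right)
qed

lemma frame_map_cross:
  assumes "frame e f" "frame e' f'"
  shows "frame_map e f e' f' (x \<times> y) = frame_map e f e' f' x \<times> frame_map e f e' f' y"
proof -
  let ?g = "e \<times> f" and ?g' = "e' \<times> f'" and ?F = "frame_map e f e' f'"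
  \<comment> \<open>The multiplication table is the same in all right-handed frames, so it can be
    read in the source frame and in the target frame.\<close>
  have cr: "(a1 *\<^sub>R e + a2 *\<^sub>R f + a3 *\<^sub>R (e \<times> f)) \<times> (b1 *\<^sub>R e + b2 *\<^sub>R f + b3 *\<^sub>R (e \<times> f))
     = (a2 * b3 - a3 * b2) *\<^sub>R e + (a3 * b1 - a1 * b3) *\<^sub>R f + (a1 * b2 - a2 * b1) *\<^sub>R (e \<times> f)"
    if "frame e f" for e f a1 a2 a3 b1 b2 b3
    using frame_cross[OF that] cross_skew[of f e]
    by (simp add: cross_add_left cross_add_right cross_mult_left cross_mult_right algebra_simps)
  have "x \<times> y = ((x \<bullet> f) * (y \<bullet> ?g) - (x \<bullet> ?g) * (y \<bullet> f)) *\<^sub>R e +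
      ((x \<bullet> ?g) * (y \<bullet> e) - (x \<bullet> e) * (y \<bullet> ?g)) *\<^sub>R f +
      ((x \<bullet> e) * (y \<bullet> f) - (x \<bullet> f) * (y \<bullet> e)) *\<^sub>R ?g"
    using cr[OF assms(1), of "x \<bullet> e" "x \<bullet> f" "x \<bullet> ?g" "y \<bullet> e" "y \<bullet> f" "y \<bullet> ?g"]
      frame_expand[OF assms(1), of x] frame_expand[OF assms(1), of y] by simp
  then have "?F (x \<times> y) = ((x \<bullet> f) * (y \<bullet> ?g) - (x \<bullet> ?g) * (y \<bullet> f)) *\<^sub>R e' +
      ((x \<bullet> ?g) * (y \<bullet> e) - (x \<bullet> e) * (y \<bullet> ?g)) *\<^sub>R f' +
      ((x \<bullet> e) * (y \<bullet> f) - (x \<bullet> f) * (y \<bullet> e)) *\<^sub>R ?g'"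
    using frame_map_basis[OF assms(1), of e' f']
    by (simp add: linear_add[OF frame_map_linear] linear_scale[OF frame_map_linear])
  also have "\<dots> = ?F x \<times> ?F y"
    unfolding frame_map_def by (rule cr[OF assms(2), symmetric])
  finally show ?thesis .
qed

lemma frame_map_rigid:
  assumes "frame e f" "frame e' f'"
  shows "rigid_motion (\<lambda>x. p' + frame_map e f e' f' (x - p))"
    "lin (\<lambda>x. p' + frame_map e f e' f' (x - p)) = frame_map e f e' f'"
proof -
  have eq: "p' + frame_map e f e' f' (x - p) = frame_map e f e' f' x + (p' - frame_map e f e' f'
    p)" for x
    by (simp add: linear_diff[OF frame_map_linear])
  show "rigid_motion (\<lambda>x. p' + frame_map e f e' f' (x - p))"
    by (rule rigid_motionI[OF frame_map_linear[of e f e' f'], of _ "p' - frame_map e f e' f' p"])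
      (simp_all add: frame_map_inner frame_map_cross assms eq)
  show "lin (\<lambda>x. p' + frame_map e f e' f' (x - p)) = frame_map e f e' f'"
    unfolding lin_def eq by (rule ext) (simp add: frame_map_def)
qed

text \<open>One point and two frame vectors fix a rigid motion. In this way the placement of a body
  is recovered from the directions of its line and of one hinge.\<close>

lemma rigid_motion_frame:
  assumes "rigid_motion F" "frame e f"
  shows "F x = F p + frame_map e f (lin F e) (lin F f) (x - p)"
proof -
  have eq: "lin F y = frame_map e f (lin F e) (lin F f) y" for y
  proof -
    have "lin F y = lin F ((y \<bullet> e) *\<^sub>R e + (y \<bullet> f) *\<^sub>R f + (y \<bullet> (e \<times> f)) *\<^sub>R (e \<times> f))"
      using frame_expand[OF assms(2), of y] by simp
    also have "\<dots> = frame_map e f (lin F e) (lin F f) y"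
      unfolding frame_map_def linear_add[OF lin_linear[OF assms(1)]]
        linear_scale[OF lin_linear[OF assms(1)]] lin_cross[OF assms(1)] ..
    finally show ?thesis .
  qed
  have "F x = F p + lin F (x - p)" by (rule rigid_motion_point[OF assms(1)])
  also have "lin F (x - p) = frame_map e f (lin F e) (lin F f) (x - p)" by (rule eq)
  finally show ?thesis .
qed

section \<open>Indices modulo 4\<close>

lemma exhaust_mod4: "(i::4) = 0 \<or> i = 1 \<or> i = 2 \<or> i = 3"
proof -
  have "(4::4) = 0" by simp
  then show ?thesis using exhaust_4[of i] by metis
qed

lemma UNIV_mod4: "(UNIV :: 4 set) = {0, 1, 2, 3}"
  using exhaust_mod4 by auto

lemma four_distinct_iff: "{i, j, k, l} = (UNIV :: 4 set) \<longleftrightarrow> distinct [i, j, k, l]"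
proof
  assume "{i, j, k, l} = (UNIV :: 4 set)"
  then have "card (set [i, j, k, l]) = 4" by simp
  then show "distinct [i, j, k, l]" using card_distinct[of "[i, j, k, l]"] by simp
next
  assume "distinct [i, j, k, l]"
  then have "card (set [i, j, k, l]) = 4" by (subst distinct_card) auto
  then have "set [i, j, k, l] = UNIV" by (intro card_subset_eq) auto
  then show "{i, j, k, l} = UNIV" by simp
qed

lemma fourth_index:
  assumes "distinct [i, j, k :: 4]"
  obtains l where "distinct [i, j, k, l]"
proof -
  have "\<exists>l. l \<notin> {i, j, k}"
  proof (rule ccontr)
    assume "\<nexists>l. l \<notin> {i, j, k}"
    then have "card (UNIV :: 4 set) \<le> card {i, j, k}" by (intro card_mono) auto
    moreover have "card {i, j, k} \<le> 3" by (simp add: card_insert_if)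
    ultimately show False by simp
  qed
  then obtain l where "l \<notin> {i, j, k}" by blast
  then show ?thesis using assms by (intro that[of l]) auto
qed

lemma third_fourth_index:
  assumes "i \<noteq> (j :: 4)"
  obtains k l where "distinct [i, j, k, l]"
proof -
  have "\<exists>k. k \<notin> {i, j}"
  proof (rule ccontr)
    assume "\<nexists>k. k \<notin> {i, j}"
    then have "card (UNIV :: 4 set) \<le> card {i, j}" by (intro card_mono) auto
    moreover have "card {i, j} \<le> 2" by (simp add: card_insert_if)
    ultimately show False by simp
  qed
  then obtain k where "k \<notin> {i, j}" by blast
  then have "distinct [i, j, k]" using assms by auto
  then show ?thesis by (rule fourth_index) (rule that)
qed

section \<open>Directions of a net of isograms\<close>

text \<open>Walking round the quadrilateral \<open>R i k\<close>, \<open>R i l\<close>,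
  \<open>R j l\<close>, \<open>R j k\<close> cancels all base points; what remains is
  \<open>closing\<close>. Injectivity says that no side has length zero.\<close>

locale isogram_directions =
  fixes u w :: "4 \<Rightarrow> space" and a b :: "4 \<Rightarrow> real"
  assumes unit_u: "u i \<bullet> u i = 1" and unit_w: "w i \<bullet> w i = 1"
    and inj_a: "inj a" and inj_b: "inj b"
    and closing: "distinct [i, j, k, l] \<Longrightarrow>
      (a l - a k) *\<^sub>R (u i - u j) = (b j - b i) *\<^sub>R (w k - w l)"
begin

text \<open>The closing condition is symmetric in the two families of lines, so each fact about the
  bodies Gamma gives one about the bodies Delta.\<close>

lemma dual: "isogram_directions w u b a"
proof
  fix i j k l :: 4 assume d: "distinct [i, j, k, l]"
  show "(b l - b k) *\<^sub>R (w i - w j) = (a j - a i) *\<^sub>R (u k - u l)"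
    using closing[of k l i j] d by auto
qed (rule unit_u unit_w inj_a inj_b)+

lemma a_diff_nonzero: "k \<noteq> l \<Longrightarrow> a l - a k \<noteq> 0"
  using inj_a by (auto simp: inj_eq)

lemma b_diff_nonzero: "k \<noteq> l \<Longrightarrow> b l - b k \<noteq> 0"
  using inj_b by (auto simp: inj_eq)

text \<open>Rearranged, the closing condition expresses the diagonal from \<open>R j k\<close> to
  \<open>R i l\<close> in two ways. The law of cosines in the two triangles on this diagonal gives
  equal angles.\<close>

lemma inner_opposite:
  assumes "distinct [i, j, k, l]"
  shows "u i \<bullet> w k = u j \<bullet> w l"
proof -
  define A B where "A = a l - a k" and "B = b j - b i"
  have AB: "A \<noteq> 0" "B \<noteq> 0" using a_diff_nonzero b_diff_nonzero assms by (auto simp: A_def B_def)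
  have eq: "A *\<^sub>R u i - B *\<^sub>R w k = A *\<^sub>R u j - B *\<^sub>R w l"
    using closing[OF assms] unfolding A_def[symmetric] B_def[symmetric] by (simp add: algebra_simps)
  have "(A *\<^sub>R u i - B *\<^sub>R w k) \<bullet> (A *\<^sub>R u i - B *\<^sub>R w k) = A * A + B * B - 2 * A * B * (u i \<bullet> w
    k)" for i k
    using unit_u[of i] unit_w[of k]
    by (simp add: inner_diff_left inner_diff_right inner_commute[of "w k" "u i"] algebra_simps)
  from this[of i k] this[of j l] eq show ?thesis using AB by simp
qed

text \<open>This is the closing condition multiplied by \<open>w k\<close>. It ties the angle
  between two lines meeting \<open>g i\<close> to the two joint cosines, with a factor that depends
  on lengths only.\<close>

lemma one_minus_inner_w:
  assumes "distinct [i, j, k, l]"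
  shows "(a l - a k) * (u i \<bullet> w k - u i \<bullet> w l) = (b j - b i) * (1 - w k \<bullet> w l)"
proof -
  have "((a l - a k) *\<^sub>R (u i - u j)) \<bullet> w k = ((b j - b i) *\<^sub>R (w k - w l)) \<bullet> w k"
    by (simp only: closing[OF assms])
  moreover have "u j \<bullet> w k = u i \<bullet> w l" using inner_opposite[of j i k l] assms by auto
  ultimately show ?thesis
    by (simp add: inner_diff_left unit_w inner_commute[of "w l" "w k"])
qed

lemma one_minus_inner_u:
  assumes "distinct [i, j, k, l]"
  shows "(b j - b i) * (u i \<bullet> w k - u j \<bullet> w k) = (a l - a k) * (1 - u i \<bullet> u j)"
  using isogram_directions.one_minus_inner_w[OF dual, of k l i j] assms
  by (auto simp: inner_commute)

end

text \<open>The closing condition is invariant under exchanging \<open>i\<close> with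
  \<open>j\<close> and \<open>k\<close> with \<open>l\<close>, so one instance per isogram yields
  all 24.\<close>

lemma isogram_directionsI:
  assumes unit: "\<And>i. u i \<bullet> u i = 1" "\<And>i. w i \<bullet> w i = 1" and inj: "inj a" "inj b"
    and cl: "(a 3 - a 2) *\<^sub>R (u 0 - u 1) = (b 1 - b 0) *\<^sub>R (w 2 - w 3)"
      "(a 1 - a 3) *\<^sub>R (u 0 - u 2) = (b 2 - b 0) *\<^sub>R (w 3 - w 1)"
      "(a 2 - a 1) *\<^sub>R (u 0 - u 3) = (b 3 - b 0) *\<^sub>R (w 1 - w 2)"
      "(a 3 - a 0) *\<^sub>R (u 1 - u 2) = (b 2 - b 1) *\<^sub>R (w 0 - w 3)"
      "(a 1 - a 0) *\<^sub>R (u 2 - u 3) = (b 3 - b 2) *\<^sub>R (w 0 - w 1)"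
      "(a 2 - a 0) *\<^sub>R (u 3 - u 1) = (b 1 - b 3) *\<^sub>R (w 0 - w 2)"
  shows "isogram_directions u w a b"
proof
  define P where "P i j k l \<longleftrightarrow> (a l - a k) *\<^sub>R (u i - u j) = (b j - b i) *\<^sub>R (w k - w l)" for i j k l
  have swap1: "P j i k l" if "P i j k l" for i j k l
  proof -
    have "- ((a l - a k) *\<^sub>R (u i - u j)) = - ((b j - b i) *\<^sub>R (w k - w l))"
      using that by (simp add: P_def)
    then show ?thesis by (simp add: P_def algebra_simps)
  qed
  have swap2: "P i j l k" if "P i j k l" for i j k l
  proof -
    have "- ((a l - a k) *\<^sub>R (u i - u j)) = - ((b j - b i) *\<^sub>R (w k - w l))"
      using that by (simp add: P_def)
    then show ?thesis by (simp add: P_def algebra_simps)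
  qed
  have six: "P 0 1 2 3" "P 0 2 3 1" "P 0 3 1 2" "P 1 2 0 3" "P 2 3 0 1" "P 3 1 0 2"
    using cl by (simp_all add: P_def)
  note all = six six[THEN swap1] six[THEN swap2] six[THEN swap1, THEN swap2]
  fix i j k l :: 4 assume d: "distinct [i, j, k, l]"
  have "P i j k l"
    using d exhaust_mod4[of i] exhaust_mod4[of j] exhaust_mod4[of k] exhaust_mod4[of l]
    by (elim disjE) (simp_all add: all)
  then show "(a l - a k) *\<^sub>R (u i - u j) = (b j - b i) *\<^sub>R (w k - w l)" by (simp add: P_def)
qed (rule unit inj)+

text \<open>Three hinges of the body \<open>\<Gamma>\<^sub>0\<close> determine the directions of the other lines; the common
  constant \<^term>\<open>m\<close> makes the three ways to reach the eighth line agree.\<close>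

lemma completed_directions:
  fixes u0 w1 w2 w3 :: space and x y z m c1 c2 c3 :: real
  assumes unit: "u0 \<bullet> u0 = 1" "w1 \<bullet> w1 = 1" "w2 \<bullet> w2 = 1" "w3 \<bullet> w3 = 1"
    and c: "u0 \<bullet> w1 = c1" "u0 \<bullet> w2 = c2" "u0 \<bullet> w3 = c3"
    and g: "x * (1 - w2 \<bullet> w3) = c2 - c3" "y * (1 - w3 \<bullet> w1) = c3 - c1" "z * (1 - w1 \<bullet> w2) = c1 - c2"
    and m: "m * (x * y + y * z + z * x) = -1"
    and u: "u1 = u0 - x *\<^sub>R (w2 - w3)" "u2 = u0 - y *\<^sub>R (w3 - w1)" "u3 = u0 - z *\<^sub>R (w1 - w2)"
    and w0: "w0 = w3 + (m * z) *\<^sub>R (u1 - u2)"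
  shows "w0 = w1 + (m * x) *\<^sub>R (u2 - u3)" "u1 \<bullet> u1 = 1" "u1 \<bullet> w2 = c3" "u1 \<bullet> w3 = c2"
    "m * z * (1 - u1 \<bullet> u2) = c1 - c2"
proof -
  have comm: "w2 \<bullet> w1 = w1 \<bullet> w2" "w3 \<bullet> w2 = w2 \<bullet> w3" "w1 \<bullet> w3 = w3 \<bullet> w1"
    "w1 \<bullet> u0 = c1" "w2 \<bullet> u0 = c2" "w3 \<bullet> u0 = c3"
    using c by (simp_all add: inner_commute)
  define X Y where "X = w2 - w3" and "Y = w3 - w1"
  have Z: "w1 - w2 = - X - Y" by (simp add: X_def Y_def)
  have "w3 + (m * z) *\<^sub>R (u1 - u2) - (w1 + (m * x) *\<^sub>R (u2 - u3)) = (1 + m * (x * y + y * z + z *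
    x)) *\<^sub>R Y"
    unfolding u Z X_def[symmetric] Y_def[symmetric]
    by (simp add: algebra_simps) (simp add: Y_def algebra_simps)
  then show "w0 = w1 + (m * x) *\<^sub>R (u2 - u3)" using m by (simp add: w0)
  show "u1 \<bullet> w2 = c3" "u1 \<bullet> w3 = c2"
    using g(1) unfolding u by (simp_all add: inner_diff_left inner_diff_right unit c comm algebra_simps)
  have "u1 \<bullet> u1 = 1 - 2 * x * (c2 - c3) + 2 * x * (x * (1 - w2 \<bullet> w3))"
    unfolding u by (simp add: inner_diff_left inner_diff_right unit c comm algebra_simps)
  then show "u1 \<bullet> u1 = 1" unfolding g by simp
  have "u1 \<bullet> u2 = 1 - x * (c2 - c3) - y * (c3 - c1)
      + x * y * (w2 \<bullet> w3 - w1 \<bullet> w2 - 1 + w3 \<bullet> w1)"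
    unfolding u by (simp add: inner_diff_left inner_diff_right unit c comm algebra_simps)
  then have "m * z * (1 - u1 \<bullet> u2) - (c1 - c2) = (m * (x * y + y * z + z * x) + 1) * (c2 - c1)
    + m * x * y * (c1 - c2) - m * z * x * y * (1 - w1 \<bullet> w2)"
    using g(1,2) by algebra
  also have "\<dots> = 0" using m g(3) by algebra
  finally show "m * z * (1 - u1 \<bullet> u2) = c1 - c2" by simp
qed

context isogram_directions
begin

lemma norm_cross_uw: "(norm (u i \<times> w k))\<^sup>2 = 1 - (u i \<bullet> w k)\<^sup>2"
  using unit_u[of i] unit_w[of k] by (simp add: norm_cross norm_eq_1[symmetric])

lemma u_diff:
  assumes "distinct [i, j, k, l]"
  shows "u i - u j = ((b j - b i) / (a l - a k)) *\<^sub>R (w k - w l)"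
proof -
  have nz: "a l - a k \<noteq> 0" by (rule a_diff_nonzero) (use assms in auto)
  then have "u i - u j = (1 / (a l - a k)) *\<^sub>R (a l - a k) *\<^sub>R (u i - u j)" by simp
  then show ?thesis unfolding closing[OF assms] by simp
qed

end

text \<open>Differences within one family are fixed multiples of differences in the other. Hence
  \<open>u 0\<close> and its three neighbours fix all \<open>u i\<close>, and these in turn fix
  \<open>w 0 - w 3\<close>.\<close>

lemma isogram_directions_unique:
  assumes "isogram_directions u w a b" "isogram_directions u' w' a b"
    and "u' 0 = u 0" "\<And>k. k \<noteq> 0 \<Longrightarrow> w' k = w k"
  shows "u' = u" "w' = w"
proof -
  interpret A: isogram_directions u w a b by fact
  interpret B: isogram_directions u' w' a b by fact
  interpret Ad: isogram_directions w u b a by (rule A.dual)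
  interpret Bd: isogram_directions w' u' b a by (rule B.dual)
  have "u' i = u i" for i
  proof (cases "i = 0")
    case False
    then have "0 \<noteq> i" by simp
    then obtain j k where d: "distinct [0, i, j, k]" by (rule third_fourth_index)
    have "u 0 - u i = u' 0 - u' i"
      unfolding A.u_diff[OF d] B.u_diff[OF d] using assms(4)[of j] assms(4)[of k] d by auto
    then show ?thesis using assms(3) by simp
  qed (use assms(3) in simp)
  then show *: "u' = u" by auto
  have "distinct [0, 3, 1, 2 :: 4]" by simp
  from Ad.u_diff[OF this] Bd.u_diff[OF this] have "w' 0 - w' 3 = w 0 - w 3" unfolding * by simp
  then have "w' 0 = w 0" using assms(4)[of 3] by simp
  then show "w' = w" using assms(4) by (intro ext) metis
qed

text \<open>Three consecutive sides of an isogram are linearly independent, that is, its vertices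
  are not coplanar.\<close>

locale skew_directions = isogram_directions +
  assumes skew: "distinct [i, k, l] \<Longrightarrow> u i \<bullet> (w k \<times> w l) \<noteq> 0"
begin

text \<open>Substituting the closing condition turns the triple product of \<open>w k\<close>,
  \<open>u i\<close>, \<open>u j\<close> into a nonzero multiple of that of \<open>u i\<close>,
  \<open>w k\<close>, \<open>w l\<close>. Up to side lengths both measure the volume of the
  tetrahedron of the four vertices.\<close>

lemma dual_skew: "skew_directions w u b a"
proof -
  interpret dual: isogram_directions w u b a by (rule dual)
  show ?thesis
  proof
    fix k i j :: 4 assume d: "distinct [k, i, j]"
    then obtain l where l: "distinct [k, i, j, l]" by (rule fourth_index)
    define A B where "A = a l - a k" and "B = b j - b i"
    have AB: "A \<noteq> 0" "B \<noteq> 0" using a_diff_nonzero b_diff_nonzero l by (auto simp: A_def B_def)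
    have cl: "A *\<^sub>R (u i - u j) = B *\<^sub>R (w k - w l)"
      unfolding A_def B_def by (rule closing) (use l in auto)
    have "A * (w k \<bullet> (u i \<times> u j)) = - (w k \<bullet> (u i \<times> (A *\<^sub>R (u i - u j))))"
      by (simp add: cross_mult_right Cross3.right_diff_distrib)
    also have "\<dots> = B * (w k \<bullet> (u i \<times> w l))"
      unfolding cl by (simp add: cross_mult_right Cross3.right_diff_distrib inner_diff_right
        dot_cross_self)
    also have "w k \<bullet> (u i \<times> w l) = - (u i \<bullet> (w k \<times> w l))"
      by (simp add: cross3_simps)
    finally show "w k \<bullet> (u i \<times> u j) \<noteq> 0"
      using skew[of i k l] l AB by auto
  qed
qed

lemma cross_nonzero: "i \<noteq> k \<Longrightarrow> u i \<times> w k \<noteq> 0"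
proof
  assume "i \<noteq> k" and 0: "u i \<times> w k = 0"
  then obtain l j where "distinct [i, k, l, j]" using third_fourth_index by blast
  then have "u i \<bullet> (w k \<times> w l) \<noteq> 0" by (intro skew) auto
  moreover have "u i \<bullet> (w k \<times> w l) = (u i \<times> w k) \<bullet> w l"
    by (simp add: cross3_simps)
  ultimately show False using 0 by simp
qed

lemma abs_inner_less_1: "i \<noteq> k \<Longrightarrow> \<bar>u i \<bullet> w k\<bar> < 1"
  using norm_cross_uw[of i k] cross_nonzero[of i k]
  by (metis abs_square_less_1 diff_gt_0_iff_gt zero_less_norm_iff zero_less_power)

end

text \<open>Multiplying \<open>tan (\<theta>/2)\<close> by \<^term>\<open>t\<close> changes \<open>cos \<theta> = c\<close> into \<open>turn_cos t c\<close>.\<close>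

definition turn_cos :: "real \<Rightarrow> real \<Rightarrow> real" where
  "turn_cos t c = ((1 + c) - t\<^sup>2 * (1 - c)) / ((1 + c) + t\<^sup>2 * (1 - c))"

text \<open>The quotient of the new sine by the old one when the half-angle tangent is multiplied by
  \<open>t\<close>.\<close>

definition turn_scale :: "real \<Rightarrow> real \<Rightarrow> real" where
  "turn_scale t c = 2 * t / ((1 + c) + t\<^sup>2 * (1 - c))"

lemma turn_denom_pos: "\<bar>c\<bar> < 1 \<Longrightarrow> 0 < (1 + c) + t\<^sup>2 * (1 - c)" for t c :: real
  by (rule add_pos_nonneg) (auto simp: abs_less_iff)

lemma turn_pythagoras:
  assumes "\<bar>c\<bar> < 1"
  shows "(turn_cos t c)\<^sup>2 + (turn_scale t c)\<^sup>2 * (1 - c\<^sup>2) = 1"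
proof -
  define D where "D = (1 + c) + t\<^sup>2 * (1 - c)"
  have "D \<noteq> 0" using turn_denom_pos[OF assms] by (simp add: D_def less_imp_neq[symmetric])
  moreover have "((1 + c) - t\<^sup>2 * (1 - c))\<^sup>2 + (2 * t)\<^sup>2 * (1 - c\<^sup>2) = D\<^sup>2"
    unfolding D_def by algebra
  ultimately show ?thesis
    unfolding turn_cos_def turn_scale_def D_def[symmetric] by (simp add: power_divide field_simps)
qed

text \<open>The heart of the flex. On one body the cosine of a twist is
  \<open>1 - r * (c - d) - c * d\<close> divided by the two joint sines, with \<open>r\<close> a
  ratio of lengths. The numerator picks up exactly the factors that the sines pick up, so the twist
  does not change.\<close>

lemma turn_twist:
  assumes "\<bar>c\<bar> < 1" "\<bar>d\<bar> < 1"
  shows "1 - r * (turn_cos t c - turn_cos t d) - turn_cos t c * turn_cos t d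
    = turn_scale t c * turn_scale t d * (1 - r * (c - d) - c * d)"
proof -
  define D E where "D = (1 + c) + t\<^sup>2 * (1 - c)" and "E = (1 + d) + t\<^sup>2 * (1 - d)"
  have DE: "D \<noteq> 0" "E \<noteq> 0"
    using turn_denom_pos[OF assms(1)] turn_denom_pos[OF assms(2)] by (simp_all add: D_def E_def
      less_imp_neq[symmetric])
  define M N where "M = (1 + c) - t\<^sup>2 * (1 - c)" and "N = (1 + d) - t\<^sup>2 * (1 - d)"
  have "1 - r * (M / D - N / E) - M / D * (N / E) = (D * E - r * (M * E - N * D) - M * N) / (D * E)"
    using DE by (simp add: field_simps)
  also have "D * E - r * (M * E - N * D) - M * N = 2 * t * (2 * t) * (1 - r * (c - d) - c * d)"
    unfolding D_def E_def M_def N_def by algebra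
  finally show ?thesis
    unfolding turn_cos_def turn_scale_def D_def[symmetric] E_def[symmetric] M_def[symmetric]
      N_def[symmetric]
    by simp
qed

lemma turn_cos_1 [simp]: "turn_cos 1 c = c" and turn_scale_1 [simp]: "turn_scale 1 c = 1"
  by (simp_all add: turn_cos_def turn_scale_def)

lemma turn_scale_pos: "\<bar>c\<bar> < 1 \<Longrightarrow> 0 < t \<Longrightarrow> 0 < turn_scale t c"
  using turn_denom_pos[of c t] by (simp add: turn_scale_def)

lemma continuous_on_turn:
  assumes "\<bar>c\<bar> < 1"
  shows "continuous_on S (\<lambda>t. turn_cos t c)" "continuous_on S (\<lambda>t. turn_scale t c)"
  unfolding turn_cos_def turn_scale_def using turn_denom_pos[OF assms]
  by (intro continuous_intros; simp add: less_imp_neq[symmetric])+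

section \<open>Flexing the directions\<close>

context skew_directions
begin

text \<open>The coefficient in \<open>u 0 - u i = link_ratio i j k *\<^sub>R (w j - w k)\<close>;
  depending on lengths only, it is the same in all poses.\<close>

definition link_ratio :: "4 \<Rightarrow> 4 \<Rightarrow> 4 \<Rightarrow> real" where
  "link_ratio i j k = (b 0 - b i) / (a j - a k)"

text \<open>For \<open>k \<noteq> 0\<close>, the vector \<open>w k\<close> turns in its plane with
  \<open>u 0\<close>, the half-angle tangent being multiplied by \<open>t\<close>. For
  \<open>t > 0\<close> this keeps the direction of the hinge, as it must when the body of
  \<open>u 0\<close> is at rest.\<close>

definition flex_spoke :: "real \<Rightarrow> 4 \<Rightarrow> space" where
  "flex_spoke t k = turn_cos t (u 0 \<bullet> w k) *\<^sub>R u 0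
     + turn_scale t (u 0 \<bullet> w k) *\<^sub>R (w k - (u 0 \<bullet> w k) *\<^sub>R u 0)"

text \<open>Given the three spokes, the closing conditions leave no choice: they are solved first
  for the other three \<open>u i\<close>, then for \<open>w 0\<close> by one of its three
  equations.\<close>

definition flex_u :: "real \<Rightarrow> 4 \<Rightarrow> space" where
  "flex_u t = quad (u 0) (u 0 - link_ratio 1 2 3 *\<^sub>R (flex_spoke t 2 - flex_spoke t 3))
     (u 0 - link_ratio 2 3 1 *\<^sub>R (flex_spoke t 3 - flex_spoke t 1))
     (u 0 - link_ratio 3 1 2 *\<^sub>R (flex_spoke t 1 - flex_spoke t 2))"

definition flex_w :: "real \<Rightarrow> 4 \<Rightarrow> space" where
  "flex_w t = quad (flex_spoke t 3 + ((a 0 - a 3) / (b 1 - b 2)) *\<^sub>R (flex_u t 1 - flex_u t 2))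
     (flex_spoke t 1) (flex_spoke t 2) (flex_spoke t 3)"

lemma flex_simps:
  "flex_u t 0 = u 0" "flex_u t 1 = u 0 - link_ratio 1 2 3 *\<^sub>R (flex_spoke t 2 - flex_spoke t 3)"
  "flex_u t 2 = u 0 - link_ratio 2 3 1 *\<^sub>R (flex_spoke t 3 - flex_spoke t 1)"
  "flex_u t 3 = u 0 - link_ratio 3 1 2 *\<^sub>R (flex_spoke t 1 - flex_spoke t 2)"
  "flex_w t 1 = flex_spoke t 1" "flex_w t 2 = flex_spoke t 2" "flex_w t 3 = flex_spoke t 3"
  "flex_w t 0 = flex_spoke t 3 + ((a 0 - a 3) / (b 1 - b 2)) *\<^sub>R (flex_u t 1 - flex_u t 2)"
  by (simp_all add: flex_u_def flex_w_def quad_def)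

lemma inner_spoke:
  assumes "k \<noteq> 0"
  shows "u 0 \<bullet> flex_spoke t k = turn_cos t (u 0 \<bullet> w k)" "flex_spoke t k \<bullet> flex_spoke t k = 1"
proof -
  let ?c = "u 0 \<bullet> w k"
  have c: "\<bar>?c\<bar> < 1" using abs_inner_less_1[of 0 k] assms by simp
  show "u 0 \<bullet> flex_spoke t k = turn_cos t ?c"
    by (simp add: flex_spoke_def inner_add_right inner_diff_right unit_u)
  have "flex_spoke t k \<bullet> flex_spoke t k = (turn_cos t ?c)\<^sup>2 + (turn_scale t ?c)\<^sup>2 * (1 - ?c\<^sup>2)"
    by (simp add: flex_spoke_def inner_add_left inner_add_right inner_diff_left inner_diff_right
        unit_u unit_w inner_commute[of "w k" "u 0"] power2_eq_square algebra_simps)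
  then show "flex_spoke t k \<bullet> flex_spoke t k = 1" using turn_pythagoras[OF c] by simp
qed

text \<open>In the reference pose \<open>w j \<bullet> w k\<close> is 1 minus a multiple of the
  difference of the joint cosines. By \<open>turn_twist\<close> with \<open>r = 1 / ?x\<close> it
  keeps this form when both spokes turn.\<close>

lemma link_ratio_spoke:
  assumes d: "distinct [0, i, j, k]"
  shows "link_ratio i j k * (1 - flex_spoke t j \<bullet> flex_spoke t k)
    = turn_cos t (u 0 \<bullet> w j) - turn_cos t (u 0 \<bullet> w k)"
proof -
  let ?c = "u 0 \<bullet> w j" and ?d = "u 0 \<bullet> w k" and ?x = "link_ratio i j k"
  have cd: "\<bar>?c\<bar> < 1" "\<bar>?d\<bar> < 1" using abs_inner_less_1[of 0] d by auto
  have aj: "a j - a k \<noteq> 0" and "b 0 - b i \<noteq> 0"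
    using d by (auto intro!: a_diff_nonzero b_diff_nonzero simp del: right_minus_eq)
  then have x: "?x \<noteq> 0" by (simp add: link_ratio_def)
  have "(b 0 - b i) * (1 - w j \<bullet> w k) = (a j - a k) * (?c - ?d)"
    using one_minus_inner_w[OF d] by (simp add: algebra_simps)
  moreover have "?x * (1 - w j \<bullet> w k) = ((b 0 - b i) * (1 - w j \<bullet> w k)) / (a j - a k)"
    by (simp add: link_ratio_def)
  ultimately have "?x * (1 - w j \<bullet> w k) = ?c - ?d" using aj by simp
  then have wjk: "w j \<bullet> w k = 1 - (1 / ?x) * (?c - ?d)" using x by (simp add: field_simps)
  have "flex_spoke t j \<bullet> flex_spoke t k = turn_cos t ?c * turn_cos t ?d
      + turn_scale t ?c * turn_scale t ?d * (w j \<bullet> w k - ?c * ?d)"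
    by (simp add: flex_spoke_def inner_add_left inner_add_right inner_diff_left inner_diff_right
        unit_u inner_commute[of "w j" "u 0"] algebra_simps)
  also have "\<dots> = 1 - (1 / ?x) * (turn_cos t ?c - turn_cos t ?d)"
    using turn_twist[OF cd, of "1 / ?x" t] by (simp add: wjk)
  finally show ?thesis using x by (simp add: field_simps)
qed

text \<open>Otherwise the unit vectors \<open>w i\<close>, \<open>w j\<close>, \<open>w k\<close>
  would lie on one line. A line meets the sphere in at most two points, so two of them would
  coincide, against skewness.\<close>

lemma independent_differences:
  assumes "distinct [i, j, k]" "x *\<^sub>R (w i - w j) + y *\<^sub>R (w j - w k) = 0"
  shows "x = 0 \<and> y = 0"
proof -
  have *: "y = 0" if eq: "y *\<^sub>R (w j - w k) = x *\<^sub>R (w j - w i)" and ijk: "distinct [i, j, k]" for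
    x y i j k
  proof (rule ccontr)
    assume "y \<noteq> 0"
    define s where "s = x / y"
    have "(1 / y) *\<^sub>R y *\<^sub>R (w j - w k) = (1 / y) *\<^sub>R x *\<^sub>R (w j - w i)"
      using eq by simp
    then have wk: "w k = w j - s *\<^sub>R (w j - w i)"
      using \<open>y \<noteq> 0\<close> by (simp add: s_def algebra_simps)
    have "w k \<bullet> w k = 1 - 2 * s * (1 - w j \<bullet> w i) + s\<^sup>2 * (2 * (1 - w j \<bullet> w i))"
      unfolding wk by (simp add: inner_diff_left inner_diff_right unit_w inner_commute[of "w i" "w j"]
          power2_eq_square algebra_simps)
    \<comment> \<open>The roots 0 and 1 are the two points \<open>w j\<close> and \<open>w i\<close>
      in which the line meets the sphere.\<close>
    then have "s * (s - 1) * (1 - w j \<bullet> w i) = 0" by (simp add: unit_w power2_eq_square algebra_simps)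
    moreover obtain l where "distinct [i, j, k, l]" using ijk by (rule fourth_index)
    then have n: "u l \<bullet> (w i \<times> w j) \<noteq> 0" "u l \<bullet> (w k \<times> w j) \<noteq> 0" "u l \<bullet> (w k \<times> w i) \<noteq> 0"
      by (auto intro!: skew)
    have "w j \<bullet> w i \<noteq> 1"
    proof
      assume "w j \<bullet> w i = 1"
      then have "(w i - w j) \<bullet> (w i - w j) = 0"
        by (simp add: inner_diff_left inner_diff_right unit_w inner_commute[of "w i" "w j"])
      then show False using n(1) by simp
    qed
    ultimately have "s = 0 \<or> s = 1" by simp
    then show False using n wk by auto
  qed
  have "y *\<^sub>R (w j - w k) = x *\<^sub>R (w j - w i)"
    using assms(2) by (simp add: algebra_simps)
  then have "y = 0" using * assms(1) by blast
  moreover have "x *\<^sub>R (w j - w i) = y *\<^sub>R (w j - w k)"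
    using assms(2) by (simp add: algebra_simps)
  then have "x = 0" using *[where y = x and x = y and i = k and k = i and j = j] assms(1) by auto
  ultimately show ?thesis by simp
qed

text \<open>The conclusions speak of lengths only. They are consequences of the existence of the
  reference directions and can therefore be used at every parameter of the flex.\<close>

lemma link_constant:
  obtains m where "m * link_ratio 1 2 3 = (a 0 - a 1) / (b 2 - b 3)"
    "m * link_ratio 2 3 1 = (a 0 - a 2) / (b 3 - b 1)"
    "m * link_ratio 3 1 2 = (a 0 - a 3) / (b 1 - b 2)"
    "m * (link_ratio 1 2 3 * link_ratio 2 3 1 + link_ratio 2 3 1 * link_ratio 3 1 2
       + link_ratio 3 1 2 * link_ratio 1 2 3) = -1"
proof -
  define x y z where xyz: "x = link_ratio 1 2 3" "y = link_ratio 2 3 1" "z = link_ratio 3 1 2"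
  define k1 k2 k3 where k: "k1 = (a 0 - a 1) / (b 2 - b 3)" "k2 = (a 0 - a 2) / (b 3 - b 1)"
    "k3 = (a 0 - a 3) / (b 1 - b 2)"
  have solve: "v = (B / A) *\<^sub>R v'" if "A *\<^sub>R v = B *\<^sub>R v'" "A \<noteq> 0" for A B :: real and v v' :: space
  proof -
    have "v = (1 / A) *\<^sub>R A *\<^sub>R v" using that(2) by simp
    also have "\<dots> = (B / A) *\<^sub>R v'" unfolding that(1) by simp
    finally show ?thesis .
  qed
  have U: "u 0 - u i = link_ratio i j k *\<^sub>R (w j - w k)" if "distinct [0, i, j, k]" for i j k
  proof -
    have "u 0 - u i = ((b i - b 0) / (a k - a j)) *\<^sub>R (w j - w k)"
      using solve[OF closing[OF that]] a_diff_nonzero that by auto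
    also have "(b i - b 0) / (a k - a j) = link_ratio i j k"
      unfolding link_ratio_def by (metis minus_diff_eq minus_divide_divide)
    finally show ?thesis .
  qed
  have W: "w 0 - w k = ((a 0 - a k) / (b i - b j)) *\<^sub>R (u i - u j)" if "distinct [i, j, 0, k]" for i j k
  proof -
    have "w 0 - w k = ((a k - a 0) / (b j - b i)) *\<^sub>R (u i - u j)"
      using solve[OF closing[OF that, symmetric]] b_diff_nonzero that by auto
    also have "(a k - a 0) / (b j - b i) = (a 0 - a k) / (b i - b j)"
      by (metis minus_diff_eq minus_divide_divide)
    finally show ?thesis .
  qed
  define X Y where XY: "X = w 2 - w 3" "Y = w 3 - w 1"
  have Z: "w 1 - w 2 = - X - Y" by (simp add: XY)
  have u: "u 0 - u 1 = x *\<^sub>R X" "u 0 - u 2 = y *\<^sub>R Y" "u 0 - u 3 = z *\<^sub>R (- X - Y)"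
    using U[of 1 2 3] U[of 2 3 1] U[of 3 1 2] by (simp_all add: xyz XY)
  have w: "w 0 - w 1 = k1 *\<^sub>R (u 2 - u 3)" "w 0 - w 2 = k2 *\<^sub>R (u 3 - u 1)" "w 0 - w 3 = k3 *\<^sub>R (u
    1 - u 2)"
    using W[of 2 3 1] W[of 3 1 2] W[of 1 2 3] by (simp_all add: k)
  have d: "u 2 - u 3 = z *\<^sub>R (- X - Y) - y *\<^sub>R Y" "u 3 - u 1 = x *\<^sub>R X - z *\<^sub>R (- X - Y)"
    "u 1 - u 2 = y *\<^sub>R Y - x *\<^sub>R X"
    unfolding u[symmetric] by simp_all
  \<comment> \<open>An edge of the triangle \<open>w 1\<close>, \<open>w 2\<close>,
    \<open>w 3\<close> is reached through \<open>w 0\<close>. As \<open>X\<close> and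
    \<open>Y\<close> are independent, coefficients can be compared.\<close>
  have "Y = (w 0 - w 1) - (w 0 - w 3)" by (simp add: XY)
  then have "(k3 * x - k1 * z) *\<^sub>R X + (- k1 * z - k1 * y - k3 * y - 1) *\<^sub>R Y = 0"
    unfolding w d by (simp add: algebra_simps)
  then have 1: "k3 * x = k1 * z" "- k1 * z - k1 * y - k3 * y = 1"
    using independent_differences[of 2 3 1 "k3 * x - k1 * z" "- k1 * z - k1 * y - k3 * y - 1"]
    by (auto simp: XY)
  have "X = (w 0 - w 3) - (w 0 - w 2)" by (simp add: XY)
  then have "(- k3 * x - k2 * x - k2 * z - 1) *\<^sub>R X + (k3 * y - k2 * z) *\<^sub>R Y = 0"
    unfolding w d by (simp add: algebra_simps)
  then have 2: "k3 * y = k2 * z"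
    using independent_differences[of 2 3 1 "- k3 * x - k2 * x - k2 * z - 1" "k3 * y - k2 * z"]
    by (auto simp: XY)
  have z: "z \<noteq> 0" using a_diff_nonzero[of 2 1] b_diff_nonzero[of 3 0] by (simp add: xyz link_ratio_def)
  show ?thesis
  proof (rule that[of "k3 / z"])
    show "k3 / z * link_ratio 1 2 3 = (a 0 - a 1) / (b 2 - b 3)"
      using 1(1) z by (simp add: xyz[symmetric] k[symmetric] field_simps)
    show "k3 / z * link_ratio 2 3 1 = (a 0 - a 2) / (b 3 - b 1)"
      using 2 z by (simp add: xyz[symmetric] k[symmetric] field_simps)
    show "k3 / z * link_ratio 3 1 2 = (a 0 - a 3) / (b 1 - b 2)"
      using z by (simp add: xyz[symmetric] k[symmetric] field_simps)
    have "z * (k3 / z * (x * y + y * z + z * x)) = - z" using 1 z by (simp add: field_simps) algebra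
    then have "k3 / z * (x * y + y * z + z * x) = -1" using z by (metis mult_cancel_left
      mult_minus1_right)
    then show "k3 / z * (link_ratio 1 2 3 * link_ratio 2 3 1 + link_ratio 2 3 1 * link_ratio 3 1 2
       + link_ratio 3 1 2 * link_ratio 1 2 3) = -1" unfolding xyz .
  qed
qed

lemma flex_directions:
  shows "isogram_directions (flex_u t) (flex_w t) a b"
    and "i \<noteq> k \<Longrightarrow> flex_u t i \<bullet> flex_w t k = turn_cos t (u i \<bullet> w k)"
proof -
  obtain m where m: "m * link_ratio 1 2 3 = (a 0 - a 1) / (b 2 - b 3)"
    "m * link_ratio 2 3 1 = (a 0 - a 2) / (b 3 - b 1)"
    "m * link_ratio 3 1 2 = (a 0 - a 3) / (b 1 - b 2)"
    "m * (link_ratio 1 2 3 * link_ratio 2 3 1 + link_ratio 2 3 1 * link_ratio 3 1 2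
       + link_ratio 3 1 2 * link_ratio 1 2 3) = -1"
    by (rule link_constant)
  define x y z where xyz: "x = link_ratio 1 2 3" "y = link_ratio 2 3 1" "z = link_ratio 3 1 2"
  define U where "U = flex_u t"
  define W where "W = flex_w t"
  define C where "C k = turn_cos t (u 0 \<bullet> w k)" for k
  have cyc: "m * (y * z + z * x + x * y) = -1" "m * (z * x + x * y + y * z) = -1" "m * (x * y + y
    * z + z * x) = -1"
    using m(4) by (simp_all add: xyz algebra_simps)
  have U: "U 0 = u 0" "U 1 = U 0 - x *\<^sub>R (W 2 - W 3)" "U 2 = U 0 - y *\<^sub>R (W 3 - W 1)" "U 3 = U 0 -
    z *\<^sub>R (W 1 - W 2)"
    by (simp_all add: U_def W_def xyz flex_simps)
  have W: "W 1 = flex_spoke t 1" "W 2 = flex_spoke t 2" "W 3 = flex_spoke t 3"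
    by (simp_all add: W_def flex_simps)
  have W0: "W 0 = W 3 + (m * z) *\<^sub>R (U 1 - U 2)"
    using m(3) by (simp add: W_def U_def flex_simps xyz)
  have un: "U 0 \<bullet> U 0 = 1" "W 1 \<bullet> W 1 = 1" "W 2 \<bullet> W 2 = 1" "W 3 \<bullet> W 3 = 1"
    by (simp_all add: U W unit_u inner_spoke)
  have c: "U 0 \<bullet> W 1 = C 1" "U 0 \<bullet> W 2 = C 2" "U 0 \<bullet> W 3 = C 3"
    by (simp_all add: U W C_def inner_spoke)
  have g: "x * (1 - W 2 \<bullet> W 3) = C 2 - C 3" "y * (1 - W 3 \<bullet> W 1) = C 3 - C 1" "z * (1 - W 1 \<bullet> W 2)
    = C 1 - C 2"
    using link_ratio_spoke[of 1 2 3 t] link_ratio_spoke[of 2 3 1 t] link_ratio_spoke[of 3 1 2 t]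
    by (simp_all add: xyz W C_def)
  \<comment> \<open>The indices 1, 2, 3 are shifted cyclically. Each round yields the formula for
    \<open>W 0\<close> that the next round takes as its hypothesis.\<close>
  note one = completed_directions[OF un(1,2,3,4) c(1,2,3) g(1,2,3) cyc(3) U(2,3,4) W0]
  note two = completed_directions[OF un(1,3,4,2) c(2,3,1) g(2,3,1) cyc(1) U(3,4,2) one(1)]
  note three = completed_directions[OF un(1,4,2,3) c(3,1,2) g(3,1,2) cyc(2) U(4,2,3) two(1)]
  have u21: "U 2 \<bullet> U 1 = U 1 \<bullet> U 2" "U 3 \<bullet> U 2 = U 2 \<bullet> U 3" by (simp_all add: inner_commute)
  have W0W0: "W 0 \<bullet> W 0 = 1"
  proof -
    have "W 0 \<bullet> W 0 = W 3 \<bullet> W 3 + 2 * (m * z) * (U 1 \<bullet> W 3 - U 2 \<bullet> W 3)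
      + (m * z)\<^sup>2 * (U 1 \<bullet> U 1 + U 2 \<bullet> U 2 - 2 * (U 1 \<bullet> U 2))"
      unfolding W0 by (simp add: inner_add_left inner_add_right inner_diff_left inner_diff_right u21
          inner_commute[of "W 3" "U 1"] inner_commute[of "W 3" "U 2"] power2_eq_square algebra_simps)
    then show ?thesis using one(2,4,5) two(2,3) un(4) by algebra
  qed
  have U1W0: "U 1 \<bullet> W 0 = C 1"
    unfolding W0 inner_add_right inner_scaleR_right inner_diff_right one(2) using one(4,5) by simp
  have U2W0: "U 2 \<bullet> W 0 = C 2"
  proof -
    have "U 2 \<bullet> W 0 = U 2 \<bullet> W 3 - m * z * (1 - U 1 \<bullet> U 2)"
      unfolding W0 inner_add_right inner_scaleR_right inner_diff_right two(2) u21 by (simp add: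
        algebra_simps)
    then show ?thesis unfolding one(5) two(3) by simp
  qed
  have U3W0: "U 3 \<bullet> W 0 = C 3"
  proof -
    have "U 3 \<bullet> W 0 = U 3 \<bullet> W 1 - m * x * (1 - U 2 \<bullet> U 3)"
      unfolding one(1) inner_add_right inner_scaleR_right inner_diff_right three(2) u21 by (simp
        add: algebra_simps)
    then show ?thesis unfolding two(5) three(3) by simp
  qed
  \<comment> \<open>By \<open>inner_opposite\<close> every joint angle equals one of the three
    angles at \<open>u 0\<close>.\<close>
  have cross: "turn_cos t (u i \<bullet> w j) = C k" if "distinct [0, i, j, k]" for i j k
    using inner_opposite[of i 0 j k] that by (auto simp: C_def)
  have cr: "turn_cos t (u 1 \<bullet> w 2) = C 3" "turn_cos t (u 1 \<bullet> w 3) = C 2"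
    "turn_cos t (u 2 \<bullet> w 1) = C 3" "turn_cos t (u 3 \<bullet> w 1) = C 2"
    "turn_cos t (u 2 \<bullet> w 3) = C 1" "turn_cos t (u 3 \<bullet> w 2) = C 1"
    by (rule cross; simp)+
  have cross0: "turn_cos t (u i \<bullet> w 0) = C i" if i: "0 \<noteq> i" for i
  proof -
    obtain j k where d: "distinct [0, i, j, k]" using i by (rule third_fourth_index)
    have "u i \<bullet> w 0 = u j \<bullet> w k" "u j \<bullet> w k = u 0 \<bullet> w i"
      using inner_opposite[of i j 0 k] inner_opposite[of j 0 k i] d by auto
    then show ?thesis by (simp add: C_def)
  qed
  show inner: "flex_u t i \<bullet> flex_w t k = turn_cos t (u i \<bullet> w k)" if "i \<noteq> k" for i k
    unfolding U_def[symmetric] W_def[symmetric]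
    using that exhaust_mod4[of i] exhaust_mod4[of k]
    by (elim disjE) (simp_all add: c one(3,4) two(3,4) three(3,4) U1W0 U2W0 U3W0 cr cross0,
      simp_all add: C_def)
  have mul: "A *\<^sub>R v = B *\<^sub>R v'" if "v = (B / A) *\<^sub>R v'" "A \<noteq> 0" for A B :: real and v v' :: space
    using that by simp
  have neg: "(p - q) / (r - s) = (q - p) / (s - r)" for p q r s :: real
    by (metis minus_diff_eq minus_divide_divide)
  show "isogram_directions (flex_u t) (flex_w t) a b"
    unfolding U_def[symmetric] W_def[symmetric]
  proof (rule isogram_directionsI)
    show "U i \<bullet> U i = 1" for i
      using exhaust_mod4[of i] un one(2) two(2) three(2) by auto
    show "W i \<bullet> W i = 1" for i
      using exhaust_mod4[of i] un W0W0 by auto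
    show "inj a" "inj b" by (rule inj_a inj_b)+
    show "(a 3 - a 2) *\<^sub>R (U 0 - U 1) = (b 1 - b 0) *\<^sub>R (W 2 - W 3)"
      by (rule mul) (simp_all add: U(2) xyz link_ratio_def neg[of "b 1"] inj_eq[OF inj_a])
    show "(a 1 - a 3) *\<^sub>R (U 0 - U 2) = (b 2 - b 0) *\<^sub>R (W 3 - W 1)"
      by (rule mul) (simp_all add: U(3) xyz link_ratio_def neg[of "b 2"] inj_eq[OF inj_a])
    show "(a 2 - a 1) *\<^sub>R (U 0 - U 3) = (b 3 - b 0) *\<^sub>R (W 1 - W 2)"
      by (rule mul) (simp_all add: U(4) xyz link_ratio_def neg[of "b 3"] inj_eq[OF inj_a])
    show "(a 3 - a 0) *\<^sub>R (U 1 - U 2) = (b 2 - b 1) *\<^sub>R (W 0 - W 3)"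
      by (rule mul[symmetric]) (simp_all add: W0 m(3) xyz neg[of "a 3"] inj_eq[OF inj_b])
    show "(a 1 - a 0) *\<^sub>R (U 2 - U 3) = (b 3 - b 2) *\<^sub>R (W 0 - W 1)"
      by (rule mul[symmetric]) (simp_all add: one(1) m(1) xyz neg[of "a 1"] inj_eq[OF inj_b])
    show "(a 2 - a 0) *\<^sub>R (U 3 - U 1) = (b 1 - b 3) *\<^sub>R (W 0 - W 2)"
      by (rule mul[symmetric]) (simp_all add: two(1) m(2) xyz neg[of "a 2"] inj_eq[OF inj_b])
  qed
qed

end

section \<open>Hinges are preserved under the flex\<close>

definition hinge_dir :: "(4 \<Rightarrow> space) \<Rightarrow> (4 \<Rightarrow> space) \<Rightarrow> 4 \<Rightarrow> 4 \<Rightarrow> space" where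
  "hinge_dir u w i k = sgn (u i \<times> w k)"

lemma hinge_dir_dual: "hinge_dir w u k i = - hinge_dir u w i k"
  unfolding hinge_dir_def by (subst cross_skew) (simp add: sgn_minus)

lemma cross_eq_hinge_dir: "u i \<times> w k = norm (u i \<times> w k) *\<^sub>R hinge_dir u w i k"
  by (cases "u i \<times> w k = 0") (simp_all add: hinge_dir_def sgn_div_norm)

context isogram_directions
begin

lemma hinge_frame: "u i \<times> w k \<noteq> 0 \<Longrightarrow> frame (u i) (hinge_dir u w i k)"
  by (simp add: frame_def hinge_dir_def norm_eq_1 unit_u norm_sgn sgn_div_norm[of "u i \<times> w k"]
    dot_cross_self)

lemma hinge_inner:
  "hinge_dir u w i k \<bullet> hinge_dir u w i l
    = (w k \<bullet> w l - (u i \<bullet> w k) * (u i \<bullet> w l)) / (norm (u i \<times> w k) * norm (u i \<times> w l))"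
  by (simp add: hinge_dir_def sgn_div_norm dot_cross unit_u inner_commute[of "w k" "u i"] field_simps)

end

text \<open>Pythagoras in the plane orthogonal to \<open>e\<close>: the cosine of a twist determines
  its sine up to sign.\<close>

lemma frame_component_sq:
  assumes "frame e f" "norm g = 1" "e \<bullet> g = 0"
  shows "((e \<times> f) \<bullet> g)\<^sup>2 = 1 - (f \<bullet> g)\<^sup>2"
proof -
  have "g \<bullet> g = g \<bullet> ((g \<bullet> e) *\<^sub>R e + (g \<bullet> f) *\<^sub>R f + (g \<bullet> (e \<times> f)) *\<^sub>R (e \<times> f))"
    using frame_expand[OF assms(1), of g] by simp
  also have "\<dots> = (f \<bullet> g)\<^sup>2 + ((e \<times> f) \<bullet> g)\<^sup>2"
    using assms(3) by (simp add: inner_add_right power2_eq_square inner_commute)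
  finally show ?thesis using assms(2) by (simp add: norm_eq_1)
qed

lemma frame_map_transport:
  assumes "frame e f" "frame e' f'" "e \<bullet> g = 0" "e' \<bullet> g' = 0" "f \<bullet> g = f' \<bullet> g'"
    and "(e \<times> f) \<bullet> g = (e' \<times> f') \<bullet> g'"
  shows "frame_map e f e' f' g = g'"
proof -
  have "g' = (g' \<bullet> e') *\<^sub>R e' + (g' \<bullet> f') *\<^sub>R f' + (g' \<bullet> (e' \<times> f')) *\<^sub>R (e' \<times> f')"
    by (rule frame_expand[OF assms(2)])
  then show ?thesis using assms(3-6) by (simp add: frame_map_def inner_commute)
qed

text \<open>At most two values are possible, and a finite connected image is a single point.\<close>

lemma constant_of_constant_square:
  fixes d :: "real \<Rightarrow> real"
  assumes "continuous_on S d" "connected S" "\<And>t. t \<in> S \<Longrightarrow> (d t)\<^sup>2 = K" "s \<in> S" "t \<in> S"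
  shows "d s = d t"
proof -
  have "d ` S \<subseteq> {d t, - d t}"
  proof
    fix y assume "y \<in> d ` S"
    then obtain r where "r \<in> S" "y = d r" by auto
    then have "y\<^sup>2 = (d t)\<^sup>2" using assms(3,5) by simp
    then show "y \<in> {d t, - d t}" by (simp add: power2_eq_iff)
  qed
  then have "finite (d ` S)" by (rule finite_subset) simp
  then obtain x where "d ` S = {x}"
    using connected_continuous_image[OF assms(1,2)] connected_finite_iff_sing assms(4) by blast
  then show ?thesis using assms(4,5) by (metis imageI singletonD)
qed

text \<open>The formulas of the flex start from \<open>u 0\<close> and are not symmetric in
  \<open>u\<close> and \<open>w\<close>. These properties are, so results on the hinges of one
  family pass to the other by \<open>dual_flexed\<close>.\<close>

locale flexed = skew_directions u w a b for u w a b +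
  fixes U W :: "real \<Rightarrow> 4 \<Rightarrow> space"
  assumes dirs: "isogram_directions (U t) (W t) a b"
    and inner: "i \<noteq> k \<Longrightarrow> U t i \<bullet> W t k = turn_cos t (u i \<bullet> w k)"
    and cont_U: "continuous_on {0<..} (\<lambda>t. U t i)" and cont_W: "continuous_on {0<..} (\<lambda>t. W t i)"
    and at_1: "U 1 = u" "W 1 = w"
begin

lemma dual_flexed: "flexed w u b a W U"
proof -
  show ?thesis
  proof (intro flexed.intro flexed_axioms.intro dual_skew)
    show "isogram_directions (W t) (U t) b a" for t by (rule isogram_directions.dual[OF dirs])
    show "W t i \<bullet> U t k = turn_cos t (w i \<bullet> u k)" if "i \<noteq> k" for t i k
      using inner[of k i t] that by (simp add: inner_commute)
  qed (rule cont_U cont_W at_1)+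
qed

lemma norm_cross_UW:
  assumes "i \<noteq> k" "0 < t"
  shows "norm (U t i \<times> W t k) = turn_scale t (u i \<bullet> w k) * norm (u i \<times> w k)"
proof (rule power2_eq_imp_eq)
  interpret T: isogram_directions "U t" "W t" a b by (rule dirs)
  have "\<bar>u i \<bullet> w k\<bar> < 1" by (rule abs_inner_less_1[OF assms(1)])
  then show "(norm (U t i \<times> W t k))\<^sup>2 = (turn_scale t (u i \<bullet> w k) * norm (u i \<times> w k))\<^sup>2"
    using turn_pythagoras[of "u i \<bullet> w k" t] inner[OF assms(1), of t]
    by (simp add: T.norm_cross_uw norm_cross_uw power_mult_distrib)
  show "0 \<le> turn_scale t (u i \<bullet> w k) * norm (u i \<times> w k)"
    using turn_scale_pos[OF abs_inner_less_1[OF assms(1)] assms(2)] by simp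
qed simp

lemma cross_UW_nonzero: "i \<noteq> k \<Longrightarrow> 0 < t \<Longrightarrow> U t i \<times> W t k \<noteq> 0"
  using norm_cross_UW[of i k t] turn_scale_pos[OF abs_inner_less_1, of i k t] cross_nonzero[of i k]
  by auto

lemma hinge_frame_flex:
  assumes "i \<noteq> k" "0 < t"
  shows "frame (U t i) (hinge_dir (U t) (W t) i k)"
proof -
  interpret T: isogram_directions "U t" "W t" a b by (rule dirs)
  show ?thesis by (rule T.hinge_frame) (rule cross_UW_nonzero[OF assms])
qed

text \<open>By \<open>turn_twist\<close> and \<open>norm_cross_UW\<close>, numerator and denominator
  of the cosine of the twist are multiplied by the same two nonzero factors.\<close>

lemma hinge_inner_const:
  assumes d: "distinct [i, k, l]" and t: "0 < t"
  shows "hinge_dir (U t) (W t) i k \<bullet> hinge_dir (U t) (W t) i l = hinge_dir u w i k \<bullet> hinge_dir u w i l"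
proof -
  interpret T: isogram_directions "U t" "W t" a b by (rule dirs)
  obtain j where "distinct [i, k, l, j]" using d by (rule fourth_index)
  then have j: "distinct [i, j, k, l]" by auto
  let ?c = "u i \<bullet> w k" and ?d = "u i \<bullet> w l"
  have cd: "\<bar>?c\<bar> < 1" "\<bar>?d\<bar> < 1" using abs_inner_less_1 d by auto
  define r where "r = (a l - a k) / (b j - b i)"
  have bij: "b j - b i \<noteq> 0" by (rule b_diff_nonzero) (use j in auto)
  have in': "U t i \<bullet> W t k = turn_cos t ?c" "U t i \<bullet> W t l = turn_cos t ?d" using inner d by auto
  have w: "w k \<bullet> w l = 1 - r * (?c - ?d)"
    using one_minus_inner_w[OF j] bij by (simp add: r_def field_simps)
  have W: "W t k \<bullet> W t l = 1 - r * (turn_cos t ?c - turn_cos t ?d)"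
    using T.one_minus_inner_w[OF j] bij by (simp add: r_def in' field_simps)
  have n: "norm (U t i \<times> W t k) = turn_scale t ?c * norm (u i \<times> w k)"
    "norm (U t i \<times> W t l) = turn_scale t ?d * norm (u i \<times> w l)"
    using norm_cross_UW t d by auto
  have s: "turn_scale t ?c \<noteq> 0" "turn_scale t ?d \<noteq> 0"
    using turn_scale_pos cd t by (metis less_irrefl)+
  have cancel: "S * T * x / (S * m * (T * n)) = x / (m * n)" if "S \<noteq> 0" "T \<noteq> 0" for S T x m n :: real
    using that by (cases "m = 0 \<or> n = 0") (auto simp: field_simps)
  show ?thesis
    unfolding hinge_inner T.hinge_inner W w in' n
    unfolding turn_twist[OF cd, of r t] using cancel[OF s] .
qed

text \<open>The square is fixed by the preceding cosine, and the sign by continuity from the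
  reference parameter 1.\<close>

lemma hinge_triple_const:
  assumes d: "distinct [i, k, l]" and t: "0 < t"
  shows "(U t i \<times> hinge_dir (U t) (W t) i k) \<bullet> hinge_dir (U t) (W t) i l
    = (u i \<times> hinge_dir u w i k) \<bullet> hinge_dir u w i l"
proof -
  have ik: "i \<noteq> k" "i \<noteq> l" using d by auto
  let ?d = "\<lambda>t. (U t i \<times> hinge_dir (U t) (W t) i k) \<bullet> hinge_dir (U t) (W t) i l"
  have cont: "continuous_on {0<..} (\<lambda>t. hinge_dir (U t) (W t) i k)" if "i \<noteq> k" for k
    unfolding hinge_dir_def using cross_UW_nonzero[OF that]
    by (intro continuous_on_sgn continuous_on_cross cont_U cont_W) auto
  have "?d t = ?d 1"
  proof (rule constant_of_constant_square[where S = "{0<..}" and d = ?d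
        and K = "1 - (hinge_dir u w i k \<bullet> hinge_dir u w i l)\<^sup>2"])
    show "continuous_on {0<..} ?d"
      by (intro continuous_intros continuous_on_cross cont_U cont ik)
    fix s :: real assume "s \<in> {0<..}"
    then have s: "0 < s" by simp
    interpret T: isogram_directions "U s" "W s" a b by (rule dirs)
    have "(?d s)\<^sup>2 = 1 - (hinge_dir (U s) (W s) i k \<bullet> hinge_dir (U s) (W s) i l)\<^sup>2"
      using hinge_frame_flex[OF ik(1) s] hinge_frame_flex[OF ik(2) s]
      by (intro frame_component_sq) (auto simp: frame_def)
    then show "(?d s)\<^sup>2 = 1 - (hinge_dir u w i k \<bullet> hinge_dir u w i l)\<^sup>2"
      unfolding hinge_inner_const[OF d s] .
  qed (use t in \<open>auto simp: is_interval_connected\<close>)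
  then show ?thesis by (simp add: at_1)
qed

text \<open>A body needs one rotation for all its hinges. The rotation is fixed by
  \<open>u i\<close> and one hinge; inner and triple products with that frame are unchanged, so it
  carries the other hinges correctly as well.\<close>

lemma hinge_transport:
  assumes "0 < t" "i \<noteq> k" "i \<noteq> l"
  shows "frame_map (u i) (hinge_dir u w i k) (U t i) (hinge_dir (U t) (W t) i k) (hinge_dir u w i l)
    = hinge_dir (U t) (W t) i l"
proof -
  have fr: "frame (u i) (hinge_dir u w i k)" "frame (u i) (hinge_dir u w i l)"
    using hinge_frame cross_nonzero assms by auto
  have fr': "frame (U t i) (hinge_dir (U t) (W t) i k)" "frame (U t i) (hinge_dir (U t) (W t) i l)"
    using hinge_frame_flex assms by auto
  show ?thesis
  proof (cases "k = l")
    case True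
    then show ?thesis using frame_map_basis[OF fr(1)] by simp
  next
    case False
    then have d: "distinct [i, k, l]" using assms by auto
    show ?thesis
      using fr fr' hinge_inner_const[OF d assms(1)] hinge_triple_const[OF d assms(1)]
      by (intro frame_map_transport) (auto simp: frame_def)
  qed
qed

end

context skew_directions
begin

lemma flexed_flex: "flexed u w a b flex_u flex_w"
proof (intro flexed.intro flexed_axioms.intro skew_directions_axioms)
  show "isogram_directions (flex_u t) (flex_w t) a b" for t by (rule flex_directions)
  show "flex_u t i \<bullet> flex_w t k = turn_cos t (u i \<bullet> w k)" if "i \<noteq> k" for t i k
    by (rule flex_directions(2)[OF that])
  \<comment> \<open>The spokes are at rest for parameter 1; uniqueness then settles the other
    directions, \<open>w 0\<close> included.\<close>
  have "flex_spoke 1 k = w k" for k by (simp add: flex_spoke_def)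
  then have "flex_w 1 k = w k" if "k \<noteq> 0" for k
    using that exhaust_mod4[of k] by (auto simp: flex_simps)
  moreover have "flex_u 1 0 = u 0" by (simp add: flex_simps)
  moreover have "isogram_directions u w a b" by unfold_locales
  ultimately show "flex_u 1 = u" "flex_w 1 = w"
    using isogram_directions_unique[OF _ flex_directions(1)[of 1]] by blast+
  have spoke: "continuous_on {0<..} (\<lambda>t. flex_spoke t k)" if "k \<noteq> 0" for k
    unfolding flex_spoke_def using abs_inner_less_1[of 0 k] that
    by (intro continuous_intros continuous_on_turn) auto
  show cu: "continuous_on {0<..} (\<lambda>t. flex_u t i)" for i
    using exhaust_mod4[of i] by (auto simp: flex_simps intro!: continuous_intros spoke)
  show "continuous_on {0<..} (\<lambda>t. flex_w t i)" for i
    using exhaust_mod4[of i]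
    by (auto simp: flex_simps(5-8) intro!: continuous_intros spoke cu)
qed

end

section \<open>Positions of the lines of a net\<close>

text \<open>The incidences \<open>R i k\<close> are solved along a spanning tree: from
  \<open>g 0\<close> to \<open>h 1\<close>, \<open>h 2\<close>, \<open>h 3\<close>, from
  \<open>h 3\<close> to \<open>g 1\<close> and \<open>g 2\<close>, from \<open>h 2\<close> to
  \<open>g 3\<close>, and from \<open>g 1\<close> to \<open>h 0\<close>.\<close>

definition net_p :: "(4 \<Rightarrow> space) \<Rightarrow> (4 \<Rightarrow> space) \<Rightarrow> (4 \<Rightarrow> real) \<Rightarrow> (4 \<Rightarrow> real) \<Rightarrow> space \<Rightarrow> 4 \<Rightarrow> space" where
  "net_p u w a b p0 = quad p0 (p0 + a 3 *\<^sub>R (u 0 - u 1) + (b 1 - b 0) *\<^sub>R w 3)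
     (p0 + a 3 *\<^sub>R (u 0 - u 2) + (b 2 - b 0) *\<^sub>R w 3) (p0 + a 2 *\<^sub>R (u 0 - u 3) + (b 3 - b 0) *\<^sub>R w 2)"

definition net_q :: "(4 \<Rightarrow> space) \<Rightarrow> (4 \<Rightarrow> space) \<Rightarrow> (4 \<Rightarrow> real) \<Rightarrow> (4 \<Rightarrow> real) \<Rightarrow> space \<Rightarrow> 4 \<Rightarrow> space" where
  "net_q u w a b p0 = quad (net_p u w a b p0 1 + a 0 *\<^sub>R u 1 - b 1 *\<^sub>R w 0)
     (p0 + a 1 *\<^sub>R u 0 - b 0 *\<^sub>R w 1) (p0 + a 2 *\<^sub>R u 0 - b 0 *\<^sub>R w 2) (p0 + a 3 *\<^sub>R u 0 - b 0 *\<^sub>R w 3)"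

lemma net_simps:
  "net_p u w a b p0 0 = p0"
  "net_p u w a b p0 1 = p0 + a 3 *\<^sub>R (u 0 - u 1) + (b 1 - b 0) *\<^sub>R w 3"
  "net_p u w a b p0 2 = p0 + a 3 *\<^sub>R (u 0 - u 2) + (b 2 - b 0) *\<^sub>R w 3"
  "net_p u w a b p0 3 = p0 + a 2 *\<^sub>R (u 0 - u 3) + (b 3 - b 0) *\<^sub>R w 2"
  "net_q u w a b p0 0 = net_p u w a b p0 1 + a 0 *\<^sub>R u 1 - b 1 *\<^sub>R w 0"
  "net_q u w a b p0 1 = p0 + a 1 *\<^sub>R u 0 - b 0 *\<^sub>R w 1"
  "net_q u w a b p0 2 = p0 + a 2 *\<^sub>R u 0 - b 0 *\<^sub>R w 2"
  "net_q u w a b p0 3 = p0 + a 3 *\<^sub>R u 0 - b 0 *\<^sub>R w 3"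
  by (simp_all add: net_p_def net_q_def quad_def)

text \<open>Seven incidences hold by construction of the tree. Each of the other five closes a
  cycle, which is where the closing conditions enter.\<close>

lemma (in isogram_directions) net_positions:
  assumes "i \<noteq> k"
  shows "net_p u w a b p0 i + a k *\<^sub>R u i = net_q u w a b p0 k + b i *\<^sub>R w k"
proof -
  let ?p = "net_p u w a b p0" and ?q = "net_q u w a b p0"
  have cl: "a l *\<^sub>R u i - a l *\<^sub>R u j - a k *\<^sub>R u i + a k *\<^sub>R u j - (b j *\<^sub>R w k - b j *\<^sub>R w l - b
    i *\<^sub>R w k + b i *\<^sub>R w l) = 0"
    if "distinct [i, j, k, l]" for i j k l
    using closing[OF that] by (simp add: algebra_simps)
  have eqI: "x = y" if "x - y = c" "c = 0" for x y c :: space using that by simp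
  have "?p 1 + a 2 *\<^sub>R u 1 = ?q 2 + b 1 *\<^sub>R w 2"
    by (rule eqI[OF _ cl[of 0 1 2 3]]) (simp_all add: net_simps algebra_simps)
  moreover have "?p 2 + a 1 *\<^sub>R u 2 = ?q 1 + b 2 *\<^sub>R w 1"
    by (rule eqI[OF _ cl[of 0 2 1 3]]) (simp_all add: net_simps algebra_simps)
  moreover have "?p 3 + a 1 *\<^sub>R u 3 = ?q 1 + b 3 *\<^sub>R w 1"
    by (rule eqI[OF _ cl[of 0 3 1 2]]) (simp_all add: net_simps algebra_simps)
  moreover have "?p 2 + a 0 *\<^sub>R u 2 = ?q 0 + b 2 *\<^sub>R w 0"
    by (rule eqI[OF _ cl[of 1 2 0 3]]) (simp_all add: net_simps algebra_simps)
  moreover have "?p 3 + a 0 *\<^sub>R u 3 = ?q 0 + b 3 *\<^sub>R w 0"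
  proof -
    \<comment> \<open>The tree path between \<open>g 3\<close> and \<open>h 0\<close> passes through
      both \<open>h 2\<close> and \<open>h 3\<close>, so two isograms are needed.\<close>
    have "?p 3 + a 0 *\<^sub>R u 3 - (?q 0 + b 3 *\<^sub>R w 0) =
      (a 2 *\<^sub>R u 1 - a 2 *\<^sub>R u 3 - a 0 *\<^sub>R u 1 + a 0 *\<^sub>R u 3 - (b 3 *\<^sub>R w 0 - b 3 *\<^sub>R w 2 - b 1
        *\<^sub>R w 0 + b 1 *\<^sub>R w 2))
      - (a 3 *\<^sub>R u 0 - a 3 *\<^sub>R u 1 - a 2 *\<^sub>R u 0 + a 2 *\<^sub>R u 1 - (b 1 *\<^sub>R w 2 - b 1 *\<^sub>R w 3 - b 0
        *\<^sub>R w 2 + b 0 *\<^sub>R w 3))"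
      by (simp add: net_simps algebra_simps)
    also have "\<dots> = 0" using cl[of 1 3 0 2] cl[of 0 1 2 3] by simp
    finally show ?thesis by simp
  qed
  ultimately show ?thesis
    using assms exhaust_mod4[of i] exhaust_mod4[of k]
    by (elim disjE) (simp_all, simp_all add: net_simps algebra_simps)
qed

lemma net_unique:
  assumes "\<And>i k. i \<noteq> k \<Longrightarrow> p i + a k *\<^sub>R u i = q k + b i *\<^sub>R w k"
  shows "p = net_p u w a b (p 0)" "q = net_q u w a b (p 0)"
proof -
  have q: "q k = p i + a k *\<^sub>R u i - b i *\<^sub>R w k" if "i \<noteq> k" for i k
    using assms[OF that] by simp
  have p: "p i = p 0 + a k *\<^sub>R (u 0 - u i) + (b i - b 0) *\<^sub>R w k" if "i \<noteq> k" "k \<noteq> 0" for i k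
    using assms[OF that(1)] q[of 0 k] that by (simp add: algebra_simps)
  have pi: "p i = net_p u w a b (p 0) i" for i
    using exhaust_mod4[of i] p[of 1 3] p[of 2 3] p[of 3 2] by (elim disjE) (simp_all only:
      net_simps, simp_all)
  show "p = net_p u w a b (p 0)" using pi by (rule ext)
  have "q k = net_q u w a b (p 0) k" for k
    using exhaust_mod4[of k] q[of 0 1] q[of 0 2] q[of 0 3] q[of 1 0] pi[of 1]
    by (elim disjE) (simp_all only: net_simps, simp_all)
  then show "q = net_q u w a b (p 0)" by (rule ext)
qed

lemma net_closing:
  fixes p q u w :: "4 \<Rightarrow> space"
  assumes "\<And>i k. i \<noteq> k \<Longrightarrow> p i + a k *\<^sub>R u i = q k + b i *\<^sub>R w k" and "distinct [i, j, k, l]"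
  shows "(a l - a k) *\<^sub>R (u i - u j) = (b j - b i) *\<^sub>R (w k - w l)"
proof -
  have 1: "a k *\<^sub>R u i - b i *\<^sub>R w k = q k - p i" if "i \<noteq> k" for i k
    using assms(1)[OF that] by (simp add: algebra_simps)
  have "(a l - a k) *\<^sub>R (u i - u j) - (b j - b i) *\<^sub>R (w k - w l) =
    (a l *\<^sub>R u i - b i *\<^sub>R w l) - (a k *\<^sub>R u i - b i *\<^sub>R w k)
    - (a l *\<^sub>R u j - b j *\<^sub>R w l) + (a k *\<^sub>R u j - b j *\<^sub>R w k)"
    by (simp add: algebra_simps)
  also have "\<dots> = 0" using assms(2) by (simp add: 1)
  finally show ?thesis by simp
qed

section \<open>The one-parameter family of poses\<close>

text \<open>The index \<open>i + 1\<close> merely selects some hinge of the body to complete a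
  frame; for the flex, \<open>hinge_transport\<close> takes care of the others.\<close>

definition body_motion ::
  "(4 \<Rightarrow> space) \<Rightarrow> (4 \<Rightarrow> space) \<Rightarrow> (4 \<Rightarrow> space) \<Rightarrow> (4 \<Rightarrow> space) \<Rightarrow> (4 \<Rightarrow> space) \<Rightarrow> (4 \<Rightarrow> space) \<Rightarrow> 4 \<Rightarrow> space \<Rightarrow>
    space" where
  "body_motion u w p u' w' p' i x = p' i
     + frame_map (u i) (hinge_dir u w i (i + 1)) (u' i) (hinge_dir u' w' i (i + 1)) (x - p i)"

lemma (in flexed) body_motion_flex:
  assumes "0 < t"
  shows "rigid_motion (body_motion u w p (U t) (W t) p' i)"
    and "i \<noteq> k \<Longrightarrow> body_motion u w p (U t) (W t) p' i (p i + r *\<^sub>R u i + s *\<^sub>R hinge_dir u w i k)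
      = p' i + r *\<^sub>R U t i + s *\<^sub>R hinge_dir (U t) (W t) i k"
proof -
  have ii: "i \<noteq> i + 1" by simp
  have fr: "frame (u i) (hinge_dir u w i (i + 1))" "frame (U t i) (hinge_dir (U t) (W t) i (i + 1))"
    using hinge_frame[OF cross_nonzero[OF ii]] hinge_frame_flex[OF ii assms] by auto
  show "rigid_motion (body_motion u w p (U t) (W t) p' i)"
    using frame_map_rigid(1)[OF fr, of "p' i" "p i"] unfolding body_motion_def[abs_def] .
  show "body_motion u w p (U t) (W t) p' i (p i + r *\<^sub>R u i + s *\<^sub>R hinge_dir u w i k)
      = p' i + r *\<^sub>R U t i + s *\<^sub>R hinge_dir (U t) (W t) i k" if "i \<noteq> k"
    using hinge_transport[OF assms ii that] frame_map_basis(1)[OF fr(1)]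
    by (simp add: body_motion_def linear_add[OF frame_map_linear] linear_scale[OF
      frame_map_linear] add.assoc)
qed

lemma (in flexed) continuous_body_motion:
  assumes "continuous_on {0<..} (\<lambda>t. p' t i)"
  shows "continuous_on {0<..} (\<lambda>t. body_motion u w p (U t) (W t) (p' t) i x)"
proof -
  have "continuous_on {0<..} (\<lambda>t. hinge_dir (U t) (W t) i (i + 1))"
    unfolding hinge_dir_def using cross_UW_nonzero[of i "i + 1"]
    by (intro continuous_on_sgn continuous_on_cross cont_U cont_W) auto
  then show ?thesis
    unfolding body_motion_def frame_map_def
    by (intro continuous_intros continuous_on_cross assms cont_U)
qed

section \<open>Uniqueness: the twists determine the ratios of half-angle tangents\<close>

lemma half_angle_twist:
  fixes c d m n r :: real
  assumes "\<bar>c\<bar> < 1" "\<bar>d\<bar> < 1" "0 < m" "0 < n" "m\<^sup>2 = 1 - c\<^sup>2" "n\<^sup>2 = 1 - d\<^sup>2"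
  defines "x \<equiv> (m / (1 + c)) / (n / (1 + d))"
  shows "2 * ((1 - r * (c - d) - c * d) / (m * n)) = (1 + r) * x + (1 - r) / x"
proof -
  have p: "1 + c > 0" "1 + d > 0" using assms(1,2) by auto
  have f: "1 - c\<^sup>2 = (1 - c) * (1 + c)" "1 - d\<^sup>2 = (1 - d) * (1 + d)"
    by (simp_all add: power2_eq_square algebra_simps)
  \<comment> \<open>As \<open>m\<close> and \<open>n\<close> are the sines,
    \<open>m / (1 + c)\<close> and \<open>n / (1 + d)\<close> are half-angle tangents. Splitting the
    squared sines into linear factors expresses the ratio and its inverse without roots.\<close>
  have "x * (n * m) = m\<^sup>2 * (1 + d) / (1 + c)"
    unfolding x_def using assms(4) by (simp add: power2_eq_square)
  then have x1: "x * (n * m) = (1 - c) * (1 + d)" using p unfolding assms(5) f by simp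
  have "(1 / x) * (n * m) = n\<^sup>2 * (1 + c) / (1 + d)"
    unfolding x_def using assms(3) by (simp add: power2_eq_square)
  then have x2: "(1 / x) * (n * m) = (1 + c) * (1 - d)" using p unfolding assms(6) f by simp
  have "((1 + r) * x + (1 - r) / x) * (m * n) = (1 + r) * (x * (n * m)) + (1 - r) * ((1 / x) * (n * m))"
    by (simp only: distrib_right divide_inverse mult.assoc mult.commute[of m n] mult_1_left)
  also have "\<dots> = 2 * (1 - r * (c - d) - c * d)" unfolding x1 x2 by (simp add: algebra_simps)
  finally show ?thesis using assms(3,4) by (simp add: field_simps)
qed

text \<open>The second equation, multiplied by \<open>r\<close>, is the first with the sign of the
  \<open>1 / x\<close> term changed. Sum and difference separate \<open>x\<close> from
  \<open>1 / x\<close>, and \<open>1 + r\<close> and \<open>1 - r\<close> do not both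
  vanish.\<close>

lemma two_twists_determine_ratio:
  fixes x y r :: real
  assumes "(1 + r) * x + (1 - r) / x = (1 + r) * y + (1 - r) / y"
    "(1 + 1 / r) * x + (1 - 1 / r) / x = (1 + 1 / r) * y + (1 - 1 / r) / y" "0 < x" "0 < y" "r \<noteq> 0"
  shows "x = y"
proof -
  have 1: "(1 + r) * (x - y) + (1 - r) * (1 / x - 1 / y) = 0"
    using assms(1) by (simp add: algebra_simps)
  have "r * ((1 + 1 / r) * z + (1 - 1 / r) / z) = (1 + r) * z - (1 - r) * (1 / z)" if "0 < z" for z
    using assms(5) that by (simp add: field_simps)
  from this[OF assms(3)] this[OF assms(4)] have "(1 + r) * x - (1 - r) * (1 / x) = (1 + r) * y -
    (1 - r) * (1 / y)"
    by (simp only: assms(2))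
  then have 2: "(1 + r) * (x - y) - (1 - r) * (1 / x - 1 / y) = 0" by (simp only: right_diff_distrib)
  have "(1 + r) * (x - y) = 0" "(1 - r) * (1 / x - 1 / y) = 0" using 1 2 by linarith+
  then show ?thesis using assms(3,4) by (cases "r = -1") auto
qed

text \<open>\<open>tan (\<theta>/2)\<close> for the angle \<open>\<theta>\<close> between the directions of two lines\<close>

definition half_tan :: "(4 \<Rightarrow> space) \<Rightarrow> (4 \<Rightarrow> space) \<Rightarrow> 4 \<Rightarrow> 4 \<Rightarrow> real" where
  "half_tan u w i k = norm (u i \<times> w k) / (1 + u i \<bullet> w k)"

text \<open>The converse of the definition of \<open>turn_cos\<close>: the squared half-angle
  tangent is (1 - cos) / (1 + cos), so its scaling by \<open>t\<close> determines the cosine, and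
  then the sine.\<close>

lemma turn_of_half_tan:
  fixes c c' n n' t :: real
  assumes "\<bar>c\<bar> < 1" "\<bar>c'\<bar> < 1" "0 < n" "0 < n'" "n\<^sup>2 = 1 - c\<^sup>2" "n'\<^sup>2 = 1 - c'\<^sup>2"
    and t: "n' / (1 + c') = t * (n / (1 + c))"
  shows "c' = turn_cos t c" "n' = turn_scale t c * n"
proof -
  have p: "1 + c > 0" "1 + c' > 0" using assms(1,2) by auto
  have sq: "(n / (1 + c))\<^sup>2 = (1 - c) / (1 + c)" if "1 + c > 0" "n\<^sup>2 = 1 - c\<^sup>2" for n c :: real
  proof -
    have "1 - c\<^sup>2 = (1 - c) * (1 + c)" by (simp add: power2_eq_square algebra_simps)
    then show ?thesis using that by (simp add: power_divide power2_eq_square[of "1 + c"])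
  qed
  have "(1 - c') / (1 + c') = t\<^sup>2 * ((1 - c) / (1 + c))"
  proof -
    have "(1 - c') / (1 + c') = (t * (n / (1 + c)))\<^sup>2"
      unfolding t[symmetric] by (rule sq[OF p(2) assms(6), symmetric])
    then show ?thesis by (simp only: power_mult_distrib sq[OF p(1) assms(5)])
  qed
  then have e: "(1 - c') * (1 + c) = t\<^sup>2 * (1 - c) * (1 + c')" using p by (simp add: field_simps)
  have D: "(1 + c) + t\<^sup>2 * (1 - c) > 0" by (rule turn_denom_pos[OF assms(1)])
  have "c' * ((1 + c) + t\<^sup>2 * (1 - c)) = (1 + c) - t\<^sup>2 * (1 - c)" using e by (simp add: algebra_simps)
  then show c': "c' = turn_cos t c" using D by (simp add: turn_cos_def field_simps)
  have "n' * (1 + c) = t * n * (1 + c')" using t p by (simp add: field_simps)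
  moreover have "(1 + c') * ((1 + c) + t\<^sup>2 * (1 - c)) = 2 * (1 + c)" using e by (simp add: algebra_simps)
  ultimately have "n' * ((1 + c) + t\<^sup>2 * (1 - c)) * (1 + c) = 2 * t * n * (1 + c)" by algebra
  then have "n' * ((1 + c) + t\<^sup>2 * (1 - c)) = 2 * t * n" using p(1) by simp
  then show "n' = turn_scale t c * n" using D by (simp add: turn_scale_def field_simps)
qed

context skew_directions
begin

text \<open>The twists on the bodies of \<open>u i\<close> and \<open>w l\<close> involve the same
  pair of joint angles, since opposite joints of an isogram have equal angles. Their equations have
  the parameters \<open>r\<close> and \<open>1 / r\<close>.\<close>

lemma half_tan_ratio:
  assumes "isogram_directions u' w' a b"
    and pos: "\<And>i k. i \<noteq> k \<Longrightarrow> u' i \<times> w' k \<noteq> 0"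
    and hu: "\<And>i k l. distinct [i, k, l] \<Longrightarrow>
      hinge_dir u' w' i k \<bullet> hinge_dir u' w' i l = hinge_dir u w i k \<bullet> hinge_dir u w i l"
    and hw: "\<And>i j l. distinct [i, j, l] \<Longrightarrow>
      hinge_dir w' u' l i \<bullet> hinge_dir w' u' l j = hinge_dir w u l i \<bullet> hinge_dir w u l j"
    and d: "distinct [i, k, l]"
  shows "half_tan u' w' i k / half_tan u' w' i l = half_tan u w i k / half_tan u w i l"
proof -
  obtain j where "distinct [i, k, l, j]" using d by (rule fourth_index)
  then have j: "distinct [i, j, k, l]" and ik: "i \<noteq> k" "i \<noteq> l" "j \<noteq> l" by auto
  define r where "r = (a l - a k) / (b j - b i)"
  have "a l - a k \<noteq> 0" "b j - b i \<noteq> 0"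
    using j by (auto intro!: a_diff_nonzero b_diff_nonzero simp del: right_minus_eq)
  then have r: "r \<noteq> 0" "b j - b i = (a l - a k) / r" "a l - a k \<noteq> 0" by (auto simp: r_def)
  \<comment> \<open>Stated for arbitrary directions, to be used for the reference pose and for the
    competing one.\<close>
  have key: "2 * (hinge_dir u w i k \<bullet> hinge_dir u w i l)
      = (1 + r) * (half_tan u w i k / half_tan u w i l) + (1 - r) / (half_tan u w i k / half_tan u w i l)
    \<and> 2 * (hinge_dir w u l j \<bullet> hinge_dir w u l i)
      = (1 + 1 / r) * (half_tan u w i k / half_tan u w i l) + (1 - 1 / r) / (half_tan u w i k /
        half_tan u w i l)
    \<and> 0 < half_tan u w i k / half_tan u w i l"
    if dir: "isogram_directions u w a b" and nz: "\<And>i k. i \<noteq> k \<Longrightarrow> u i \<times> w k \<noteq> 0" for u w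
  proof -
    interpret isogram_directions u w a b by (rule dir)
    interpret dual: isogram_directions w u b a by (rule dual)
    let ?c = "u i \<bullet> w k" and ?d = "u i \<bullet> w l" and ?m = "norm (u i \<times> w k)" and ?n = "norm (u i \<times> w l)"
    have m: "?m > 0" "?n > 0" "?m\<^sup>2 = 1 - ?c\<^sup>2" "?n\<^sup>2 = 1 - ?d\<^sup>2"
      using nz ik norm_cross_uw by auto
    have lt: "\<bar>x\<bar> < 1" if "0 < y" "y\<^sup>2 = 1 - x\<^sup>2" for x y :: real
      using that by (metis abs_square_less_1 diff_gt_0_iff_gt zero_less_power)
    have cd: "\<bar>?c\<bar> < 1" "\<bar>?d\<bar> < 1" by (rule lt[OF m(1,3)], rule lt[OF m(2,4)])
    have opp: "u j \<bullet> w l = ?c" "u j \<bullet> w k = ?d"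
      using inner_opposite[of i j k l] inner_opposite[of j i k l] j by auto
    have ww: "w k \<bullet> w l = 1 - r * (?c - ?d)"
    proof -
      have "(a l - a k) * (r * (?c - ?d)) = r * ((b j - b i) * (1 - w k \<bullet> w l))"
        using one_minus_inner_w[OF j] by simp
      also have "\<dots> = (a l - a k) * (1 - w k \<bullet> w l)" unfolding r(2) using r(1) by simp
      finally have "r * (?c - ?d) = 1 - w k \<bullet> w l" using r(3) by (simp only: mult_cancel_left) simp
      then show ?thesis by simp
    qed
    have uu: "u j \<bullet> u i = 1 - (1 / r) * (?c - ?d)"
    proof -
      have "(a l - a k) * ((1 / r) * (?c - ?d)) = (a l - a k) * (1 - u i \<bullet> u j)"
        using one_minus_inner_u[OF j] unfolding opp r(2) by simp
      then have "(1 / r) * (?c - ?d) = 1 - u i \<bullet> u j" using r(3) by (simp only: mult_cancel_left) simp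
      then show ?thesis by (simp add: inner_commute)
    qed
    have "(norm (u j \<times> w l))\<^sup>2 = ?m\<^sup>2" unfolding norm_cross_uw opp ..
    then have jl: "norm (w l \<times> u j) = ?m" by (subst cross_skew) simp
    have li: "norm (w l \<times> u i) = ?n" by (subst cross_skew) simp
    have "0 < ?m / (1 + ?c)" "0 < ?n / (1 + ?d)" using m cd by (auto intro!: divide_pos_pos)
    then have "0 < (?m / (1 + ?c)) / (?n / (1 + ?d))" by (rule divide_pos_pos)
    then show ?thesis
      unfolding hinge_inner ww dual.hinge_inner jl li uu half_tan_def
        inner_commute[of "w l"] opp half_angle_twist[OF cd m]
      by (intro conjI) (assumption | rule half_angle_twist[OF cd m] | simp add: mult.commute
        half_angle_twist[OF cd m])+
  qed
  have 0: "isogram_directions u w a b" by unfold_locales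
  note A = key[OF 0 cross_nonzero] and B = key[OF assms(1) pos]
  have l: "distinct [j, i, l]" using j by auto
  show ?thesis
    by (rule two_twists_determine_ratio[of r]) (use A B hu[OF d] hw[OF l] r(1) in auto)
qed

text \<open>All ratios of half-angle tangents at \<open>u 0\<close> agree with the reference, so the
  three tangents are multiplied by one factor \<open>t\<close>. Cosine, sine and hinge direction
  then recover each spoke, and the spokes recover the rest.\<close>

lemma flex_unique:
  assumes dir: "isogram_directions u' w' a b"
    and pos: "\<And>i k. i \<noteq> k \<Longrightarrow> u' i \<times> w' k \<noteq> 0"
    and hu: "\<And>i k l. distinct [i, k, l] \<Longrightarrow>
      hinge_dir u' w' i k \<bullet> hinge_dir u' w' i l = hinge_dir u w i k \<bullet> hinge_dir u w i l"
    and hw: "\<And>i j l. distinct [i, j, l] \<Longrightarrow>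
      hinge_dir w' u' l i \<bullet> hinge_dir w' u' l j = hinge_dir w u l i \<bullet> hinge_dir w u l j"
    and u0: "u' 0 = u 0" and h0: "\<And>k. k \<noteq> 0 \<Longrightarrow> hinge_dir u' w' 0 k = hinge_dir u w 0 k"
  defines "t \<equiv> half_tan u' w' 0 1 / half_tan u w 0 1"
  shows "0 < t" "u' = flex_u t" "w' = flex_w t"
proof -
  interpret T: isogram_directions u' w' a b by (rule dir)
  have lt: "\<bar>u' i \<bullet> w' k\<bar> < 1" if "i \<noteq> k" for i k
    using T.norm_cross_uw[of i k] pos[OF that]
    by (metis abs_square_less_1 diff_gt_0_iff_gt zero_less_norm_iff zero_less_power)
  have pos': "half_tan u' w' i k > 0" "half_tan u w i k > 0" if "i \<noteq> k" for i k
    using pos[OF that] cross_nonzero[OF that] lt[OF that] abs_inner_less_1[OF that]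
    by (auto simp: half_tan_def intro!: divide_pos_pos)
  then show "0 < t" by (simp add: t_def)
  have ht: "half_tan u' w' 0 k = t * half_tan u w 0 k" if "k \<noteq> 0" for k
  proof (cases "k = 1")
    case True
    then show ?thesis using pos'(2)[of 0 1] by (simp add: t_def)
  next
    case False
    then have "distinct [0, k, 1]" using that by auto
    from half_tan_ratio[OF dir pos hu hw this]
    show ?thesis using pos'[of 0 1] pos'[of 0 k] that by (simp add: t_def field_simps)
  qed
  have spoke: "w' k = flex_spoke t k" if "k \<noteq> 0" for k
  proof -
    have k: "0 \<noteq> k" using that by simp
    have tr: "u' 0 \<bullet> w' k = turn_cos t (u 0 \<bullet> w k)"
      "norm (u' 0 \<times> w' k) = turn_scale t (u 0 \<bullet> w k) * norm (u 0 \<times> w k)"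
      using turn_of_half_tan[OF abs_inner_less_1[OF k] lt[OF k] _ _ norm_cross_uw T.norm_cross_uw]
        ht[OF that] pos[OF k] cross_nonzero[OF k] by (auto simp: half_tan_def)
    \<comment> \<open>A vector is rebuilt from its component along a unit vector and its cross
      product with it. Here these are the cosine, and the sine times the known hinge
      direction.\<close>
    have rec: "x = (v \<bullet> x) *\<^sub>R v - v \<times> (v \<times> x)" if "v \<bullet> v = 1" for v x
      unfolding Lagrange using that by simp
    have "w' k = (u 0 \<bullet> w' k) *\<^sub>R u 0 - u 0 \<times> (norm (u' 0 \<times> w' k) *\<^sub>R hinge_dir u w 0 k)"
      using rec[OF unit_u[of 0], of "w' k"] cross_eq_hinge_dir[of u' 0 w' k] h0[OF that]
      by (simp add: u0)
    also have "\<dots> = turn_cos t (u 0 \<bullet> w k) *\<^sub>R u 0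
        - turn_scale t (u 0 \<bullet> w k) *\<^sub>R (u 0 \<times> (norm (u 0 \<times> w k) *\<^sub>R hinge_dir u w 0 k))"
      using tr by (simp add: u0 cross_mult_right)
    also have "\<dots> = flex_spoke t k"
      unfolding cross_eq_hinge_dir[symmetric] flex_spoke_def Lagrange unit_u
      by (simp add: algebra_simps)
    finally show ?thesis .
  qed
  have "w' k = flex_w t k" if "k \<noteq> 0" for k
    using spoke[OF that] that exhaust_mod4[of k] by (auto simp: flex_simps)
  then show "u' = flex_u t" "w' = flex_w t"
    using isogram_directions_unique[OF flex_directions(1)[of t] dir] u0 by (auto simp: flex_simps)
qed

end

section \<open>Poses near a non-aligned pose\<close>

locale skew_net = skew_directions u w a b for u w a b +
  fixes p q :: "4 \<Rightarrow> space" and I :: "4 \<Rightarrow> 4 \<Rightarrow> space set"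
  assumes net: "i \<noteq> k \<Longrightarrow> p i + a k *\<^sub>R u i = q k + b i *\<^sub>R w k"
    and hinge: "i \<noteq> k \<Longrightarrow> I i k = pline (p i + a k *\<^sub>R u i) (u i \<times> w k)"

text \<open>The sine of the joint angle, signed so that it is positive in the reference pose\<close>

definition joint_sine :: "(4 \<Rightarrow> space) \<Rightarrow> (4 \<Rightarrow> space) \<Rightarrow> 4 \<Rightarrow> 4 \<Rightarrow> placement \<Rightarrow> real" where
  "joint_sine u w i k x =
     (lin (fst x i) (u i) \<times> lin (snd x k) (w k)) \<bullet> lin (fst x i) (hinge_dir u w i k)"

lemma cross_parallel:
  fixes n x y :: space
  assumes "norm n = 1" "n \<bullet> x = 0" "n \<bullet> y = 0"
  shows "x \<times> y = ((x \<times> y) \<bullet> n) *\<^sub>R n"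
proof -
  have nn: "n \<bullet> n = 1" using assms(1) by (simp add: norm_eq_1)
  have "n \<times> (x \<times> y) = 0" using assms(2,3) by (simp add: Lagrange)
  then have "n \<times> (n \<times> (x \<times> y)) = 0" by simp
  then have "(n \<bullet> (x \<times> y)) *\<^sub>R n - x \<times> y = 0" using nn by (simp add: Lagrange[of n n])
  then show ?thesis by (simp add: inner_commute)
qed

lemma continuous_on_placement:
  "continuous_on S (\<lambda>x::placement. fst x i y)" "continuous_on S (\<lambda>x::placement. snd x i y)"
  using continuous_on_product_then_coordinatewise[OF continuous_on_product_then_coordinatewise[OF
        continuous_on_fst[OF continuous_on_id]], of S i y]
    continuous_on_product_then_coordinatewise[OF continuous_on_product_then_coordinatewise[OF
        continuous_on_snd[OF continuous_on_id]], of S i y] by simp_all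

lemma continuous_on_lin_placement:
  "continuous_on S (\<lambda>x::placement. lin (fst x i) y)" "continuous_on S (\<lambda>x::placement. lin (snd x i) y)"
  unfolding lin_def by (intro continuous_intros continuous_on_placement)+

lemma continuous_on_triple:
  fixes f g h :: "'a::topological_space \<Rightarrow> space"
  assumes "continuous_on S f" "continuous_on S g" "continuous_on S h"
  shows "continuous_on S (\<lambda>x. (f x \<times> g x) \<bullet> h x)"
  unfolding inner_vec_def sum_3 cross_components inner_real_def
  by (intro continuous_intros assms)

lemma continuous_on_joint_sine: "continuous_on S (joint_sine u w i k)"
  unfolding joint_sine_def[abs_def]
  by (intro continuous_on_triple continuous_on_lin_placement)

text \<open>Finitely many strict inequalities between continuous functions; this supplies the
  neighbourhood in which poses are parametrised.\<close>

lemma open_joint_sine_pos: "open {x. \<forall>i k. i \<noteq> k \<longrightarrow> 0 < joint_sine u w i k x}"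
proof -
  have "{x. \<forall>i k. i \<noteq> k \<longrightarrow> 0 < joint_sine u w i k x}
      = (\<Inter>i. \<Inter>k. {x. i \<noteq> k \<longrightarrow> 0 < joint_sine u w i k x})" by auto
  moreover have "open {x. i \<noteq> k \<longrightarrow> 0 < joint_sine u w i k x}" for i k
    using open_Collect_less[OF continuous_on_const continuous_on_joint_sine, of 0 u w i k]
    by (cases "i = k") auto
  ultimately show ?thesis by (simp add: open_INT)
qed

context skew_net
begin

lemma hinge_point: "i \<noteq> k \<Longrightarrow> p i + a k *\<^sub>R u i \<in> I i k"
  by (simp add: hinge)

text \<open>The normalisation \<open>fst x 0 = id\<close> picks one pose per class, and the sign
  condition excludes other branches. The flex parametrises precisely this set.\<close>

definition near_poses :: "placement set" where
  "near_poses = {x. pose I x \<and> fst x 0 = id \<and> (\<forall>i k. i \<noteq> k \<longrightarrow> 0 < joint_sine u w i k x)}"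

definition flex_pose :: "real \<Rightarrow> placement" where
  "flex_pose t = (body_motion u w p (flex_u t) (flex_w t) (net_p (flex_u t) (flex_w t) a b (p 0)),
     body_motion w u q (flex_w t) (flex_u t) (net_q (flex_u t) (flex_w t) a b (p 0)))"

text \<open>The inverse of \<open>flex_pose\<close>: the half-angle tangent at the joint between the
  bodies Gamma 0 and Delta 1, divided by its reference value.\<close>

definition flex_parameter :: "placement \<Rightarrow> real" where
  "flex_parameter x = joint_sine u w 0 1 x / (1 + lin (fst x 0) (u 0) \<bullet> lin (snd x 1) (w 1))
     / half_tan u w 0 1"

lemma flex_pose_near:
  assumes t: "0 < t"
  shows "flex_pose t \<in> near_poses"
proof -
  interpret F: flexed u w a b flex_u flex_w by (rule flexed_flex)
  interpret D: flexed w u b a flex_w flex_u by (rule F.dual_flexed)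
  define U where "U = flex_u t"
  define W where "W = flex_w t"
  interpret T: isogram_directions U W a b unfolding U_def W_def by (rule F.dirs)
  define X where "X = body_motion u w p U W (net_p U W a b (p 0))"
  define Y where "Y = body_motion w u q W U (net_q U W a b (p 0))"
  have x: "flex_pose t = (X, Y)" by (simp add: flex_pose_def X_def Y_def U_def W_def)
  note BX = F.body_motion_flex[OF t, where p = p and p' = "net_p U W a b (p 0)", folded U_def
    W_def, folded X_def]
  note BY = D.body_motion_flex[OF t, where p = q and p' = "net_q U W a b (p 0)", folded U_def
    W_def, folded Y_def]
  have agree: "X i z = Y k z" if ik: "i \<noteq> k" and z: "z \<in> I i k" for i k z
  proof -
    obtain s where "z = p i + a k *\<^sub>R u i + s *\<^sub>R (u i \<times> w k)"
      using z unfolding hinge[OF ik] by (rule mem_plineE)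
    then have "z = p i + a k *\<^sub>R u i + (s * norm (u i \<times> w k)) *\<^sub>R hinge_dir u w i k"
      by (subst (asm) cross_eq_hinge_dir) simp
    then obtain r where r: "z = p i + a k *\<^sub>R u i + r *\<^sub>R hinge_dir u w i k" by blast
    \<comment> \<open>Seen from the other body, the hinge direction has the opposite sign, hence the
      coordinate \<open>- r\<close>.\<close>
    then have r': "z = q k + b i *\<^sub>R w k + (- r) *\<^sub>R hinge_dir w u k i"
      unfolding net[OF ik] hinge_dir_dual[of w u] by simp
    have "X i z = net_p U W a b (p 0) i + a k *\<^sub>R U i + r *\<^sub>R hinge_dir U W i k"
      unfolding r by (rule BX(2)[OF ik])
    also have "\<dots> = net_q U W a b (p 0) k + b i *\<^sub>R W k + (- r) *\<^sub>R hinge_dir W U k i"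
      unfolding T.net_positions[OF ik] hinge_dir_dual[of W U] by simp
    also have "\<dots> = Y k z"
      unfolding r' by (rule BY(2)[symmetric]) (use ik in simp)
    finally show ?thesis .
  qed
  have id: "X 0 = id"
  proof (rule ext)
    fix z
    \<comment> \<open>A spoke changes only by a positive factor and a multiple of
      \<open>u 0\<close>, so the frame of the body at rest is unchanged.\<close>
    have "hinge_dir U W 0 1 = sgn (turn_scale t (u 0 \<bullet> w 1) *\<^sub>R (u 0 \<times> w 1))"
      by (simp add: hinge_dir_def U_def W_def flex_simps flex_spoke_def cross_add_right cross_mult_right
          Cross3.right_diff_distrib)
    then have h: "hinge_dir U W 0 1 = hinge_dir u w 0 1"
      using turn_scale_pos[OF abs_inner_less_1[of 0 1] t] by (simp add: sgn_scaleR hinge_dir_def)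
    have fr: "frame (u 0) (hinge_dir u w 0 1)" by (rule hinge_frame[OF cross_nonzero]) simp
    have "X 0 z = p 0 + frame_map (u 0) (hinge_dir u w 0 1) (u 0) (hinge_dir u w 0 1) (z - p 0)"
      unfolding X_def body_motion_def by (simp add: net_simps h) (simp add: U_def flex_simps)
    then show "X 0 z = id z" by (simp add: frame_map_id[OF fr])
  qed
  have sine: "0 < joint_sine u w i k (X, Y)" if ik: "i \<noteq> k" for i k
  proof -
    have ki: "k \<noteq> i" using ik by simp
    have "lin (X i) (u i) = U i" "lin (X i) (hinge_dir u w i k) = hinge_dir U W i k"
      using BX(2)[OF ik, of 1 0] BX(2)[OF ik, of 0 1] BX(2)[OF ik, of 0 0]
        rigid_motion_eq[OF BX(1)[of i], of "p i" "u i"]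
        rigid_motion_eq[OF BX(1)[of i], of "p i" "hinge_dir u w i k"] by simp_all
    moreover have "lin (Y k) (w k) = W k"
      using BY(2)[OF ki, of 1 0] BY(2)[OF ki, of 0 0] rigid_motion_eq[OF BY(1)[of k], of "q k" "w k"]
      by simp
    moreover have "U i \<times> W k \<noteq> 0"
      unfolding U_def W_def by (rule F.cross_UW_nonzero[OF ik t])
    ultimately show ?thesis
      by (simp add: joint_sine_def hinge_dir_def sgn_div_norm dot_square_norm power2_eq_square)
  qed
  show ?thesis
    unfolding near_poses_def x pose_def using BX(1) BY(1) agree id sine by auto
qed

lemma near_pose_directions:
  assumes x: "(X, Y) \<in> near_poses"
    and u'_def: "u' = (\<lambda>i. lin (X i) (u i))" and w'_def: "w' = (\<lambda>k. lin (Y k) (w k))"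
  shows "isogram_directions u' w' a b"
    and "i \<noteq> k \<Longrightarrow> X i (p i) + a k *\<^sub>R u' i = Y k (q k) + b i *\<^sub>R w' k"
    and "i \<noteq> k \<Longrightarrow> joint_sine u w i k (X, Y) = norm (u' i \<times> w' k)"
    and "i \<noteq> k \<Longrightarrow> u' i \<times> w' k \<noteq> 0"
    and "i \<noteq> k \<Longrightarrow> lin (X i) (hinge_dir u w i k) = hinge_dir u' w' i k"
    and "i \<noteq> k \<Longrightarrow> lin (Y k) (hinge_dir w u k i) = hinge_dir w' u' k i"
proof -
  have rig: "rigid_motion (X i)" "rigid_motion (Y i)" for i
    using x by (auto simp: near_poses_def pose_def)
  have agree: "X i z = Y k z" if "i \<noteq> k" "z \<in> I i k" for i k z
    using x that by (auto simp: near_poses_def pose_def)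
  have sine: "0 < joint_sine u w i k (X, Y)" if "i \<noteq> k" for i k
    using x that by (auto simp: near_poses_def)
  have scale: "lin f (c *\<^sub>R v) = c *\<^sub>R lin f v" if "rigid_motion f" for f c v
    using linear_scale[OF lin_linear[OF that]] .
  have net': "X i (p i) + a k *\<^sub>R u' i = Y k (q k) + b i *\<^sub>R w' k" if ik: "i \<noteq> k" for i k
  proof -
    have "X i (p i) + a k *\<^sub>R u' i = X i (p i + a k *\<^sub>R u i)"
      by (simp add: u'_def rigid_motion_eq[OF rig(1)] scale[OF rig(1)])
    also have "\<dots> = Y k (p i + a k *\<^sub>R u i)" by (rule agree[OF ik hinge_point[OF ik]])
    also have "\<dots> = Y k (q k) + b i *\<^sub>R w' k"
      unfolding net[OF ik] by (simp add: w'_def rigid_motion_eq[OF rig(2)] scale[OF rig(2)])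
    finally show ?thesis .
  qed
  have hinge': "lin (X i) (hinge_dir u w i k) = lin (Y k) (hinge_dir u w i k)" if ik: "i \<noteq> k" for i k
  proof -
    let ?R = "p i + a k *\<^sub>R u i" and ?n = "u i \<times> w k"
    have "?R + ?n \<in> I i k" unfolding hinge[OF ik] by (rule mem_plineI[of _ _ 1]) simp
    then have "X i (?R + ?n) = Y k (?R + ?n)" by (rule agree[OF ik])
    then have "lin (X i) ?n = lin (Y k) ?n"
      using agree[OF ik hinge_point[OF ik]] by (simp only: rigid_motion_eq[OF rig(1)]
        rigid_motion_eq[OF rig(2)]) simp
    then show ?thesis
      by (simp add: hinge_dir_def sgn_div_norm scale[OF rig(1)] scale[OF rig(2)])
  qed
  show dirs: "isogram_directions u' w' a b"
    by unfold_locales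
      (auto simp: u'_def w'_def lin_inner[OF rig(1)] lin_inner[OF rig(2)] unit_u unit_w inj_a inj_b
        intro: net_closing[OF net'[unfolded u'_def w'_def]])
  show "X i (p i) + a k *\<^sub>R u' i = Y k (q k) + b i *\<^sub>R w' k" if "i \<noteq> k" by (rule net'[OF that])
  {
    fix i k :: 4 assume ik: "i \<noteq> k"
    let ?n = "lin (X i) (hinge_dir u w i k)"
    have fr: "frame (u i) (hinge_dir u w i k)" by (rule hinge_frame[OF cross_nonzero[OF ik]])
    have n: "norm ?n = 1" "?n \<bullet> u' i = 0"
      using fr by (auto simp: frame_def u'_def lin_norm[OF rig(1)] lin_inner[OF rig(1)] inner_commute)
    have "?n \<bullet> w' k = 0"
      unfolding hinge'[OF ik] w'_def lin_inner[OF rig(2)]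
      by (simp add: hinge_dir_def sgn_div_norm dot_cross_self)
    \<comment> \<open>The moved hinge is orthogonal to both moved lines, so it is parallel to their
      cross product, with \<open>joint_sine\<close> as factor. Positivity makes the oriented hinge
      directions agree.\<close>
    then have c: "u' i \<times> w' k = joint_sine u w i k (X, Y) *\<^sub>R ?n"
      using cross_parallel[OF n, of "w' k"] by (simp add: joint_sine_def u'_def w'_def)
    show "joint_sine u w i k (X, Y) = norm (u' i \<times> w' k)"
      unfolding c using sine[OF ik] n(1) by simp
    show "u' i \<times> w' k \<noteq> 0" unfolding c using sine[OF ik] n(1) by auto
    show eq: "?n = hinge_dir u' w' i k"
      unfolding hinge_dir_def[of u' w'] c using sine[OF ik] n(1) by (simp add: sgn_scaleR sgn_div_norm)
    show "lin (Y k) (hinge_dir w u k i) = hinge_dir w' u' k i"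
      unfolding hinge_dir_dual[of w u] hinge_dir_dual[of w' u'] eq[symmetric] hinge'[OF ik]
      using scale[OF rig(2), of k "-1"] by simp
  }
qed

text \<open>The bodies are rigid, so their twists are those of the reference pose and
  \<open>flex_unique\<close> gives the directions. Then \<open>net_unique\<close> gives the base
  points and \<open>rigid_motion_frame\<close> the motions.\<close>

lemma near_pose_flex:
  assumes x: "x \<in> near_poses"
  shows "0 < flex_parameter x" "flex_pose (flex_parameter x) = x"
    "flex_parameter x = half_tan (\<lambda>i. lin (fst x i) (u i)) (\<lambda>k. lin (snd x k) (w k)) 0 1 /
      half_tan u w 0 1"
proof -
  obtain X Y where xy: "x = (X, Y)" by (cases x)
  define u' where "u' = (\<lambda>i. lin (X i) (u i))"
  define w' where "w' = (\<lambda>k. lin (Y k) (w k))"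
  note N = near_pose_directions[OF x[unfolded xy] u'_def w'_def]
  have rig: "rigid_motion (X i)" "rigid_motion (Y i)" for i
    using x by (auto simp: near_poses_def pose_def xy)
  have X0: "X 0 = id" using x by (simp add: near_poses_def xy)
  define t where "t = half_tan u' w' 0 1 / half_tan u w 0 1"
  have ft: "flex_parameter x = t"
    using N(3)[of 0 1] by (simp add: flex_parameter_def xy t_def half_tan_def u'_def w'_def)
  then show "flex_parameter x = half_tan (\<lambda>i. lin (fst x i) (u i)) (\<lambda>k. lin (snd x k) (w k)) 0 1 /
    half_tan u w 0 1"
    by (simp add: t_def u'_def w'_def xy)
  have hu: "hinge_dir u' w' i k \<bullet> hinge_dir u' w' i l = hinge_dir u w i k \<bullet> hinge_dir u w i l"
    if d: "distinct [i, k, l]" for i k l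
  proof -
    have "i \<noteq> k" "i \<noteq> l" using d by auto
    then show ?thesis using N(5)[symmetric] by (simp add: lin_inner[OF rig(1)])
  qed
  have hw: "hinge_dir w' u' l i \<bullet> hinge_dir w' u' l j = hinge_dir w u l i \<bullet> hinge_dir w u l j"
    if d: "distinct [i, j, l]" for i j l
  proof -
    have "i \<noteq> l" "j \<noteq> l" using d by auto
    then show ?thesis using N(6)[symmetric] by (simp add: lin_inner[OF rig(2)])
  qed
  have u0: "u' 0 = u 0" by (simp add: u'_def X0 lin_def)
  have h0: "hinge_dir u' w' 0 k = hinge_dir u w 0 k" if "k \<noteq> 0" for k
    using N(5)[of 0 k] that by (simp add: X0 lin_def)
  note FU = flex_unique[OF N(1) N(4) hu hw u0 h0, folded t_def]
  have FU2: "u' = flex_u t" "w' = flex_w t" using FU(2,3) by blast+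
  show "0 < flex_parameter x" unfolding ft by (rule FU(1))
  have P: "(\<lambda>i. X i (p i)) = net_p u' w' a b (p 0)" "(\<lambda>k. Y k (q k)) = net_q u' w' a b (p 0)"
    using net_unique[where p = "\<lambda>i. X i (p i)" and q = "\<lambda>k. Y k (q k)" and u = u' and w = w' and a
      = a and b = b]
      N(2) by (simp_all add: X0)
  have ii: "i \<noteq> i + 1" "i + 1 \<noteq> i" for i :: 4 by simp_all
  have "X i z = body_motion u w p u' w' (net_p u' w' a b (p 0)) i z" for i z
  proof -
    have fr: "frame (u i) (hinge_dir u w i (i + 1))" by (rule hinge_frame[OF cross_nonzero[OF ii(1)]])
    show ?thesis
      using rigid_motion_frame[OF rig(1) fr, of i z "p i"] fun_cong[OF P(1), of i] N(5)[OF ii(1), of i]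
      by (simp add: body_motion_def u'_def)
  qed
  then have 1: "X = body_motion u w p u' w' (net_p u' w' a b (p 0))" by (intro ext)
  have "Y i z = body_motion w u q w' u' (net_q u' w' a b (p 0)) i z" for i z
  proof -
    interpret dual: skew_directions w u b a by (rule dual_skew)
    have fr: "frame (w i) (hinge_dir w u i (i + 1))" by (rule dual.hinge_frame[OF
      dual.cross_nonzero[OF ii(1)]])
    show ?thesis
      using rigid_motion_frame[OF rig(2) fr, of i z "q i"] fun_cong[OF P(2), of i] N(6)[OF ii(2), of i]
      by (simp add: body_motion_def w'_def)
  qed
  then have 2: "Y = body_motion w u q w' u' (net_q u' w' a b (p 0))" by (intro ext)
  have "flex_pose t = (X, Y)"
    using 1 2 unfolding FU2 flex_pose_def by simp
  then show "flex_pose (flex_parameter x) = x" by (simp only: ft) (simp only: xy)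
qed

lemma flex_parameter_flex_pose:
  assumes t: "0 < t"
  shows "flex_parameter (flex_pose t) = t"
proof -
  interpret F: flexed u w a b flex_u flex_w by (rule flexed_flex)
  let ?x = "flex_pose t"
  let ?s = "flex_parameter ?x"
  have s: "0 < ?s" "flex_pose ?s = ?x" using near_pose_flex[OF flex_pose_near[OF t]] by auto
  have lin_w: "lin (snd (flex_pose t) 1) (w 1) = flex_w t 1" if "0 < t" for t
  proof -
    interpret D: flexed w u b a flex_w flex_u by (rule F.dual_flexed)
    let ?q = "net_q (flex_u t) (flex_w t) a b (p 0)"
    note BY = D.body_motion_flex[OF that, where p = q and p' = ?q]
    have "1 \<noteq> (0 :: 4)" by simp
    from BY(2)[OF this, of 1 0] BY(2)[OF this, of 0 0] rigid_motion_eq[OF BY(1)[of 1], of "q 1" "w 1"]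
    show ?thesis by (simp add: flex_pose_def)
  qed
  \<comment> \<open>The poses at \<open>?s\<close> and \<open>t\<close> are known to coincide; one
    joint cosine suffices, because \<open>turn_cos\<close> is injective in a positive
    parameter.\<close>
  have "flex_w ?s 1 = flex_w t 1" using lin_w[OF s(1)] lin_w[OF t] by (simp add: s(2))
  then have e: "turn_cos ?s (u 0 \<bullet> w 1) = turn_cos t (u 0 \<bullet> w 1)"
    using inner_spoke(1)[of 1] by (simp add: flex_simps) metis
  have lt: "\<bar>u 0 \<bullet> w 1\<bar> < 1" by (rule abs_inner_less_1) simp
  define c where "c = u 0 \<bullet> w 1"
  have c: "1 + c > 0" "1 - c > 0" using lt by (auto simp: c_def)
  have D: "(1 + c) + ?s\<^sup>2 * (1 - c) \<noteq> 0" "(1 + c) + t\<^sup>2 * (1 - c) \<noteq> 0"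
    using turn_denom_pos[OF lt, of ?s] turn_denom_pos[OF lt, of t] unfolding c_def by linarith+
  have "((1 + c) - ?s\<^sup>2 * (1 - c)) * ((1 + c) + t\<^sup>2 * (1 - c)) = ((1 + c) - t\<^sup>2 * (1 - c)) * ((1 +
    c) + ?s\<^sup>2 * (1 - c))"
    using e D unfolding turn_cos_def c_def[symmetric] by (simp add: frac_eq_eq)
  then have "(1 + c) * (1 - c) * (t\<^sup>2 - ?s\<^sup>2) = 0" by algebra
  then have "t\<^sup>2 = ?s\<^sup>2" using c by simp
  then show ?thesis using t s(1) by (metis less_imp_le power2_eq_imp_eq)
qed

lemma continuous_flex_pose: "continuous_on {0<..} flex_pose"
proof -
  interpret F: flexed u w a b flex_u flex_w by (rule flexed_flex)
  interpret D: flexed w u b a flex_w flex_u by (rule F.dual_flexed)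
  have p: "continuous_on {0<..} (\<lambda>t. net_p (flex_u t) (flex_w t) a b (p 0) i)" for i
    using exhaust_mod4[of i] by (auto simp: net_simps intro!: continuous_intros F.cont_U F.cont_W)
  have q: "continuous_on {0<..} (\<lambda>t. net_q (flex_u t) (flex_w t) a b (p 0) i)" for i
    using exhaust_mod4[of i] by (auto simp: net_simps(5-8) intro!: continuous_intros F.cont_U F.cont_W p)
  show ?thesis
    unfolding flex_pose_def[abs_def]
    by (intro continuous_on_Pair continuous_on_coordinatewise_then_product
        F.continuous_body_motion[where p' = "\<lambda>t. net_p (flex_u t) (flex_w t) a b (p 0)", OF p]
        D.continuous_body_motion[where p' = "\<lambda>t. net_q (flex_u t) (flex_w t) a b (p 0)", OF q])
qed

lemma continuous_flex_parameter: "continuous_on near_poses flex_parameter"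
proof -
  have pos: "1 + lin (fst x 0) (u 0) \<bullet> lin (snd x 1) (w 1) \<noteq> 0" if x: "x \<in> near_poses" for x
  proof
    \<comment> \<open>Division by zero yields 0, so a vanishing denominator would make the parameter
      0, against its positivity.\<close>
    assume 0: "1 + lin (fst x 0) (u 0) \<bullet> lin (snd x 1) (w 1) = 0"
    show False using near_pose_flex(1)[OF x] 0 by (simp add: flex_parameter_def)
  qed
  have "half_tan u w 0 1 \<noteq> 0"
    using cross_nonzero[of 0 1] abs_inner_less_1[of 0 1] by (auto simp: half_tan_def)
  then show ?thesis
    unfolding flex_parameter_def
    by (intro continuous_intros continuous_on_joint_sine continuous_on_lin_placement) (use pos in auto)
qed

lemma flex_pose_1: "flex_pose 1 = (\<lambda>_. id, \<lambda>_. id)"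
proof -
  let ?x = "(\<lambda>_. id, \<lambda>_. id) :: placement"
  have lid: "lin id = (\<lambda>v. v)" by (rule ext) (simp add: lin_def)
  have "0 < joint_sine u w i k ?x" if "i \<noteq> k" for i k
    using cross_nonzero[OF that]
    by (simp add: joint_sine_def lid hinge_dir_def sgn_div_norm dot_square_norm power2_eq_square)
  then have x: "?x \<in> near_poses"
    by (simp add: near_poses_def pose_def rigid_motion_id)
  have "half_tan u w 0 1 \<noteq> 0"
    using cross_nonzero[of 0 1] abs_inner_less_1[of 0 1] by (auto simp: half_tan_def)
  then have "flex_parameter ?x = 1" unfolding near_pose_flex(3)[OF x] by (simp add: lid)
  then show ?thesis using near_pose_flex(2)[OF x] by simp
qed

end

section \<open>Relative poses and change of the reference pose\<close>

lemma pose_left_compose: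
  assumes "pose I (A, B)" "rigid_motion f"
  shows "pose I (\<lambda>i. f \<circ> A i, \<lambda>k. f \<circ> B k)"
  using assms by (auto simp: pose_def rigid_motion_compose)

lemma relative_poses_eq: "relative_poses I = {x. pose I x \<and> fst x 0 = id}"
proof (intro equalityI subsetI)
  fix x assume "x \<in> relative_poses I"
  then obtain A B where p: "pose I (A, B)" "x = relative_placement (A, B)"
    unfolding relative_poses_def by auto
  then have A0: "rigid_motion (A 0)" by (simp add: pose_def)
  have "pose I x" unfolding p(2) relative_placement_def
    using pose_left_compose[OF p(1) rigid_motion_inv[OF A0]] by simp
  moreover have "fst x 0 = id"
    using bij_is_inj[OF rigid_motion_bij[OF A0]] by (simp add: p(2) relative_placement_def)
  ultimately show "x \<in> {x. pose I x \<and> fst x 0 = id}" by simp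
next
  fix x assume "x \<in> {x. pose I x \<and> fst x 0 = id}"
  then have "pose I x" "relative_placement x = x"
    by (auto simp: relative_placement_def prod_eq_iff case_prod_beta)
  then show "x \<in> relative_poses I" unfolding relative_poses_def by (metis image_eqI mem_Collect_eq)
qed

text \<open>Each body is first moved by \<open>y\<close> and then by \<open>x\<close>. If
  \<open>y\<close> is a pose, this turns placements measured from the pose \<open>y\<close> into
  placements measured from the reference pose.\<close>

definition compose_placement :: "placement \<Rightarrow> placement \<Rightarrow> placement" where
  "compose_placement y x = (\<lambda>i. fst x i \<circ> fst y i, \<lambda>k. snd x k \<circ> snd y k)"

lemma continuous_compose_placement:
  assumes "continuous_on S f"
  shows "continuous_on S (\<lambda>t. compose_placement y (f t))"
proof -
  have "continuous_on S (\<lambda>t. fst (f t) i z)" "continuous_on S (\<lambda>t. snd (f t) i z)" for i z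
    using continuous_on_compose2[OF continuous_on_placement(1)[of UNIV i z] assms]
      continuous_on_compose2[OF continuous_on_placement(2)[of UNIV i z] assms] by simp_all
  then show ?thesis
    unfolding compose_placement_def o_def
    by (intro continuous_on_Pair continuous_on_coordinatewise_then_product)
qed

lemma homeomorphic_greaterThan_unit_interval: "{0::real<..} homeomorphic {0<..<1::real}"
proof -
  have "homeomorphism {0<..} {0<..<1} (\<lambda>x. x / (1 + x)) (\<lambda>y::real. y / (1 - y))"
    by (rule homeomorphismI) (auto intro!: continuous_intros simp: field_simps)
  then show ?thesis
    unfolding homeomorphic_def
    by (intro exI[where x = "\<lambda>x::real. x / (1 + x)"] exI[where x = "\<lambda>y::real. y / (1 - y)"])
qed

lemma rigid_motion_continuous:
  assumes "rigid_motion f"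
  shows "continuous_on S f"
proof -
  have eq: "(\<lambda>x. f 0 + lin f x) = f" by (rule ext) (simp add: lin_def)
  have "continuous_on S (\<lambda>x. f 0 + lin f x)"
    using lin_linear[OF assms] by (intro continuous_intros linear_continuous_on) (simp add:
      linear_conv_bounded_linear)
  then show ?thesis unfolding eq .
qed

text \<open>The given relative pose \<open>y\<close> becomes the reference pose, with hinges
  \<open>J\<close>. Composition with \<open>y\<close> is a homeomorphism of placements taking poses
  for \<open>J\<close> to poses for \<open>I\<close>, so the flex at parameter 1 starts in
  \<open>y\<close>.\<close>

lemma flexible_at_skew_net:
  assumes pose: "pose I (A, B)"
    and net: "skew_net u w a b p q (\<lambda>i k. (inv (A 0) \<circ> A i) ` I i k)"
  shows "continuously_flexible I (A, B)" "poses_locally_one_dimensional I (A, B)"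
proof -
  define J where "J = (\<lambda>i k. (inv (A 0) \<circ> A i) ` I i k)"
  interpret skew_net u w a b p q J unfolding J_def by (rule net)
  define y where "y = relative_placement (A, B)"
  define y' :: placement where "y' = (\<lambda>i. inv (fst y i), \<lambda>k. inv (snd y k))"
  have A0: "rigid_motion (A 0)" using pose by (simp add: pose_def)
  have y_rel: "y \<in> relative_poses I" unfolding y_def relative_poses_def using pose by blast
  then have y: "pose I y" "fst y 0 = id" by (auto simp: relative_poses_eq)
  have ry: "rigid_motion (fst y i)" "rigid_motion (snd y i)" for i
    using y(1) by (auto simp: pose_def case_prod_beta)
  have yI: "fst y i = inv (A 0) \<circ> A i" for i by (simp add: y_def relative_placement_def)
  have inv: "compose_placement y' (compose_placement y x) = x" "compose_placement y
    (compose_placement y' x) = x" for x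
    using ry[THEN rigid_motion_bij]
    by (auto simp: compose_placement_def y'_def prod_eq_iff fun_eq_iff bij_is_surj surj_f_inv_f
      bij_is_inj)
  have y_agree: "fst y i z = snd y k z" if "i \<noteq> k" "z \<in> I i k" for i k z
    using y(1) that by (auto simp: pose_def case_prod_beta)
  have J: "J i k = fst y i ` I i k" for i k by (simp add: J_def yI)
  have pose_iff: "pose J x \<longleftrightarrow> pose I (compose_placement y x)" for x
  proof
    assume x: "pose J x"
    have "fst x i (fst y i z) = snd x k (snd y k z)" if "i \<noteq> k" "z \<in> I i k" for i k z
    proof -
      have "fst y i z \<in> J i k" using that(2) by (simp add: J)
      then have "fst x i (fst y i z) = snd x k (fst y i z)"
        using x that(1) by (auto simp: pose_def case_prod_beta)
      then show ?thesis using y_agree[OF that] by simp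
    qed
    then show "pose I (compose_placement y x)"
      using x ry by (auto simp: pose_def case_prod_beta compose_placement_def rigid_motion_compose)
  next
    assume x: "pose I (compose_placement y x)"
    have "fst x i = (fst x i \<circ> fst y i) \<circ> inv (fst y i)" "snd x i = (snd x i \<circ> snd y i) \<circ> inv (snd
      y i)" for i
      using ry[of i, THEN rigid_motion_bij] by (auto simp: fun_eq_iff bij_is_surj surj_f_inv_f)
    moreover have "rigid_motion (fst x i \<circ> fst y i)" "rigid_motion (snd x i \<circ> snd y i)" for i
      using x by (auto simp: pose_def compose_placement_def)
    ultimately have "rigid_motion (fst x i)" "rigid_motion (snd x i)" for i
      using rigid_motion_compose rigid_motion_inv ry by metis+
    moreover have "fst x i z = snd x k z" if ik: "i \<noteq> k" and zI: "z \<in> J i k" for i k z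
    proof -
      obtain v where v: "v \<in> I i k" "z = fst y i v" using zI by (auto simp: J)
      have "fst x i (fst y i v) = snd x k (snd y k v)"
        using x v(1) ik by (auto simp: pose_def compose_placement_def)
      then show ?thesis using y_agree[OF ik v(1)] v(2) by simp
    qed
    ultimately show "pose J x" by (auto simp: pose_def case_prod_beta)
  qed
  define S where "S = {x. \<forall>i k. i \<noteq> k \<longrightarrow> 0 < joint_sine u w i k x}"
  have near: "near_poses = {x. compose_placement y x \<in> relative_poses I} \<inter> S"
  proof -
    have "fst (compose_placement y x) 0 = fst x 0" for x by (simp add: compose_placement_def y(2))
    then show ?thesis unfolding near_poses_def S_def relative_poses_eq pose_iff by auto
  qed
  define U where "U = relative_poses I \<inter> compose_placement y' -` S"
  have U: "U = compose_placement y ` near_poses"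
  proof (intro equalityI subsetI)
    fix x assume "x \<in> U"
    then have "compose_placement y' x \<in> near_poses" by (simp add: U_def near inv)
    then show "x \<in> compose_placement y ` near_poses" using inv(2)[of x] by (metis image_eqI)
  qed (auto simp: U_def near inv)
  have open_U: "openin (top_of_set (relative_poses I)) U"
    unfolding U_def
    by (intro openin_open_Int open_vimage continuous_compose_placement continuous_on_id)
      (simp add: S_def open_joint_sine_pos)
  have "homeomorphism {0<..} U (\<lambda>t. compose_placement y (flex_pose t)) (\<lambda>x. flex_parameter
    (compose_placement y' x))"
  proof (rule homeomorphismI)
    show "continuous_on {0<..} (\<lambda>t. compose_placement y (flex_pose t))"
      by (intro continuous_compose_placement continuous_flex_pose)
    show "continuous_on U (\<lambda>x. flex_parameter (compose_placement y' x))"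
      by (rule continuous_on_compose2[OF continuous_flex_parameter])
        (auto simp: U inv intro!: continuous_compose_placement continuous_on_id)
  qed (auto simp: U inv flex_pose_near near_pose_flex(1,2) flex_parameter_flex_pose)
  then have "{0::real<..} homeomorphic U" unfolding homeomorphic_def by blast
  then have "U homeomorphic {0<..<1::real}"
    using homeomorphic_trans[OF _ homeomorphic_greaterThan_unit_interval] homeomorphic_sym by blast
  moreover have y1: "compose_placement y (flex_pose 1) = y"
    by (simp add: flex_pose_1 compose_placement_def)
  then have "y \<in> U" using flex_pose_near[of 1] unfolding U by force
  ultimately show "poses_locally_one_dimensional I (A, B)"
    unfolding poses_locally_one_dimensional_def y_def[symmetric] using open_U by blast
  \<comment> \<open>The motion uses the parameters from 1 to 2 with Gamma 0 at rest;
    \<open>m\<close> then restores the given placement of Gamma 0.\<close>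
  define z where "z t = compose_placement y (flex_pose (1 + t))" for t
  define m :: "real \<Rightarrow> placement" where "m t = (\<lambda>i. A 0 \<circ> fst (z t) i, \<lambda>k. A 0 \<circ> snd (z t) k)" for t
  have z: "z t \<in> relative_poses I" if "t \<in> {0..1}" for t
    using flex_pose_near[of "1 + t"] that unfolding z_def near by auto
  have sur: "A 0 (inv (A 0) x) = x" and inj: "inv (A 0) (A 0 x) = x" for x
    using rigid_motion_bij[OF A0] by (simp_all add: bij_is_surj surj_f_inv_f bij_is_inj)
  have rel: "relative_placement (m t) = z t" if "t \<in> {0..1}" for t
  proof -
    have "fst (z t) 0 = id" using z[OF that] by (simp add: relative_poses_eq)
    then show ?thesis by (simp add: relative_placement_def m_def prod_eq_iff o_def inj)
  qed
  have "z 0 = y" by (simp add: z_def y1)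
  then have "m 0 = (A, B)"
    by (simp add: m_def y_def relative_placement_def sur fun_eq_iff)
  moreover have "pose I (m t)" if "t \<in> {0..1}" for t
    using pose_left_compose[OF _ A0, of I "fst (z t)" "snd (z t)"] z[OF that]
    by (simp add: m_def relative_poses_eq)
  moreover have "inj_on (relative_placement \<circ> m) {0..1}"
  proof (rule inj_onI)
    fix s t :: real assume st: "s \<in> {0..1}" "t \<in> {0..1}" "(relative_placement \<circ> m) s =
      (relative_placement \<circ> m) t"
    have "flex_pose (1 + r) = compose_placement y' (z r)" for r by (simp add: z_def inv)
    moreover have "z s = z t" using st rel by simp
    ultimately have "flex_parameter (flex_pose (1 + s)) = flex_parameter (flex_pose (1 + t))" by simp
    then have "1 + s = 1 + t" using st(1,2) by (simp add: flex_parameter_flex_pose)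
    then show "s = t" by simp
  qed
  moreover have "continuous_on {0..1} m"
  proof -
    have "continuous_on {0..1} z"
      unfolding z_def
      by (intro continuous_compose_placement continuous_on_compose2[OF continuous_flex_pose])
        (auto intro!: continuous_intros)
    then have c: "continuous_on {0..1} (\<lambda>t. fst (z t) i x)" "continuous_on {0..1} (\<lambda>t. snd (z t) i
      x)" for i x
      using continuous_on_compose2[OF continuous_on_placement(1)[of UNIV i x]]
        continuous_on_compose2[OF continuous_on_placement(2)[of UNIV i x]] by simp_all
    have "continuous_on {0..1} (\<lambda>t. A 0 (c t))" if "continuous_on {0..1} c" for c :: "real \<Rightarrow> space"
      by (rule continuous_on_compose2[OF rigid_motion_continuous[OF A0, of UNIV] that]) simp
    from this[OF c(1)] this[OF c(2)]
    have "continuous_on {0..1} (\<lambda>t. A 0 (fst (z t) i x))" "continuous_on {0..1} (\<lambda>t. A 0 (snd (z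
      t) i x))" for i x .
    then show ?thesis
      unfolding m_def o_def
      by (intro continuous_on_Pair continuous_on_coordinatewise_then_product)
  qed
  ultimately show "continuously_flexible I (A, B)"
    unfolding continuously_flexible_def by blast
qed

section \<open>Nets with an axis\<close>

text \<open>With complex coordinates orthogonal to an axis, rotations about it are multiplications
  by unit numbers, and halfturns about lines crossing it at right angles involve
  conjugation.\<close>

definition plane :: "space \<Rightarrow> space \<Rightarrow> complex \<Rightarrow> space" where
  "plane e f z = Re z *\<^sub>R e + Im z *\<^sub>R f"

lemma plane_add: "plane e f (v + z) = plane e f v + plane e f z"
  and plane_diff: "plane e f (v - z) = plane e f v - plane e f z"
  and plane_minus: "plane e f (- z) = - plane e f z"
  and plane_scaleR: "plane e f (of_real r * z) = r *\<^sub>R plane e f z"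
  and plane_0 [simp]: "plane e f 0 = 0"
  by (simp_all add: plane_def algebra_simps)

lemma plane_inner:
  assumes "frame e f"
  shows "plane e f v \<bullet> plane e f z = Re (v * cnj z)" "plane e f v \<bullet> (e \<times> f) = 0" "(e \<times> f) \<bullet> plane
    e f v = 0"
  using frame_inner[OF assms]
  by (simp_all add: plane_def inner_add_left inner_add_right algebra_simps)

lemma norm_plane: "frame e f \<Longrightarrow> norm (plane e f z) = cmod z"
  by (simp add: norm_eq_sqrt_inner plane_inner complex_norm_square[symmetric] cmod_power2 cmod_def
    power2_eq_square)

lemma plane_eq_iff:
  assumes "frame e f"
  shows "plane e f v + r *\<^sub>R (e \<times> f) = plane e f z + s *\<^sub>R (e \<times> f) \<longleftrightarrow> v = z \<and> r = s"
proof
  assume eq: "plane e f v + r *\<^sub>R (e \<times> f) = plane e f z + s *\<^sub>R (e \<times> f)"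
  from arg_cong[OF eq, of "\<lambda>x. x \<bullet> (e \<times> f)"] have "r = s"
    by (simp add: inner_add_left plane_inner[OF assms] frame_inner[OF assms])
  moreover have "plane e f (v - z) = 0" using eq \<open>r = s\<close> by (simp add: plane_diff)
  then have "cmod (v - z) = 0" using norm_plane[OF assms, of "v - z"] by simp
  ultimately show "v = z \<and> r = s" by simp
qed simp

lemma frame_cylindrical:
  assumes "frame e f"
  obtains v r where "x = plane e f v + r *\<^sub>R (e \<times> f)"
  using frame_expand[OF assms, of x] that[of "Complex (x \<bullet> e) (x \<bullet> f)" "x \<bullet> (e \<times> f)"] by (simp
    add: plane_def)

lemma frame_rotated:
  assumes "frame e f" "cmod z = 1"
  shows "frame (plane e f z) (plane e f (\<i> * z))" "plane e f z \<times> plane e f (\<i> * z) = e \<times> f"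
    "plane (plane e f z) (plane e f (\<i> * z)) v = plane e f (z * v)"
    "(e \<times> f) \<times> plane e f z = plane e f (\<i> * z)"
proof -
  have sq: "Re z * Re z + Im z * Im z = 1"
    using assms(2) by (metis cmod_power2 one_power2 power2_eq_square)
  have "plane e f z \<bullet> plane e f (\<i> * z) = 0" by (simp add: plane_inner[OF assms(1)])
  then show "frame (plane e f z) (plane e f (\<i> * z))"
    using assms(2) by (simp add: frame_def norm_plane[OF assms(1)] norm_mult)
  have "plane e f z \<times> plane e f (\<i> * z) = (Re z * Re z + Im z * Im z) *\<^sub>R (e \<times> f)"
    using cross_skew[of f e]
    by (simp add: plane_def cross_add_left cross_add_right Cross3.right_diff_distrib
        cross_mult_left cross_mult_right algebra_simps)
  then show "plane e f z \<times> plane e f (\<i> * z) = e \<times> f" using sq by simp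
  show "plane (plane e f z) (plane e f (\<i> * z)) v = plane e f (z * v)"
    by (simp add: plane_def algebra_simps)
  show "(e \<times> f) \<times> plane e f z = plane e f (\<i> * z)"
    using frame_cross[OF assms(1)]
    by (simp add: plane_def cross_add_right cross_mult_right)
qed

text \<open>In the plane, reflection in the real line through \<open>v\<close> is
  \<open>v\<^sup>2 * cnj z\<close>; heights are reflected in \<open>h\<close>.\<close>

lemma halfturn_across:
  assumes f: "frame e f" and v: "cmod v = 1"
  shows "halfturn (pline (cn + h *\<^sub>R (e \<times> f)) (plane e f v)) (cn + plane e f z + r *\<^sub>R (e \<times> f))
    = cn + plane e f (v\<^sup>2 * cnj z) + (2 * h - r) *\<^sub>R (e \<times> f)"
proof -
  have nv: "norm (plane e f v) = 1" using v by (simp add: norm_plane[OF f])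
  have "v * cnj v = 1" using v complex_norm_square[of v] by simp
  then have "of_real (2 * Re (z * cnj v)) * v - z = v\<^sup>2 * cnj z"
    unfolding complex_add_cnj[symmetric] by (simp add: power2_eq_square algebra_simps)
  then have eq: "plane e f (v\<^sup>2 * cnj z) = (2 * Re (z * cnj v)) *\<^sub>R plane e f v - plane e f z"
    by (metis plane_diff plane_scaleR)
  have "(cn + plane e f z + r *\<^sub>R (e \<times> f) - (cn + h *\<^sub>R (e \<times> f))) \<bullet> plane e f v = Re (z * cnj v)"
    by (simp add: inner_add_left inner_diff_left plane_inner[OF f])
  then show ?thesis
    unfolding halfturn_pline[OF nv] eq by (simp add: algebra_simps scaleR_2)
qed

lemma halfturn_rigid:
  assumes "line s"
  shows "rigid_motion (halfturn s)"
proof -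
  obtain c d where s: "norm d = 1" "s = pline c d" using assms by (rule lineE)
  have dd: "d \<bullet> d = 1" using s(1) by (simp add: norm_eq_1)
  define L where "L x = (2 * (x \<bullet> d)) *\<^sub>R d - x" for x
  \<comment> \<open>This is the dual-basis expansion [x,y,z]v = (v.x)(y x z) + (v.y)(z x x) +
    (v.z)(x x y), taken at z = v = d.\<close>
  have triple: "((x \<times> y) \<bullet> d) *\<^sub>R d = (d \<bullet> d) *\<^sub>R (x \<times> y) - (x \<bullet> d) *\<^sub>R (d \<times> y) - (y \<bullet> d) *\<^sub>R (x \<times>
    d)" for x y
    by (simp add: vec_eq_iff forall_3 cross_components inner_vec_def sum_3 algebra_simps)
  show ?thesis
  proof (rule rigid_motionI)
    show "linear L" by (rule linearI) (simp_all add: L_def inner_add_left algebra_simps)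
    show "L x \<bullet> L y = x \<bullet> y" for x y
      using dd by (simp add: L_def inner_diff_left inner_diff_right inner_commute[of d y] algebra_simps)
    show "L (x \<times> y) = L x \<times> L y" for x y
    proof -
      have "L x \<times> L y = x \<times> y - (2 * (x \<bullet> d)) *\<^sub>R (d \<times> y) - (2 * (y \<bullet> d)) *\<^sub>R (x \<times> d)"
        by (simp add: L_def Cross3.left_diff_distrib Cross3.right_diff_distrib cross_mult_left
          cross_mult_right algebra_simps)
      also have "\<dots> = 2 *\<^sub>R (((x \<times> y) \<bullet> d) *\<^sub>R d) - x \<times> y"
        unfolding triple dd by (simp add: algebra_simps scaleR_2)
      finally show ?thesis by (simp add: L_def)
    qed
    show "halfturn s x = L x + (2 *\<^sub>R c - (2 * (c \<bullet> d)) *\<^sub>R d)" for x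
      unfolding s(2) halfturn_pline[OF s(1)] L_def by (simp add: inner_diff_left algebra_simps)
  qed
qed

text \<open>A common perpendicular must be a multiple of \<open>\<i> * v\<close> in the plane. Since
  \<open>r\<close> is nonzero, the line is not parallel to the axis, and the foot has to lie at
  height \<open>h\<close>.\<close>

lemma common_perpendicular_pline:
  assumes f: "frame e f" and v: "cmod v = 1" and r: "r \<noteq> 0"
  shows "common_perpendicular (pline cn (e \<times> f)) (pline (cn + h *\<^sub>R (e \<times> f) + plane e f (of_real d
    * (\<i> * v))) (plane e f (of_real r * v) + m *\<^sub>R (e \<times> f)))
    = pline (cn + h *\<^sub>R (e \<times> f)) (plane e f (\<i> * v))"
proof -
  let ?N = "e \<times> f" and ?b = "plane e f (\<i> * v)"
  let ?u = "plane e f (of_real r * v) + m *\<^sub>R ?N"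
  let ?n = "pline cn ?N" and ?g = "pline (cn + h *\<^sub>R ?N + plane e f (of_real d * (\<i> * v))) ?u"
  have vv: "v * cnj v = 1" using v complex_norm_square[of v] by simp
  have nb: "norm ?b = 1" using v by (simp add: norm_plane[OF f] norm_mult)
  have ub: "?b \<bullet> ?u = 0" and Nb: "?b \<bullet> ?N = 0"
    using vv by (auto simp: inner_add_right plane_inner[OF f] frame_inner[OF f] algebra_simps)
  have perp: "is_common_perpendicular (pline (cn + h *\<^sub>R ?N) ?b) ?n ?g"
    unfolding is_common_perpendicular_def meets_orthogonally_pline
  proof (intro conjI ub Nb)
    show "line (pline (cn + h *\<^sub>R ?N) ?b)" using nb by (intro line_pline) auto
    have "cn + h *\<^sub>R ?N \<in> pline (cn + h *\<^sub>R ?N) ?b \<inter> ?n" by (auto intro: mem_plineI)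
    then show "pline (cn + h *\<^sub>R ?N) ?b \<inter> ?n \<noteq> {}" by blast
    have "cn + h *\<^sub>R ?N + plane e f (of_real d * (\<i> * v)) \<in> pline (cn + h *\<^sub>R ?N) ?b \<inter> ?g"
      by (auto intro!: mem_plineI[of _ _ d] simp: plane_scaleR)
    then show "pline (cn + h *\<^sub>R ?N) ?b \<inter> ?g \<noteq> {}" by blast
  qed
  have uniq: "c = pline (cn + h *\<^sub>R ?N) ?b" if c: "is_common_perpendicular c ?n ?g" for c
  proof -
    from c have "line c" and cn: "meets_orthogonally c ?n" and cg: "meets_orthogonally c ?g"
      unfolding is_common_perpendicular_def by auto
    obtain p0 k where k: "norm k = 1" "c = pline p0 k" using \<open>line c\<close> by (rule lineE)
    have k0: "k \<bullet> ?N = 0" "k \<bullet> ?u = 0" and ne: "c \<inter> ?n \<noteq> {}" "c \<inter> ?g \<noteq> {}"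
      using cn cg unfolding k(2) meets_orthogonally_pline by auto
    obtain z s where z: "k = plane e f z + s *\<^sub>R ?N" using f by (rule frame_cylindrical)
    have s: "s = 0" using k0(1) by (simp add: z inner_add_left plane_inner[OF f] frame_inner[OF f])
    have "Re (z * cnj v) = 0"
      using k0(2) r by (simp add: z s inner_add_left inner_add_right plane_inner[OF f]
        frame_inner[OF f] mult.left_commute[of z])
    then have "z * cnj v = \<i> * of_real (Im (z * cnj v))" by (simp add: complex_eq_iff)
    then have "z * cnj v * v = \<i> * of_real (Im (z * cnj v)) * v" by simp
    then obtain y where y: "z = of_real y * (\<i> * v)" using vv by (metis mult.assoc mult.commute mult_1)
    have ky: "k = y *\<^sub>R ?b" by (simp add: z s y plane_scaleR)
    then have y0: "y \<noteq> 0" using k(1) by auto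
    obtain x1 x2 where x: "x1 \<in> c" "x1 \<in> ?n" "x2 \<in> c" "x2 \<in> ?g" using ne by blast
    obtain t1 where t1: "x1 = cn + t1 *\<^sub>R ?N" using x(2) by (rule mem_plineE)
    obtain t2 where t2: "x2 = cn + h *\<^sub>R ?N + plane e f (of_real d * (\<i> * v)) + t2 *\<^sub>R ?u" using
      x(4) by (rule mem_plineE)
    have c1: "c = pline x1 k" unfolding k(2) by (rule pline_shift) (use x(1) k(2) in simp)
    then obtain t where t: "x2 = x1 + t *\<^sub>R k" using x(3) by (auto elim: mem_plineE)
    have "plane e f (of_real d * (\<i> * v) + of_real t2 * (of_real r * v)) + (h + t2 * m) *\<^sub>R ?N
      = plane e f (of_real (t * y) * (\<i> * v)) + t1 *\<^sub>R ?N"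
      using t unfolding t1 t2 ky plane_add plane_scaleR by (simp add: algebra_simps)
    then have *: "of_real d * (\<i> * v) + of_real t2 * (of_real r * v) = of_real (t * y) * (\<i> * v)"
      "h + t2 * m = t1"
      unfolding plane_eq_iff[OF f] by auto
    from *(1) have "(of_real d * \<i> + of_real (t2 * r)) * v = (of_real (t * y) * \<i>) * v" by (simp
      add: algebra_simps)
    then have "of_real d * \<i> + of_real (t2 * r) = of_real (t * y) * \<i>" using v by auto
    then have "Re (of_real d * \<i> + of_real (t2 * r)) = Re (of_real (t * y) * \<i>)" by simp
    then have "t2 = 0" using r by simp
    then have "x1 = cn + h *\<^sub>R ?N" using *(2) t1 by simp
    then show ?thesis unfolding c1 ky by (simp add: pline_scale[OF y0])
  qed
  show ?thesis unfolding common_perpendicular_def by (rule the_equality) (rule perp, rule uniq)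
qed

text \<open>A rotation fixing the axis pointwise fixes its direction, and the image of
  \<open>e\<close> determines that of \<open>f\<close> by a cross product. So a unit number and a
  height describe the displacement completely.\<close>

lemma helical_displacement_iff:
  assumes f: "frame e f"
  shows "helical_displacement (pline cn (e \<times> f)) D \<longleftrightarrow>
    (\<exists>z h. cmod z = 1 \<and> (\<forall>v r. D (cn + plane e f v + r *\<^sub>R (e \<times> f)) = cn + plane e f (z * v) + (r
      + h) *\<^sub>R (e \<times> f)))"
    (is "?L \<longleftrightarrow> ?R")
proof
  let ?N = "e \<times> f"
  assume ?L
  then obtain r c where r: "rotation_about (pline cn ?N) r" "\<forall>x\<in>pline cn ?N. x + c \<in> pline cn ?N"
    "D = (\<lambda>x. r x + c)"
    unfolding helical_displacement_def by blast
  have fixed: "r x = x" if "x \<in> pline cn ?N" for x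
    using r(1) that unfolding rotation_about_def by auto
  have rig: "rigid_motion r" using r(1) unfolding rotation_about_def by auto
  have "cn + c \<in> pline cn ?N" using r(2) by simp
  then obtain h where "cn + c = cn + h *\<^sub>R ?N" by (rule mem_plineE)
  then have h: "c = h *\<^sub>R ?N" by simp
  have lN: "lin r ?N = ?N"
    using fixed[of "cn + ?N"] fixed[of cn] rigid_motion_eq[OF rig, of cn ?N] mem_plineI[of "cn +
      ?N" cn 1 ?N] by simp
  obtain z s where z: "lin r e = plane e f z + s *\<^sub>R ?N" using f by (rule frame_cylindrical)
  have "lin r e \<bullet> lin r ?N = 0" unfolding lin_inner[OF rig] by (rule frame_inner[OF f])
  then have s: "s = 0" by (simp add: lN z inner_add_left plane_inner[OF f] frame_inner[OF f])
  have "norm (lin r e) = 1" using f by (simp add: lin_norm[OF rig] frame_def)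
  then have z1: "cmod z = 1" by (simp add: z s norm_plane[OF f])
  have "lin r f = lin r ?N \<times> lin r e" unfolding lin_cross[OF rig, symmetric] frame_cross[OF f] ..
  then have lf: "lin r f = plane e f (\<i> * z)" using frame_rotated(4)[OF f z1] by (simp add: lN z s)
  have "D (cn + plane e f v + t *\<^sub>R ?N) = cn + plane e f (z * v) + (t + h) *\<^sub>R ?N" for v t
  proof -
    have "lin r (plane e f v) = plane (lin r e) (lin r f) v"
      unfolding plane_def by (simp add: linear_add[OF lin_linear[OF rig]] linear_scale[OF
        lin_linear[OF rig]])
    also have "\<dots> = plane e f (z * v)" unfolding lf using frame_rotated(3)[OF f z1, of v] by (simp
      add: z s)
    finally have "r (cn + plane e f v + t *\<^sub>R ?N) = cn + plane e f (z * v) + t *\<^sub>R ?N"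
      using fixed[of cn] lN by (simp add: rigid_motion_eq[OF rig] linear_scale[OF lin_linear[OF rig]])
    then show ?thesis by (simp add: r(3) h algebra_simps)
  qed
  then show ?R using z1 by blast
next
  let ?N = "e \<times> f"
  assume ?R
  then obtain z h where z1: "cmod z = 1"
    and D: "\<And>v r. D (cn + plane e f v + r *\<^sub>R ?N) = cn + plane e f (z * v) + (r + h) *\<^sub>R ?N" by blast
  define r where "r x = cn + frame_map e f (plane e f z) (plane e f (\<i> * z)) (x - cn)" for x
  note fr = frame_rotated[OF f z1]
  have rv: "r (cn + plane e f v + t *\<^sub>R ?N) = cn + plane e f (z * v) + t *\<^sub>R ?N" for v t
  proof -
    have "frame_map e f (plane e f z) (plane e f (\<i> * z)) (plane e f v + t *\<^sub>R ?N)
      = plane (plane e f z) (plane e f (\<i> * z)) v + t *\<^sub>R ?N"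
      unfolding plane_def[of e f v] plane_def[of "plane e f z"]
      by (simp add: linear_add[OF frame_map_linear] linear_scale[OF frame_map_linear]
        frame_map_basis[OF f] fr(2))
    then show ?thesis by (simp add: r_def fr(3) add.assoc)
  qed
  have "rotation_about (pline cn ?N) r"
    unfolding rotation_about_def
  proof (intro conjI ballI)
    show "rigid_motion r" using frame_map_rigid(1)[OF f fr(1)] unfolding r_def[abs_def] .
    fix x assume "x \<in> pline cn ?N"
    then obtain t where "x = cn + plane e f 0 + t *\<^sub>R ?N" by (auto elim: mem_plineE)
    then show "r x = x" using rv[of 0 t] by simp
  qed
  moreover have "\<forall>x\<in>pline cn ?N. x + h *\<^sub>R ?N \<in> pline cn ?N"
  proof
    fix x assume "x \<in> pline cn ?N"
    then obtain t where "x = cn + t *\<^sub>R ?N" by (rule mem_plineE)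
    then show "x + h *\<^sub>R ?N \<in> pline cn ?N" by (intro mem_plineI[of _ _ "t + h"]) (simp add:
      algebra_simps)
  qed
  moreover have "D = (\<lambda>x. r x + h *\<^sub>R ?N)"
  proof
    fix x
    obtain v t where "x - cn = plane e f v + t *\<^sub>R ?N" using f by (rule frame_cylindrical)
    then have x: "x = cn + plane e f v + t *\<^sub>R ?N" by (simp add: algebra_simps)
    show "D x = r x + h *\<^sub>R ?N" unfolding x D rv by (simp add: algebra_simps)
  qed
  ultimately show ?L unfolding helical_displacement_def by blast
qed

locale axial_net =
  fixes e f cn :: space and rho sig mu nu d d' :: real and z :: "4 \<Rightarrow> complex" and H :: "4 \<Rightarrow> real"
    and u w :: "4 \<Rightarrow> space" and g h :: "4 \<Rightarrow> space set"
  assumes frame: "frame e f" and pos: "0 < rho" "0 < sig"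
    and unit_z: "cmod (z i) = 1" and inj_z: "inj z"
    and prod_z: "distinct [i, j, k, l] \<Longrightarrow> z i * z j * z k * z l = 1"
    and sum_H: "distinct [i, j, k, l] \<Longrightarrow> H i + H j + H k + H l = 0"
    and u: "u i = plane e f (of_real rho * z i) + mu *\<^sub>R (e \<times> f)"
    and w: "w i = plane e f (of_real sig * cnj (z i)) + nu *\<^sub>R (e \<times> f)"
    and unit: "norm (u i) = 1" "norm (w i) = 1"
    and g: "g i = pline (cn + H i *\<^sub>R (e \<times> f) + plane e f (of_real d * (\<i> * z i))) (u i)"
    and h: "h i = pline (cn + (- H i) *\<^sub>R (e \<times> f) + plane e f (of_real d' * (\<i> * cnj (z i)))) (w i)"

context skew_directions
begin

text \<open>Each difference of directions is parallel to the complementary difference in the other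
  family. Two independent differences of the \<open>u i\<close> therefore span a plane containing
  all differences of both families, and its normal is the one sought.\<close>

lemma common_normal:
  "\<exists>e f mu nu. frame e f \<and> (\<forall>i. u i \<bullet> (e \<times> f) = mu) \<and> (\<forall>i. w i \<bullet> (e \<times> f) = nu)"
proof -
  interpret dual: skew_directions w u b a by (rule dual_skew)
  define x y where "x = u 0 - u 1" and "y = u 0 - u 2"
  define n where "n = x \<times> y"
  have "n \<noteq> 0"
  proof
    assume "n = 0"
    then have "collinear {0, x, y}" unfolding n_def cross_eq_0 .
    then consider "x = 0" | "y = 0" | c where "y = c *\<^sub>R x" unfolding collinear_lemma by blast
    then show False
    proof cases
      case 1
      then show ?thesis using dual.independent_differences[of 0 1 2 1 0] by (simp add: x_def)
    next
      case 2
      then show ?thesis using dual.independent_differences[of 0 1 2 1 1] by (simp add: y_def)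
    next
      case 3
      then have "(1 - c) *\<^sub>R (u 0 - u 1) + 1 *\<^sub>R (u 1 - u 2) = 0"
        by (simp add: x_def y_def algebra_simps)
      then show ?thesis using dual.independent_differences[of 0 1 2 "1 - c" 1] by simp
    qed
  qed
  define N where "N = sgn n"
  have nN: "norm N = 1" using \<open>n \<noteq> 0\<close> by (simp add: N_def norm_sgn)
  have xy: "x \<bullet> N = 0" "y \<bullet> N = 0"
    by (simp_all add: N_def n_def sgn_div_norm dot_cross_self)
  have x0: "x \<noteq> 0" using \<open>n \<noteq> 0\<close> by (auto simp: n_def)
  have uu: "(w k - w l) \<bullet> N = 0" if "(u i - u j) \<bullet> N = 0" "distinct [k, l, i, j]" for i j k l
    unfolding dual.u_diff[OF that(2)] using that(1) by simp
  have ww: "(u i - u j) \<bullet> N = 0" if "(w k - w l) \<bullet> N = 0" "distinct [i, j, k, l]" for i j k l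
    unfolding u_diff[OF that(2)] using that(1) by simp
  have u1: "(u 0 - u 1) \<bullet> N = 0" "(u 0 - u 2) \<bullet> N = 0" using xy by (simp_all add: x_def y_def)
  then have u12: "(u 1 - u 2) \<bullet> N = 0" by (simp add: inner_diff_left)
  have w1: "(w 2 - w 3) \<bullet> N = 0" "(w 1 - w 3) \<bullet> N = 0" "(w 0 - w 3) \<bullet> N = 0"
    by (rule uu[OF u1(1)], simp) (rule uu[OF u1(2)], simp, rule uu[OF u12], simp)
  then have w12: "(w 1 - w 2) \<bullet> N = 0" by (simp add: inner_diff_left)
  have u3: "(u 0 - u 3) \<bullet> N = 0" by (rule ww[OF w12]) simp
  define e f where "e = sgn x" and "f = N \<times> e"
  have ne: "frame N e" using nN x0 xy(1) by (simp add: frame_def e_def norm_sgn sgn_div_norm[of x]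
    inner_commute)
  have ef: "e \<times> f = N" unfolding f_def by (rule frame_cross(1)[OF ne])
  have fr: "frame e f"
    using frame_inner[OF ne] by (simp add: frame_def norm_eq_1 f_def)
  have "u i \<bullet> (e \<times> f) = u 0 \<bullet> N" for i
    using exhaust_mod4[of i] u1 u3 by (auto simp: ef inner_diff_left)
  moreover have "w i \<bullet> (e \<times> f) = w 3 \<bullet> N" for i
    using exhaust_mod4[of i] w1 by (auto simp: ef inner_diff_left)
  ultimately show ?thesis using fr by blast
qed

end

text \<open>For points on the unit circle, the product of the end points determines the direction of
  the chord, and parallel chords have equal products.\<close>

lemma opposite_chords:
  fixes x y v z :: complex and A B :: real
  assumes "cmod x = 1" "cmod y = 1" "cmod v = 1" "cmod z = 1" "of_real A * (x - y) = of_real B * (v - z)"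
    and "x \<noteq> y" "A \<noteq> 0"
  shows "x * y = v * z"
proof -
  have inv: "x * cnj x = 1" "y * cnj y = 1" "v * cnj v = 1" "z * cnj z = 1"
    using assms(1-4) complex_norm_square[of x] complex_norm_square[of y] complex_norm_square[of v]
      complex_norm_square[of z]
    by simp_all
  have "of_real A * (cnj x - cnj y) = of_real B * (cnj v - cnj z)"
    using arg_cong[OF assms(5), of cnj] by simp
  then have "of_real A * (x - y) * (v * z) = of_real A * (x - y) * (x * y)"
    using inv assms(5) by algebra
  then show ?thesis using assms(6,7) by simp
qed

context skew_directions
begin

lemma polar_directions:
  assumes fr: "frame e f" and m: "\<And>i. u i \<bullet> (e \<times> f) = m"
  shows "\<exists>r x. 0 < r \<and> inj x \<and> (\<forall>i. cmod (x i) = 1 \<and> u i = plane e f (of_real r * x i) + m *\<^sub>R (e \<times> f))"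
proof -
  interpret dual: skew_directions w u b a by (rule dual_skew)
  define v where "v i = Complex (u i \<bullet> e) (u i \<bullet> f)" for i
  have u: "u i = plane e f (v i) + m *\<^sub>R (e \<times> f)" for i
    using frame_expand[OF fr, of "u i"] m by (simp add: v_def plane_def)
  define r where "r = sqrt (1 - m\<^sup>2)"
  have "u i \<bullet> u i = (cmod (v i))\<^sup>2 + m\<^sup>2" for i
    unfolding u by (simp add: inner_add_left inner_add_right plane_inner[OF fr] frame_inner[OF fr]
        complex_mult_cnj power2_eq_square cmod_def)
  then have "(cmod (v i))\<^sup>2 = 1 - m\<^sup>2" for i using unit_u[of i] by (simp add: algebra_simps)
  then have vr: "cmod (v i) = r" for i by (metis norm_ge_zero r_def real_sqrt_abs abs_of_nonneg)
  have inj_u: "u i \<noteq> u j" if "i \<noteq> j" for i j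
  proof
    assume eq: "u i = u j"
    obtain k l where "distinct [i, j, k, l]" using \<open>i \<noteq> j\<close> by (rule third_fourth_index)
    then have "w k \<bullet> (u i \<times> u j) \<noteq> 0" by (intro dual.skew) auto
    then show False by (simp add: eq)
  qed
  have inj_v: "v i \<noteq> v j" if "i \<noteq> j" for i j using inj_u[OF that] u by metis
  \<comment> \<open>Vanishing plane components would make the directions \<open>u i\<close>
    coincide.\<close>
  have "r \<noteq> 0" using inj_v[of 0 1] vr[of 0] vr[of 1] by auto
  then have r: "0 < r" using vr[of 0] norm_ge_zero[of "v 0"] by linarith
  define x where "x i = v i / of_real r" for i
  have "cmod (x i) = 1" "u i = plane e f (of_real r * x i) + m *\<^sub>R (e \<times> f)" for i
    using vr[of i] r u by (simp_all add: x_def norm_divide)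
  moreover have "inj x" using inj_v r by (auto simp: inj_def x_def)
  ultimately show ?thesis using r by blast
qed

lemma cylindrical_directions:
  "\<exists>e f rho sig mu nu z. frame e f \<and> 0 < rho \<and> 0 < sig \<and> (\<forall>i. cmod (z i) = 1) \<and> inj z \<and>
    (\<forall>i j k l. distinct [i, j, k, l] \<longrightarrow> z i * z j * z k * z l = 1) \<and>
    (\<forall>i. u i = plane e f (of_real rho * z i) + mu *\<^sub>R (e \<times> f)) \<and>
    (\<forall>i. w i = plane e f (of_real sig * cnj (z i)) + nu *\<^sub>R (e \<times> f))"
proof -
  interpret dual: skew_directions w u b a by (rule dual_skew)
  obtain e f mu nu where fr: "frame e f" and mu: "\<And>i. u i \<bullet> (e \<times> f) = mu" and nu: "\<And>i. w i \<bullet> (e \<times>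
    f) = nu"
    using common_normal by blast
  obtain rho x where rho: "0 < rho" and x: "inj x" "\<And>i. cmod (x i) = 1"
    and ux: "\<And>i. u i = plane e f (of_real rho * x i) + mu *\<^sub>R (e \<times> f)"
    using polar_directions[OF fr mu] by blast
  obtain sig y where sig: "0 < sig" and y: "inj y" "\<And>i. cmod (y i) = 1"
    and wy: "\<And>i. w i = plane e f (of_real sig * y i) + nu *\<^sub>R (e \<times> f)"
    using dual.polar_directions[OF fr nu] by blast
  have opp: "x i * x j = y k * y l" if d: "distinct [i, j, k, l]" for i j k l
  proof -
    define A B where "A = (a l - a k) * rho" and "B = (b j - b i) * sig"
    have "u i - u j = rho *\<^sub>R plane e f (x i - x j)" "w k - w l = sig *\<^sub>R plane e f (y k - y l)"
      by (simp_all add: ux wy plane_scaleR plane_diff scaleR_diff_right)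
    then have "(a l - a k) *\<^sub>R (u i - u j) = plane e f (of_real A * (x i - x j))"
      "(b j - b i) *\<^sub>R (w k - w l) = plane e f (of_real B * (y k - y l))"
      by (simp_all only: plane_scaleR A_def B_def scaleR_scaleR)
    then have "plane e f (of_real A * (x i - x j)) + 0 *\<^sub>R (e \<times> f) = plane e f (of_real B * (y k -
      y l)) + 0 *\<^sub>R (e \<times> f)"
      using closing[OF d] by simp
    then have "of_real A * (x i - x j) = of_real B * (y k - y l)" unfolding plane_eq_iff[OF fr] by simp
    moreover have "A \<noteq> 0" using rho a_diff_nonzero[of k l] d by (simp add: A_def)
    moreover have "x i \<noteq> x j" using x(1) d by (auto simp: inj_eq)
    ultimately show ?thesis by (intro opposite_chords[OF x(2) x(2) y(2) y(2)])
  qed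
  have nz: "x i \<noteq> 0" "y i \<noteq> 0" for i using x(2)[of i] y(2)[of i] by auto
  define T where "T = x 0 * y 0"
  have T: "x i * y i = T" for i
  \<comment> \<open>Dividing two instances of \<open>opp\<close> gives
    \<open>x i / x 0 = y 0 / y i\<close>.\<close>
  proof (cases "i = 0")
    case False
    then have "0 \<noteq> i" by simp
    then obtain j k where d: "distinct [0, i, j, k]" by (rule third_fourth_index)
    have "x i * x j = y 0 * y k" "x 0 * x j = y i * y k" using opp[of i j 0 k] opp[of 0 j i k] d by auto
    then have "x i * y i * (x j * y k) = x 0 * y 0 * (x j * y k)" by algebra
    then show ?thesis using nz by (simp add: T_def)
  qed (simp add: T_def)
  have T1: "cmod T = 1" using x(2) y(2) by (simp add: T_def norm_mult)
  \<comment> \<open>Turning the real axis into the direction of a square root of \<open>T\<close>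
    makes the plane directions of \<open>u i\<close> and \<open>w i\<close> conjugate.\<close>
  define om where "om = csqrt T"
  have om: "om * om = T" using power2_csqrt[of T] by (simp add: om_def power2_eq_square)
  have om1: "cmod om = 1"
  proof -
    have "(cmod om)\<^sup>2 = 1" using om T1 by (metis norm_mult power2_eq_square)
    then show ?thesis by (metis abs_norm_cancel abs_square_eq_1)
  qed
  then have om0: "om \<noteq> 0" by auto
  define z where "z i = x i / om" for i
  have z1: "cmod (z i) = 1" for i using x(2) om1 by (simp add: z_def norm_divide)
  have xz: "x i = om * z i" for i using om0 by (simp add: z_def)
  have zz: "z i * cnj (z i) = 1" for i using complex_norm_square[of "z i"] z1[of i] by simp
  have yz: "y i = om * cnj (z i)" for i
  proof -
    have "om * z i * y i = om * z i * (om * cnj (z i))"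
      using T[of i] zz[of i] unfolding xz om[symmetric] by algebra
    then show ?thesis using om0 z1[of i] by auto
  qed
  note rot = frame_rotated[OF fr om1]
  let ?e = "plane e f om" and ?f = "plane e f (\<i> * om)"
  show ?thesis
  proof (rule exI[of _ ?e], rule exI[of _ ?f], rule exI[of _ rho], rule exI[of _ sig], rule exI[of _ mu],
      rule exI[of _ nu], rule exI[of _ z], intro conjI allI impI)
    show "frame ?e ?f" "0 < rho" "0 < sig" by (fact rot(1) rho sig)+
    show "cmod (z i) = 1" for i by (rule z1)
    show "inj z" using x(1) om0 by (auto simp: inj_def z_def)
    show "z i * z j * z k * z l = 1" if d: "distinct [i, j, k, l]" for i j k l
    proof -
      have "om * om * (z i * z j) = om * om * (cnj (z k) * cnj (z l))"
        using opp[OF d] unfolding xz yz by algebra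
      then have "z i * z j = cnj (z k) * cnj (z l)" using om0 by simp
      then show ?thesis using zz[of k] zz[of l] by algebra
    qed
    show "u i = plane ?e ?f (of_real rho * z i) + mu *\<^sub>R (?e \<times> ?f)" for i
      unfolding rot(2,3) using ux[of i] by (simp add: xz mult_ac)
    show "w i = plane ?e ?f (of_real sig * cnj (z i)) + nu *\<^sub>R (?e \<times> ?f)" for i
      unfolding rot(2,3) using wy[of i] by (simp add: yz mult_ac)
  qed
qed

end

section \<open>Complex identities behind the axis\<close>

lemma unit_circle_noncollinear:
  assumes "cmod x = 1" "cmod y = 1" "cmod z = 1" "x \<noteq> y" "x \<noteq> z" "y \<noteq> z"
  shows "Im ((x - z) * cnj (y - z)) \<noteq> 0"
proof
  assume "Im ((x - z) * cnj (y - z)) = 0"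
  moreover have "c = cnj c" if "Im c = 0" for c using that by (simp add: complex_eq_iff)
  ultimately have "(x - z) * cnj (y - z) = cnj ((x - z) * cnj (y - z))" by blast
  then have eq: "(x - z) * (cnj y - cnj z) = (cnj x - cnj z) * (y - z)" by simp
  have "x * cnj x = 1" "y * cnj y = 1" "z * cnj z = 1"
    using assms(1-3) complex_norm_square[of x] complex_norm_square[of y] complex_norm_square[of z]
      by simp_all
  \<comment> \<open>Conjugation inverts unit numbers, so collinearity becomes a product of
    differences.\<close>
  then have "(x - z) * (z - y) * (x - y) = 0" using eq by algebra
  then show False using assms(4-6) by simp
qed

lemma solve_real_parts:
  assumes "Im (x * cnj y) \<noteq> 0"
  obtains c where "Re (c * x) = r" "Re (c * y) = s"
proof
  define D where "D = Re x * Im y - Re y * Im x"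
  have D: "D \<noteq> 0" using assms by (simp add: D_def algebra_simps)
  let ?c = "Complex ((r * Im y - s * Im x) / D) (- ((s * Re x - r * Re y) / D))"
  have "Re (?c * x) = r * D / D" "Re (?c * y) = s * D / D"
    unfolding D_def by (simp_all add: add_divide_distrib[symmetric] algebra_simps diff_divide_distrib)
  then show "Re (?c * x) = r" "Re (?c * y) = s" using D by simp_all
qed

lemma of_real_Re: "of_real (Re x) = (x + cnj x) / 2"
  by (simp add: complex_add_cnj)

text \<open>It shows that \<open>Re (c * z k)\<close> and \<open>Re (cnj c * z i)\<close>, up to
  scaling, solve the closing conditions. With conjugates replaced by inverses it is an identity of
  rational functions modulo \<open>x * y * v * z = 1\<close>.\<close>

lemma chord_identity:
  assumes "cmod x = 1" "cmod y = 1" "cmod v = 1" "cmod z = 1" "x * y * v * z = 1"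
  shows "of_real (Re (c * (z - v))) * (x - y) = of_real (Re (cnj c * (y - x))) * (cnj v - cnj z)"
proof -
  have "x * cnj x = 1" "y * cnj y = 1" "v * cnj v = 1" "z * cnj z = 1"
    using assms(1-4) complex_norm_square[of x] complex_norm_square[of y] complex_norm_square[of v]
      complex_norm_square[of z] by simp_all
  then have "(c * (z - v) + cnj c * (cnj z - cnj v)) * (x - y)
    = (cnj c * (y - x) + c * (cnj y - cnj x)) * (cnj v - cnj z)"
    using assms(5) by algebra
  then show ?thesis unfolding of_real_Re by simp
qed

text \<open>The plane part of the incidence at a vertex. Both sides come from subtracting a complex
  constant, \<open>c * s / 2\<close> or its counterpart: its real part centres the coordinates along
  the lines, its imaginary part becomes their distance from the axis.\<close>

lemma vertex_identity:
  assumes "cmod x = 1" "cmod y = 1" "cmod v = 1" "cmod z = 1" "x * y * v * z = 1"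
  defines "s \<equiv> x + y + v + z"
  shows "of_real (- Im (c * s) / 2) * (\<i> * x) + of_real (Re (c * x) + Re (c * v) - Re (c * s) / 2) * x
    = of_real (Im (cnj c * s) / 2) * (\<i> * cnj v)
      + of_real (Re (cnj c * x) + Re (cnj c * v) - Re (cnj c * s) / 2) * cnj v"
proof -
  have inv: "x * cnj x = 1" "y * cnj y = 1" "v * cnj v = 1" "z * cnj z = 1"
    using assms(1-4) complex_norm_square[of x] complex_norm_square[of y] complex_norm_square[of v]
      complex_norm_square[of z] by simp_all
  have split: "of_real (- Im t / 2) * (\<i> * p) + of_real (r - Re t / 2) * p = (of_real r - t / 2) * p"
    "of_real (Im t / 2) * (\<i> * p) + of_real (r - Re t / 2) * p = (of_real r - cnj t / 2) * p" for r t p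
    by (simp_all add: complex_eq_iff algebra_simps diff_divide_distrib add_divide_distrib)
  have "(c * x + cnj c * cnj x + (c * v + cnj c * cnj v) - c * s) * x
    = (cnj c * x + c * cnj x + (cnj c * v + c * cnj v) - c * cnj s) * cnj v"
    unfolding s_def complex_cnj_add using inv assms(5) by algebra
  moreover have "of_real (Re (c * x) + Re (c * v)) - c * s / 2
      = (c * x + cnj c * cnj x + (c * v + cnj c * cnj v) - c * s) / 2"
    "of_real (Re (cnj c * x) + Re (cnj c * v)) - cnj (cnj c * s) / 2
      = (cnj c * x + c * cnj x + (cnj c * v + c * cnj v) - c * cnj s) / 2"
    unfolding of_real_add of_real_Re complex_cnj_mult complex_cnj_cnj
    by (simp_all only: add_divide_distrib diff_divide_distrib)
  ultimately have "(of_real (Re (c * x) + Re (c * v)) - c * s / 2) * x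
    = (of_real (Re (cnj c * x) + Re (cnj c * v)) - cnj (cnj c * s) / 2) * cnj v"
    by (simp only: times_divide_eq_left)
  then show ?thesis unfolding split .
qed

lemma sum_mod4:
  assumes "distinct [i, j, k, l :: 4]"
  shows "x i + x j + x k + x l = x 0 + x 1 + x 2 + (x 3 :: 'a::ab_group_add)"
proof -
  have "{i, j, k, l} = {0, 1, 2, 3}" using assms UNIV_mod4 unfolding four_distinct_iff[symmetric]
    by metis
  then have "sum x {i, j, k, l} = sum x {0, 1, 2, 3}" by (rule arg_cong)
  moreover have "sum x {i, j, k, l} = x i + x j + x k + x l" using assms by (simp add: add.assoc)
  moreover have "sum x {0, 1, 2, 3} = x 0 + x 1 + x 2 + x 3" by (simp add: add.assoc)
  ultimately show ?thesis by simp
qed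

lemma (in skew_net) axial_net_exists:
  "\<exists>e f cn rho sig mu nu d d' z H.
    axial_net e f cn rho sig mu nu d d' z H u w (\<lambda>i. pline (p i) (u i)) (\<lambda>i. pline (q i) (w i))"
proof -
  obtain e f rho sig mu nu z where fr: "frame e f" and pos: "0 < rho" "0 < sig"
    and z1: "\<And>i. cmod (z i) = 1" and inj_z: "inj z"
    and prod: "\<And>i j k l. distinct [i, j, k, l] \<Longrightarrow> z i * z j * z k * z l = 1"
    and u: "\<And>i. u i = plane e f (of_real rho * z i) + mu *\<^sub>R (e \<times> f)"
    and w: "\<And>i. w i = plane e f (of_real sig * cnj (z i)) + nu *\<^sub>R (e \<times> f)"
    using cylindrical_directions by blast
  let ?N = "e \<times> f"
  have zne: "z i \<noteq> z j" if "i \<noteq> j" for i j using inj_z that by (auto simp: inj_eq)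
  have cl: "of_real ((a l - a k) * rho) * (z i - z j) = of_real ((b j - b i) * sig) * (cnj (z k) -
    cnj (z l))"
    if d: "distinct [i, j, k, l]" for i j k l
  proof -
    have "u i - u j = rho *\<^sub>R plane e f (z i - z j)" "w k - w l = sig *\<^sub>R plane e f (cnj (z k) -
      cnj (z l))"
      by (simp_all add: u w plane_scaleR plane_diff scaleR_diff_right)
    then have "plane e f (of_real ((a l - a k) * rho) * (z i - z j)) + 0 *\<^sub>R ?N
      = plane e f (of_real ((b j - b i) * sig) * (cnj (z k) - cnj (z l))) + 0 *\<^sub>R ?N"
      using closing[OF d] by (simp only: plane_scaleR scaleR_scaleR[symmetric])
    then show ?thesis unfolding plane_eq_iff[OF fr] by simp
  qed
  \<comment> \<open>The constant \<open>c\<close> is fitted to two differences of \<open>a\<close>.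
    The closing conditions then carry the formulas to all \<open>b i\<close> and finally back to
    \<open>a 0\<close>.\<close>
  have "Im ((z 1 - z 3) * cnj (z 2 - z 3)) \<noteq> 0"
    by (intro unit_circle_noncollinear z1 zne) simp_all
  then obtain c where c: "Re (c * (z 1 - z 3)) = (a 1 - a 3) / sig" "Re (c * (z 2 - z 3)) = (a 2 -
    a 3) / sig"
    by (rule solve_real_parts)
  have a_imp_b: "b j - b i = rho * Re (cnj c * (z j - z i))"
    if d: "distinct [i, j, k, l]" and al: "a l - a k = sig * Re (c * (z l - z k))" for i j k l
  proof -
    have "of_real (sig * rho) * (of_real (Re (c * (z l - z k))) * (z i - z j))
      = of_real ((b j - b i) * sig) * (cnj (z k) - cnj (z l))"
      using cl[OF d] unfolding al by (simp add: mult_ac)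
    then have "of_real (sig * rho * Re (cnj c * (z j - z i))) * (cnj (z k) - cnj (z l))
      = of_real ((b j - b i) * sig) * (cnj (z k) - cnj (z l))"
      unfolding chord_identity[OF z1 z1 z1 z1 prod[OF d]] by (simp only: of_real_mult mult.assoc)
    moreover have "cnj (z k) - cnj (z l) \<noteq> 0" using zne[of k l] d by auto
    ultimately have "of_real (sig * rho * Re (cnj c * (z j - z i))) = (of_real ((b j - b i) * sig)
      :: complex)"
      by (simp only: mult_cancel_right) simp
    then have "sig * rho * Re (cnj c * (z j - z i)) = (b j - b i) * sig" by (simp only: of_real_eq_iff)
    then show ?thesis using pos by simp
  qed
  have b_imp_a: "a l - a k = sig * Re (c * (z l - z k))"
    if d: "distinct [i, j, k, l]" and bj: "b j - b i = rho * Re (cnj c * (z j - z i))" for i j k l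
  proof -
    have "of_real ((a l - a k) * rho) * (z i - z j)
      = of_real (sig * rho) * (of_real (Re (cnj c * (z j - z i))) * (cnj (z k) - cnj (z l)))"
      using cl[OF d] unfolding bj by (simp add: mult_ac)
    then have "of_real ((a l - a k) * rho) * (z i - z j) = of_real (sig * rho * Re (c * (z l - z
      k))) * (z i - z j)"
      unfolding chord_identity[OF z1 z1 z1 z1 prod[OF d], symmetric] by (simp only: of_real_mult
        mult.assoc)
    moreover have "z i - z j \<noteq> 0" using zne[of i j] d by auto
    ultimately have "of_real ((a l - a k) * rho) = (of_real (sig * rho * Re (c * (z l - z k))) ::
      complex)"
      by (simp only: mult_cancel_right) simp
    then have "(a l - a k) * rho = sig * rho * Re (c * (z l - z k))" by (simp only: of_real_eq_iff)
    then show ?thesis using pos by simp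
  qed
  have Re_c: "Re (c * (x - y)) = Re (c * x) - Re (c * y)" for c x y by (simp add: algebra_simps)
  have a13: "a 1 - a 3 = sig * Re (c * (z 1 - z 3))" and a23: "a 2 - a 3 = sig * Re (c * (z 2 - z 3))"
    using c pos by simp_all
  then have a12: "a 1 - a 2 = sig * Re (c * (z 1 - z 2))" unfolding Re_c by (simp add: algebra_simps)
  define b0 where "b0 = b 0 - rho * Re (cnj c * z 0)"
  have b1: "b 1 - b 0 = rho * Re (cnj c * (z 1 - z 0))" by (rule a_imp_b[OF _ a23]) simp
  have b2: "b 2 - b 0 = rho * Re (cnj c * (z 2 - z 0))" by (rule a_imp_b[OF _ a13]) simp
  have b3: "b 3 - b 0 = rho * Re (cnj c * (z 3 - z 0))" by (rule a_imp_b[OF _ a12]) simp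
  have b: "b i = b0 + rho * Re (cnj c * z i)" for i
    using exhaust_mod4[of i] b1 b2 b3 unfolding Re_c by (auto simp: b0_def algebra_simps)
  define a0 where "a0 = a 3 - sig * Re (c * z 3)"
  have "b 2 - b 1 = rho * Re (cnj c * (z 2 - z 1))" unfolding b Re_c by (simp add: algebra_simps)
  then have a03: "a 0 - a 3 = sig * Re (c * (z 0 - z 3))" by (rule b_imp_a[rotated]) simp
  have a: "a i = a0 + sig * Re (c * z i)" for i
    using exhaust_mod4[of i] a13 a23 a03 unfolding Re_c by (auto simp: a0_def algebra_simps)
  define s where "s = z 0 + z 1 + z 2 + z 3"
  define A where "A i = Re (c * z i)" for i
  define B where "B i = Re (cnj c * z i)" for i
  define sA sB where "sA = Re (c * s)" and "sB = Re (cnj c * s)"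
  have sA: "sA = A 0 + A 1 + A 2 + A 3" and sB: "sB = B 0 + B 1 + B 2 + B 3"
    by (simp_all add: sA_def sB_def A_def B_def s_def algebra_simps)
  define d d' where "d = rho * sig * (- Im (c * s) / 2)" and "d' = rho * sig * (Im (cnj c * s) / 2)"
  \<comment> \<open>The components along \<open>?N\<close> of the incidences prescribe
    \<open>H i + H k\<close>. These values are the solution, and the quarters of \<open>sA\<close>
    and \<open>sB\<close> make the sum zero.\<close>
  define H where "H i = nu * rho * B i - mu * sig * A i + mu * sig * sA / 4 - nu * rho * sB / 4" for i
  define F where "F i = H i *\<^sub>R ?N + plane e f (of_real d * (\<i> * z i))" for i
  define F' where "F' i = (- H i) *\<^sub>R ?N + plane e f (of_real d' * (\<i> * cnj (z i)))" for i
  have vertex: "F i + (sig * (A i + A k - sA / 2)) *\<^sub>R u i = F' k + (rho * (B i + B k - sB / 2)) *\<^sub>R w k"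
    if ik: "i \<noteq> k" for i k
  proof -
    obtain j l where "distinct [i, k, j, l]" using ik by (rule third_fourth_index)
    then have dist: "distinct [i, j, k, l]" by auto
    then have s: "s = z i + z j + z k + z l" unfolding s_def by (rule sum_mod4[symmetric])
    have "of_real (- Im (c * s) / 2) * (\<i> * z i) + of_real (A i + A k - sA / 2) * z i
      = of_real (Im (cnj c * s) / 2) * (\<i> * cnj (z k)) + of_real (B i + B k - sB / 2) * cnj (z k)"
      unfolding A_def B_def sA_def sB_def s
      by (rule vertex_identity[OF z1 z1 z1 z1 prod[OF dist]])
    then have "of_real (rho * sig) * (of_real (- Im (c * s) / 2) * (\<i> * z i) + of_real (A i + A k
      - sA / 2) * z i)
      = of_real (rho * sig) * (of_real (Im (cnj c * s) / 2) * (\<i> * cnj (z k)) + of_real (B i + B k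
        - sB / 2) * cnj (z k))"
      by simp
    then have pl: "of_real d * (\<i> * z i) + of_real (sig * (A i + A k - sA / 2)) * (of_real rho * z i)
      = of_real d' * (\<i> * cnj (z k)) + of_real (rho * (B i + B k - sB / 2)) * (of_real sig * cnj (z k))"
      unfolding d_def d'_def of_real_mult by (simp only: distrib_left mult_ac)
    have ht: "H i + sig * (A i + A k - sA / 2) * mu = - H k + rho * (B i + B k - sB / 2) * nu"
      by (simp add: H_def algebra_simps)
    have "F i + (sig * (A i + A k - sA / 2)) *\<^sub>R u i
      = plane e f (of_real d * (\<i> * z i) + of_real (sig * (A i + A k - sA / 2)) * (of_real rho * z i))
        + (H i + sig * (A i + A k - sA / 2) * mu) *\<^sub>R ?N"
      unfolding F_def u plane_add plane_scaleR[of e f "sig * _"] by (simp add: scaleR_add_left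
        scaleR_add_right)
    also have "\<dots> = F' k + (rho * (B i + B k - sB / 2)) *\<^sub>R w k"
      unfolding pl ht F'_def w plane_add plane_scaleR[of e f "rho * (_ - _)"]
      by (simp add: scaleR_add_left scaleR_diff_left scaleR_add_right)
    finally show ?thesis .
  qed
  define x where "x i = sig * (A i - sA / 2) - a0" for i
  define y where "y i = rho * (B i - sB / 2) - b0" for i
  \<comment> \<open>The model lines satisfy the same incidences, so the offset from model to pose is
    the same for every line of both families. This common translation is \<open>cn\<close>.\<close>
  have diff: "p i - (F i + x i *\<^sub>R u i) = q k - (F' k + y k *\<^sub>R w k)" if ik: "i \<noteq> k" for i k
  proof -
    have "x i + a k = sig * (A i + A k - sA / 2)" "y k + b i = rho * (B i + B k - sB / 2)"
      by (simp_all add: x_def y_def a b A_def B_def algebra_simps)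
    then have "F i + x i *\<^sub>R u i + a k *\<^sub>R u i = F' k + y k *\<^sub>R w k + b i *\<^sub>R w k"
      using vertex[OF ik] by (metis add.assoc scaleR_add_left)
    then have "(p i + a k *\<^sub>R u i) - (F i + x i *\<^sub>R u i + a k *\<^sub>R u i)
      = (q k + b i *\<^sub>R w k) - (F' k + y k *\<^sub>R w k + b i *\<^sub>R w k)"
      using net[OF ik] by simp
    then show ?thesis by simp
  qed
  define cn where "cn = p 0 - (F 0 + x 0 *\<^sub>R u 0)"
  have p: "p i - (F i + x i *\<^sub>R u i) = cn" for i
  proof (cases "i = 0")
    case False
    then have "0 \<noteq> i" by simp
    then obtain j k where "distinct [0, i, j, k]" by (rule third_fourth_index)
    then show ?thesis using diff[of i j] diff[of 0 j] by (auto simp: cn_def)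
  qed (simp add: cn_def)
  have "\<exists>i. i \<noteq> k" for k :: 4 by (rule exI[of _ "k + 1"]) simp
  then have q: "q k - (F' k + y k *\<^sub>R w k) = cn" for k using diff p by metis
  have g: "pline (p i) (u i) = pline (cn + H i *\<^sub>R ?N + plane e f (of_real d * (\<i> * z i))) (u i)" for i
    by (rule pline_shift[OF mem_plineI[of _ _ "- x i"]])
      (use p[of i] in \<open>simp add: F_def algebra_simps\<close>)
  have h: "pline (q i) (w i) = pline (cn + (- H i) *\<^sub>R ?N + plane e f (of_real d' * (\<i> * cnj (z
    i)))) (w i)" for i
    by (rule pline_shift[OF mem_plineI[of _ _ "- y i"]])
      (use q[of i] in \<open>simp add: F'_def algebra_simps\<close>)
  have sum_H: "H i + H j + H k + H l = 0" if dist: "distinct [i, j, k, l]" for i j k l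
  proof -
    have "H i + H j + H k + H l = H 0 + H 1 + H 2 + H 3" using dist by (rule sum_mod4)
    also have "\<dots> = 0" unfolding H_def sA sB by (simp add: algebra_simps)
    finally show ?thesis .
  qed
  have "axial_net e f cn rho sig mu nu d d' z H u w (\<lambda>i. pline (p i) (u i)) (\<lambda>i. pline (q i) (w i))"
    by (rule axial_net.intro) (fact fr pos z1 inj_z u w g h | rule prod sum_H, assumption
      | simp add: norm_eq_1 unit_u unit_w)+
  then show ?thesis by (intro exI)
qed

section \<open>Isogram axes, helical displacements and the transversal\<close>

lemma pline_intersection_unique:
  assumes "x \<in> pline p u" "y \<in> pline p u" "x \<in> pline q w" "y \<in> pline q w" "u \<times> w \<noteq> 0"
  shows "x = y"
proof -
  have "y \<in> pline x u" "y \<in> pline x w"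
    using assms(2,4) pline_shift[OF assms(1)] pline_shift[OF assms(3)] by auto
  then obtain s t where s: "y = x + s *\<^sub>R u" and t: "y = x + t *\<^sub>R w" by (metis mem_plineE)
  then have "s *\<^sub>R u = t *\<^sub>R w" by simp
  then have "s *\<^sub>R (u \<times> w) = (t *\<^sub>R w) \<times> w" by (simp add: cross_mult_left[symmetric])
  then have "s = 0" using assms(5) by (simp add: cross_mult_left)
  then show ?thesis using s by simp
qed

lemma rigid_motion_image_side:
  assumes "rigid_motion T" "\<And>k. T (P k) = Q k"
  shows "T ` side P k = side Q k"
  using rigid_motion_image_pline[OF assms(1), of "P k" "P (k + 1) - P k"]
    rigid_motion_eq[OF assms(1), of "P k" "P (k + 1) - P k"] assms(2)[of k] assms(2)[of "k + 1"]
  by (simp add: side_def affine_hull_pline)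

lemma helical_displacement_rigid: "helical_displacement n D \<Longrightarrow> rigid_motion D"
proof -
  assume "helical_displacement n D"
  then obtain r v where r: "rigid_motion r" and D: "D = (\<lambda>x. r x + v)"
    unfolding helical_displacement_def rotation_about_def by blast
  obtain Q c where "rotation_matrix Q" "r = (\<lambda>x. Q *v x + c)" using r unfolding rigid_motion_def by blast
  then have "rotation_matrix Q" "D = (\<lambda>x. Q *v x + (c + v))" by (simp_all add: D add.assoc)
  then show ?thesis unfolding rigid_motion_def by blast
qed

lemma quad_simps: "quad a b c d 0 = a" "quad a b c d 1 = b" "quad a b c d 2 = c" "quad a b c d 3 = d"
  by (simp_all add: quad_def)

text \<open>An axis passes through the midpoints of both diagonals, and these differ when the
  quadrilateral is not a parallelogram.\<close>

lemma isogram_axis_unique: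
  assumes s: "is_isogram_axis P I s" and ne: "P 0 + P 2 \<noteq> P 1 + P 3"
  shows "isogram_axis P I = s"
  unfolding isogram_axis_def
proof (rule the_equality[where P = "is_isogram_axis P I"])
  have mid: "s = pline ((1/2) *\<^sub>R (P 0 + P 2)) ((1/2) *\<^sub>R (P 1 + P 3) - (1/2) *\<^sub>R (P 0 + P 2))"
    if "is_isogram_axis P I s" for s
  proof (rule line_two_points)
    show "line s" using that by (simp add: is_isogram_axis_def)
    have hs: "halfturn s (P 0) = P (0 + 2)" "halfturn s (P 1) = P (1 + 2)"
      using that unfolding is_isogram_axis_def by blast+
    show "(1/2) *\<^sub>R (P 0 + P 2) \<in> s" "(1/2) *\<^sub>R (P 1 + P 3) \<in> s"
      using midpoint_mem_axis[OF \<open>line s\<close> hs(1)] midpoint_mem_axis[OF \<open>line s\<close> hs(2)] by simp_all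
    show "(1/2) *\<^sub>R (P 0 + P 2) \<noteq> (1/2) *\<^sub>R (P 1 + P 3)" using ne by simp
  qed
  show "s' = s" if "is_isogram_axis P I s'" for s'
    using mid[OF that] mid[OF s] by simp
qed (rule s)

context axial_net
begin

abbreviation "N \<equiv> e \<times> f"

text \<open>The squared unit vector in direction \<open>z i - z j\<close> is
  \<open>- (z i * z j)\<close>, so the halfturn sends \<open>z i\<close> to \<open>- z j\<close>;
  lying at mean height, it also exchanges the feet of \<open>g i\<close> and
  \<open>g j\<close>.\<close>

definition sym_axis :: "4 \<Rightarrow> 4 \<Rightarrow> space set" where
  "sym_axis i j = pline (cn + ((H i + H j) / 2) *\<^sub>R N) (plane e f (z i - z j))"

lemma swap_height: "cn + r *\<^sub>R N + plane e f x = cn + plane e f x + r *\<^sub>R N"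
  by (simp add: add_ac)

lemma z_conj: "z i * cnj (z i) = 1"
  using complex_norm_square[of "z i"] unit_z[of i] by simp

lemma z_nonzero [simp]: "z i \<noteq> 0"
  using unit_z[of i] by auto

lemma opposite_z: "distinct [i, j, k, l] \<Longrightarrow> z i * z j * z k = cnj (z l)"
  using prod_z[of i j k l] z_conj[of l] by algebra

lemma sym_axis_swap: "sym_axis i j = sym_axis j i"
proof -
  have "plane e f (z i - z j) = (-1) *\<^sub>R plane e f (z j - z i)" by (simp add: plane_diff)
  then show ?thesis unfolding sym_axis_def by (simp only: pline_scale add.commute)
qed

lemma line_sym_axis: "i \<noteq> j \<Longrightarrow> line (sym_axis i j)"
proof -
  assume "i \<noteq> j"
  then have "cmod (z i - z j) \<noteq> 0" using inj_z by (auto simp: inj_eq)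
  then have "plane e f (z i - z j) \<noteq> 0" using norm_plane[OF frame] by (metis norm_zero)
  then show ?thesis unfolding sym_axis_def by (rule line_pline)
qed

lemma line_axis: "line (pline cn N)"
  using frame_inner(9)[OF frame] by (intro line_pline) auto

lemma axis_meets_sym_axis: "meets_orthogonally (pline cn N) (sym_axis i j)"
proof -
  have "cn + ((H i + H j) / 2) *\<^sub>R N \<in> pline cn N \<inter> sym_axis i j"
    by (auto simp: sym_axis_def intro: mem_plineI)
  then show ?thesis
    unfolding sym_axis_def meets_orthogonally_pline by (auto simp: plane_inner[OF frame])
qed

lemma halfturn_sym_axis:
  assumes "i \<noteq> j"
  shows "halfturn (sym_axis i j) (cn + plane e f x + r *\<^sub>R N)
    = cn + plane e f (- (z i * z j) * cnj x) + (H i + H j - r) *\<^sub>R N"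
proof -
  define m where "m = cmod (z i - z j)"
  have m: "m \<noteq> 0" using inj_z assms by (auto simp: m_def inj_eq)
  define v where "v = (z i - z j) / of_real m"
  have "cmod v = 1" using m by (simp add: v_def norm_divide m_def)
  have "z i - z j = of_real m * v" using m by (simp add: v_def)
  then have ax: "sym_axis i j = pline (cn + ((H i + H j) / 2) *\<^sub>R N) (plane e f v)"
    unfolding sym_axis_def by (simp add: plane_scaleR pline_scale[OF m])
  have "of_real (m\<^sup>2) = (z i - z j) * cnj (z i - z j)"
    unfolding m_def by (rule trans[OF _ complex_norm_square]) simp
  then have "- (z i * z j) * of_real (m\<^sup>2) = (z i - z j)\<^sup>2"
    using z_conj[of i] z_conj[of j] unfolding complex_cnj_diff by algebra
  then have "v\<^sup>2 = - (z i * z j)" using m by (simp add: v_def power_divide field_simps)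
  then show ?thesis
    unfolding ax halfturn_across[OF frame \<open>cmod v = 1\<close>] by simp
qed

lemma halfturn_sym_axis_rigid: "i \<noteq> j \<Longrightarrow> rigid_motion (halfturn (sym_axis i j))"
  by (rule halfturn_rigid[OF line_sym_axis])

lemma lin_halfturn_sym_axis:
  assumes "i \<noteq> j"
  shows "lin (halfturn (sym_axis i j)) (plane e f x + r *\<^sub>R N) = - plane e f (z i * z j * cnj x) -
    r *\<^sub>R N"
proof -
  let ?T = "halfturn (sym_axis i j)" and ?y = "plane e f (- (z i * z j) * cnj x)"
  have 1: "?T (cn + (plane e f x + r *\<^sub>R N)) = cn + ?y + (H i + H j - r) *\<^sub>R N"
    by (subst add.assoc[symmetric]) (rule halfturn_sym_axis[OF assms])
  have 2: "?T cn = cn + (H i + H j) *\<^sub>R N" using halfturn_sym_axis[OF assms, of 0 0] by simp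
  have "lin ?T (plane e f x + r *\<^sub>R N) = ?T (cn + (plane e f x + r *\<^sub>R N)) - ?T cn"
    unfolding rigid_motion_eq[OF halfturn_sym_axis_rigid[OF assms]] by simp
  also have "\<dots> = ?y - r *\<^sub>R N" unfolding 1 2 by (simp add: scaleR_diff_left)
  finally show ?thesis by (simp add: plane_minus)
qed

lemma sym_axis_g:
  assumes "i \<noteq> j"
  shows "lin (halfturn (sym_axis i j)) (u i) = - u j" "halfturn (sym_axis i j) ` g i = g j"
proof -
  have zz: "z i * z j * cnj (z i) = z j" using z_conj[of i] by algebra
  show l: "lin (halfturn (sym_axis i j)) (u i) = - u j"
  proof -
    have "z i * z j * cnj (of_real rho * z i) = of_real rho * (z i * z j * cnj (z i))" by (simp
      add: mult_ac)
    then have eq: "z i * z j * cnj (of_real rho * z i) = of_real rho * z j" unfolding zz .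
    show ?thesis unfolding u lin_halfturn_sym_axis[OF assms] eq by simp
  qed
  have "- (z i * z j) * cnj (of_real d * (\<i> * z i)) = of_real d * (\<i> * (z i * z j * cnj (z i)))" by simp
  note eq = this[unfolded zz]
  have "halfturn (sym_axis i j) (cn + plane e f (of_real d * (\<i> * z i)) + H i *\<^sub>R N)
    = cn + plane e f (of_real d * (\<i> * z j)) + H j *\<^sub>R N"
    unfolding halfturn_sym_axis[OF assms] eq by simp
  then have "halfturn (sym_axis i j) ` g i = pline (cn + H j *\<^sub>R N + plane e f (of_real d * (\<i> * z
    j))) ((-1) *\<^sub>R u j)"
    unfolding g rigid_motion_image_pline[OF halfturn_sym_axis_rigid[OF assms]] l swap_height by simp
  then show "halfturn (sym_axis i j) ` g i = g j" unfolding g by (subst (asm) pline_scale) simp_all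
qed

text \<open>That the axis for \<open>i\<close>, \<open>j\<close> also serves the complementary pair
  \<open>k\<close>, \<open>l\<close> is the content of \<open>prod_z\<close> and
  \<open>sum_H\<close>: they give \<open>z i * z j * z k = cnj (z l)\<close> and the height
  \<open>- H l\<close>.\<close>

lemma sym_axis_h:
  assumes dist: "distinct [i, j, k, l]"
  shows "lin (halfturn (sym_axis i j)) (w k) = - w l" "halfturn (sym_axis i j) ` h k = h l"
proof -
  have ij: "i \<noteq> j" using dist by simp
  have zz: "z i * z j * z k = cnj (z l)" by (rule opposite_z[OF dist])
  show lw: "lin (halfturn (sym_axis i j)) (w k) = - w l"
  proof -
    have "z i * z j * cnj (of_real sig * cnj (z k)) = of_real sig * (z i * z j * z k)" by (simp
      add: mult_ac)
    then have eq: "z i * z j * cnj (of_real sig * cnj (z k)) = of_real sig * cnj (z l)" unfolding zz .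
    show ?thesis unfolding w lin_halfturn_sym_axis[OF ij] eq by simp
  qed
  have "- (z i * z j) * cnj (of_real d' * (\<i> * cnj (z k))) = of_real d' * (\<i> * (z i * z j * z k))"
    by simp
  note eq = this[unfolded zz]
  have ht: "H i + H j - - H k = - H l" using sum_H[OF dist] by simp
  have "halfturn (sym_axis i j) (cn + plane e f (of_real d' * (\<i> * cnj (z k))) + (- H k) *\<^sub>R N)
    = cn + plane e f (of_real d' * (\<i> * cnj (z l))) + (- H l) *\<^sub>R N"
    unfolding halfturn_sym_axis[OF ij] eq ht ..
  then have "halfturn (sym_axis i j) ` h k = pline (cn + (- H l) *\<^sub>R N + plane e f (of_real d' *
    (\<i> * cnj (z l)))) ((-1) *\<^sub>R w l)"
    unfolding h rigid_motion_image_pline[OF halfturn_sym_axis_rigid[OF ij]] lw swap_height by simp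
  then show "halfturn (sym_axis i j) ` h k = h l" unfolding h by (subst (asm) pline_scale) simp_all
qed

text \<open>Vertices are the intersections of sides and hinges are their cross products, so the
  action on the lines determines everything else.\<close>

lemma isogram_axis_sym_axis:
  assumes dist: "distinct [i, j, k, l]"
    and R: "\<And>i k. i \<noteq> k \<Longrightarrow> R i k \<in> g i \<and> R i k \<in> h k"
    and I: "\<And>i k. i \<noteq> k \<Longrightarrow> I i k = pline (R i k) (u i \<times> w k)"
    and nz: "\<And>i k. i \<noteq> k \<Longrightarrow> u i \<times> w k \<noteq> 0"
    and ne: "R i k + R j l \<noteq> R i l + R j k"
  shows "isogram_axis (loop R i l j k) (loop I i l j k) = sym_axis i j"
proof (rule isogram_axis_unique)
  let ?T = "halfturn (sym_axis i j)"
  have ij: "i \<noteq> j" using dist by simp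
  have rig: "rigid_motion ?T" by (rule halfturn_sym_axis_rigid[OF ij])
  have vertex: "halfturn (sym_axis i j) (R i k) = R j l" if dist: "distinct [i, j, k, l]" for i j k l
  proof -
    let ?T = "halfturn (sym_axis i j)"
    have ne: "i \<noteq> j" "i \<noteq> k" "j \<noteq> l" using dist by auto
    have "?T (R i k) \<in> g j" "?T (R i k) \<in> h l"
      using R[OF ne(2)] sym_axis_g(2)[OF ne(1)] sym_axis_h(2)[OF dist] by blast+
    then show ?thesis
      using R[OF ne(3)] nz[OF ne(3)] unfolding g h by (blast intro: pline_intersection_unique)
  qed
  have hinge: "halfturn (sym_axis i j) ` I i k = I j l" if dist: "distinct [i, j, k, l]" for i j k l
  proof -
    have ne: "i \<noteq> j" "i \<noteq> k" "j \<noteq> l" using dist by auto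
    show ?thesis
      unfolding I[OF ne(2)] I[OF ne(3)] rigid_motion_image_pline[OF halfturn_sym_axis_rigid[OF ne(1)]]
        vertex[OF dist] lin_cross[OF halfturn_sym_axis_rigid[OF ne(1)]] sym_axis_g(1)[OF ne(1)]
          sym_axis_h(1)[OF dist]
      by simp
  qed
  have dist': "distinct [i, j, l, k]" "distinct [j, i, l, k]" "distinct [j, i, k, l]" using dist by auto
  note v = vertex[OF dist] vertex[OF dist'(1)] vertex[OF dist'(2), unfolded sym_axis_swap[of j i]]
    vertex[OF dist'(3), unfolded sym_axis_swap[of j i]]
  note hi = hinge[OF dist] hinge[OF dist'(1)] hinge[OF dist'(2), unfolded sym_axis_swap[of j i]]
    hinge[OF dist'(3), unfolded sym_axis_swap[of j i]]
  let ?P = "loop R i l j k"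
  have four: "(2::4) + 2 = 0" "(3::4) + 2 = 1" "(1::4) + 2 = 3" "(0::4) + 2 = 2" by simp_all
  have Pv: "?T (?P m) = ?P (m + 2)" for m
    using exhaust_mod4[of m] v by (elim disjE) (simp_all only: four, simp_all add: loop_def quad_simps)
  have "?T ` side ?P m = side ?P (m + 2)" for m
  proof -
    have "?T ` side ?P m = side (\<lambda>m. ?P (m + 2)) m" by (rule rigid_motion_image_side[OF rig Pv])
    also have "\<dots> = side ?P (m + 2)" by (simp add: side_def add_ac)
    finally show ?thesis .
  qed
  moreover have "?T ` loop I i l j k m = loop I i l j k (m + 2)" for m
    using exhaust_mod4[of m] hi by (elim disjE) (simp_all only: four, simp_all add: loop_def quad_simps)
  ultimately show "is_isogram_axis ?P (loop I i l j k) (sym_axis i j)"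
    unfolding is_isogram_axis_def using line_sym_axis[OF ij] Pv by blast
  show "?P 0 + ?P 2 \<noteq> ?P 1 + ?P 3" using ne by (simp add: loop_def quad_simps)
qed

text \<open>Rotation by \<open>z i / z 0\<close> and translation by \<open>H i - H 0\<close> are
  forced by the line and direction of \<open>g 0\<close>. The same two data take
  \<open>cnj (z i)\<close> to \<open>cnj (z 0)\<close> and the height \<open>- H i\<close> to
  \<open>- H 0\<close>. The scalars \<open>c1\<close>, \<open>c2\<close> stand for the signs of the
  orientations.\<close>

lemma axis_helical:
  assumes c: "c1 \<noteq> 0"
  shows "\<exists>!D. helical_displacement (pline cn N) D \<and> move_oline D (g 0, c1 *\<^sub>R u 0) = (g i, c1 *\<^sub>R u i)"
    and "helical_displacement (pline cn N) D \<Longrightarrow> move_oline D (g 0, c1 *\<^sub>R u 0) = (g i, c1 *\<^sub>R u i) \<Longrightarrow>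
      move_oline D (h i, c2 *\<^sub>R w i) = (h 0, c2 *\<^sub>R w 0)"
proof -
  define m where "m = z i * cnj (z 0)"
  have m0: "m * z 0 = z i" "m * cnj (z i) = cnj (z 0)"
    using z_conj[of 0] z_conj[of i] unfolding m_def by algebra+
  have m1: "cmod m = 1" by (simp add: m_def norm_mult unit_z)
  let ?n = "pline cn N"
  define cyl where "cyl D y r \<longleftrightarrow> (\<forall>v t. D (cn + plane e f v + t *\<^sub>R N) = cn + plane e f (y * v) +
    (t + r) *\<^sub>R N)" for D y r
  have hel: "helical_displacement ?n D \<longleftrightarrow> (\<exists>y r. cmod y = 1 \<and> cyl D y r)" for D
    unfolding cyl_def by (rule helical_displacement_iff[OF frame])
  have lin_cyl: "lin D (plane e f v + t *\<^sub>R N) = plane e f (y * v) + t *\<^sub>R N"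
    if "cyl D y r" "helical_displacement ?n D" for D y r v t
  proof -
    have c: "D (cn + plane e f v + t *\<^sub>R N) = cn + plane e f (y * v) + (t + r) *\<^sub>R N" for v t
      using that(1) unfolding cyl_def by blast
    then have 1: "D (cn + (plane e f v + t *\<^sub>R N)) = cn + plane e f (y * v) + (t + r) *\<^sub>R N"
      by (subst add.assoc[symmetric])
    have 2: "D cn = cn + r *\<^sub>R N" using c[of 0 0] by simp
    have "lin D (plane e f v + t *\<^sub>R N) = D (cn + (plane e f v + t *\<^sub>R N)) - D cn"
      unfolding rigid_motion_eq[OF helical_displacement_rigid[OF that(2)]] by simp
    also have "\<dots> = plane e f (y * v) + t *\<^sub>R N" unfolding 1 2 by (simp add: scaleR_add_left)
    finally show ?thesis .
  qed
  have image: "D ` pline (cn + s *\<^sub>R N + plane e f v) x = pline (cn + (s + r) *\<^sub>R N + plane e f (y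
    * v)) (lin D x)"
    if "cyl D y r" "helical_displacement ?n D" for D y r v s x
  proof -
    have "D (cn + plane e f v + s *\<^sub>R N) = cn + plane e f (y * v) + (s + r) *\<^sub>R N"
      using that(1) unfolding cyl_def by blast
    then show ?thesis
      unfolding rigid_motion_image_pline[OF helical_displacement_rigid[OF that(2)]] swap_height by simp
  qed
  have move: "move_oline D (L, x) = (D ` L, lin D x)" for D L x
    by (simp add: move_oline_def lin_def)
  have lin_c: "lin D (c *\<^sub>R x) = c *\<^sub>R lin D x" if "helical_displacement ?n D" for D c x
    by (rule linear_scale[OF lin_linear[OF helical_displacement_rigid[OF that]]])
  have params: "y = m \<and> r = H i - H 0"
    if y: "cyl D y r" and D: "helical_displacement ?n D" and G: "move_oline D (g 0, c1 *\<^sub>R u 0) =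
      (g i, c1 *\<^sub>R u i)"
    for D y r
  proof -
    have "c1 *\<^sub>R lin D (u 0) = c1 *\<^sub>R u i" and img: "D ` g 0 = g i"
      using G unfolding move lin_c[OF D] by auto
    then have "lin D (u 0) = u i" using c by simp
    then have "plane e f (y * (of_real rho * z 0)) + mu *\<^sub>R N = plane e f (of_real rho * z i) + mu *\<^sub>R N"
      unfolding u lin_cyl[OF y D] .
    then have "y * (of_real rho * z 0) = of_real rho * z i" unfolding plane_eq_iff[OF frame] by simp
    then have yz: "y * z 0 = z i" using pos by (simp add: mult.left_commute)
    have "y * (z 0 * cnj (z 0)) = m" unfolding m_def yz[symmetric] by (simp add: mult_ac)
    then have ym: "y = m" by (simp add: z_conj)
    have "cn + (H 0 + r) *\<^sub>R N + plane e f (y * (of_real d * (\<i> * z 0))) \<in> D ` g 0"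
      unfolding g image[OF y D] by (rule pline_base)
    then have "cn + (H 0 + r) *\<^sub>R N + plane e f (y * (of_real d * (\<i> * z 0))) \<in> g i" unfolding img .
    then obtain t where t: "cn + (H 0 + r) *\<^sub>R N + plane e f (y * (of_real d * (\<i> * z 0)))
      = cn + H i *\<^sub>R N + plane e f (of_real d * (\<i> * z i)) + t *\<^sub>R u i"
      unfolding g by (rule mem_plineE)
    have E: "y * (of_real d * (\<i> * z 0)) = of_real d * (\<i> * z i)" unfolding yz[symmetric] by (simp
      add: mult_ac)
    have "plane e f 0 + (H 0 + r) *\<^sub>R N = plane e f (of_real t * (of_real rho * z i)) + (H i + t *
      mu) *\<^sub>R N"
      \<comment> \<open>The plane component forces \<open>t = 0\<close>: feet go to feet, and the
        heights can be compared.\<close>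
      using t unfolding E by (simp add: u plane_scaleR algebra_simps)
    then have "0 = of_real t * (of_real rho * z i)" "H 0 + r = H i + t * mu"
      unfolding plane_eq_iff[OF frame] by auto
    then show ?thesis using ym pos by simp
  qed
  have good: "move_oline D (g 0, c1 *\<^sub>R u 0) = (g i, c1 *\<^sub>R u i)" "move_oline D (h i, c2 *\<^sub>R w i)
    = (h 0, c2 *\<^sub>R w 0)"
    if y: "cyl D m (H i - H 0)" and D: "helical_displacement ?n D" for D
  proof -
    have E: "m * (of_real rho * z 0) = of_real rho * z i" "m * (of_real d * (\<i> * z 0)) = of_real d
      * (\<i> * z i)"
      "m * (of_real sig * cnj (z i)) = of_real sig * cnj (z 0)"
      "m * (of_real d' * (\<i> * cnj (z i))) = of_real d' * (\<i> * cnj (z 0))"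
      using m0 by (simp_all add: mult.left_commute[of m])
    have "lin D (u 0) = u i" "lin D (w i) = w 0" "D ` g 0 = g i" "D ` h i = h 0"
      unfolding g h image[OF y D] u w lin_cyl[OF y D] E by simp_all
    then show "move_oline D (g 0, c1 *\<^sub>R u 0) = (g i, c1 *\<^sub>R u i)" "move_oline D (h i, c2 *\<^sub>R w i)
      = (h 0, c2 *\<^sub>R w 0)"
      unfolding move lin_c[OF D] by simp_all
  qed
  define D0 where "D0 x = cn + plane e f (m * Complex ((x - cn) \<bullet> e) ((x - cn) \<bullet> f)) + ((x - cn) \<bullet>
    N + (H i - H 0)) *\<^sub>R N" for x
  have D0: "cyl D0 m (H i - H 0)"
    unfolding cyl_def D0_def
    by (simp add: inner_add_left frame_inner[OF frame] plane_def complex_eq_iff)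
  then have hD0: "helical_displacement ?n D0" using m1 hel by blast
  have unique: "D = D0" if D: "helical_displacement ?n D" and G: "move_oline D (g 0, c1 *\<^sub>R u 0) =
    (g i, c1 *\<^sub>R u i)" for D
  proof
    fix x
    obtain y r where y: "cyl D y r" using D hel by blast
    have p: "y = m" "r = H i - H 0" using params[OF y D G] by auto
    obtain v t where "x - cn = plane e f v + t *\<^sub>R N" using frame by (rule frame_cylindrical)
    then have x: "x = cn + plane e f v + t *\<^sub>R N" by (simp add: algebra_simps)
    show "D x = D0 x" using y D0 unfolding p x cyl_def by simp
  qed
  show "\<exists>!D. helical_displacement ?n D \<and> move_oline D (g 0, c1 *\<^sub>R u 0) = (g i, c1 *\<^sub>R u i)"
    using hD0 good(1)[OF D0 hD0] unique by blast
  show "move_oline D (h i, c2 *\<^sub>R w i) = (h 0, c2 *\<^sub>R w 0)"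
    if "helical_displacement ?n D" "move_oline D (g 0, c1 *\<^sub>R u 0) = (g i, c1 *\<^sub>R u i)"
    using unique[OF that] good(2)[OF D0 hD0] by simp
qed

text \<open>The line through \<open>cn\<close> along the real axis serves as transversal: its
  halfturn conjugates plane coordinates and negates heights, exactly the passage from the feet data
  of \<open>g i\<close> to those of \<open>h i\<close>.\<close>

lemma transversal_symmetry:
  "line (pline cn e)"
  "halfturn (pline cn e) ` common_perpendicular (pline cn N) (g i) = common_perpendicular (pline
    cn N) (h i)"
  "halfturn (pline cn e) ` common_perpendicular (pline cn N) (h i) = common_perpendicular (pline
    cn N) (g i)"
proof -
  let ?t = "pline cn e" and ?n = "pline cn N"
  have e0: "e \<noteq> 0" using frame by (auto simp: frame_def)
  then show line: "line ?t" by (rule line_pline)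
  have cpg: "common_perpendicular ?n (g i) = pline (cn + H i *\<^sub>R N) (plane e f (\<i> * z i))"
    unfolding g u by (rule common_perpendicular_pline[OF frame unit_z]) (use pos in simp)
  have cph: "common_perpendicular ?n (h i) = pline (cn + (- H i) *\<^sub>R N) (plane e f (\<i> * cnj (z i)))"
    unfolding h w by (rule common_perpendicular_pline[OF frame]) (use pos unit_z in simp_all)
  have one: "halfturn ?t (cn + plane e f x + r *\<^sub>R N) = cn + plane e f (cnj x) + (- r) *\<^sub>R N" for x r
    using halfturn_across[OF frame, of 1 cn 0 x r] by (simp add: plane_def)
  have image: "halfturn ?t ` pline (cn + r *\<^sub>R N) (plane e f x) = pline (cn + (- r) *\<^sub>R N) (plane
    e f (cnj x))" for r x
  proof -
    have rig: "rigid_motion (halfturn ?t)" by (rule halfturn_rigid[OF line])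
    have "halfturn ?t (cn + plane e f x) = halfturn ?t cn + lin (halfturn ?t) (plane e f x)"
      by (rule rigid_motion_eq[OF rig])
    then have "lin (halfturn ?t) (plane e f x) = plane e f (cnj x)" using one[of x 0] one[of 0 0] by simp
    then show ?thesis using one[of 0 r] unfolding rigid_motion_image_pline[OF rig] by simp
  qed
  have minus: "pline p (plane e f (- x)) = pline p (plane e f x)" for p x
    using pline_scale[of "-1" p "plane e f x"] by (simp add: plane_minus)
  have c: "cnj (\<i> * z i) = - (\<i> * cnj (z i))" "cnj (\<i> * cnj (z i)) = - (\<i> * z i)" by simp_all
  show "halfturn ?t ` common_perpendicular ?n (g i) = common_perpendicular ?n (h i)"
    unfolding cpg cph image c minus ..
  show "halfturn ?t ` common_perpendicular ?n (h i) = common_perpendicular ?n (g i)"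
    unfolding cpg cph image c minus by simp
qed

end

section \<open>From the linkage to the net of its lines\<close>

text \<open>Signed lengths are integrated to coordinates with \<open>a 0 = 0\<close>. For fixed
  \<open>k\<close> only two lines have vertices with both indices 0 and \<open>k\<close>, and they
  share one value by hypothesis.\<close>

lemma signed_coordinates:
  fixes R :: "4 \<Rightarrow> 4 \<Rightarrow> space" and u :: "4 \<Rightarrow> space"
  assumes u: "\<And>i. u i \<noteq> 0"
    and opp: "\<And>i j k l. distinct [i, j, k, l] \<Longrightarrow> \<exists>c. R i l - R i k = c *\<^sub>R u i \<and> R j l - R j k = c
      *\<^sub>R u j"
  shows "\<exists>p a. \<forall>i k. i \<noteq> k \<longrightarrow> R i k = p i + a k *\<^sub>R u i"
proof -
  have "\<exists>c. (k = 0 \<longrightarrow> c = 0) \<and> (\<forall>i. i \<noteq> 0 \<longrightarrow> i \<noteq> k \<longrightarrow> R i k - R i 0 = c *\<^sub>R u i)" for k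
  proof (cases "k = 0")
    case False
    then have "0 \<noteq> k" by simp
    then obtain i j where d: "distinct [0, k, i, j]" by (rule third_fourth_index)
    then have "distinct [i, j, 0, k]" by auto
    then obtain c where c: "R i k - R i 0 = c *\<^sub>R u i" "R j k - R j 0 = c *\<^sub>R u j" using opp by blast
    have "m = i \<or> m = j" if "m \<noteq> 0" "m \<noteq> k" for m
    proof -
      have "m \<in> {0, k, i, j}" using d unfolding four_distinct_iff[symmetric] by simp
      then show ?thesis using that by simp
    qed
    then show ?thesis using c False by metis
  qed simp
  then obtain a where a: "a 0 = 0" "\<And>k i. i \<noteq> 0 \<Longrightarrow> i \<noteq> k \<Longrightarrow> R i k - R i 0 = a k *\<^sub>R u i" by metis
  have zero: "R 0 k = R 0 1 + (a k - a 1) *\<^sub>R u 0" if "k \<noteq> 0" for k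
  proof (cases "k = 1")
    case False
    then have "distinct [0, 1, k]" using that by auto
    then obtain j where j: "distinct [0, 1, k, j]" by (rule fourth_index)
    then have "distinct [0, j, 1, k]" by auto
    then obtain c where c: "R 0 k - R 0 1 = c *\<^sub>R u 0" "R j k - R j 1 = c *\<^sub>R u j" using opp by blast
    have "R j k - R j 0 = a k *\<^sub>R u j" "R j 1 - R j 0 = a 1 *\<^sub>R u j" using j by (auto intro!: a(2))
    then have "(a k - a 1) *\<^sub>R u j = R j k - R j 1" by (simp add: algebra_simps)
    then have "c = a k - a 1" using c(2) u[of j] by simp
    moreover have "R 0 k = R 0 1 + c *\<^sub>R u 0" using c(1) by (simp add: algebra_simps)
    ultimately show ?thesis by (simp only:)
  qed simp
  have "R i k = (if i = 0 then R 0 1 - a 1 *\<^sub>R u 0 else R i 0) + a k *\<^sub>R u i" if "i \<noteq> k" for i k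
    using that zero[of k] a(2)[of i k] by (auto simp: algebra_simps)
  then show ?thesis
    by (intro exI[of _ "\<lambda>i. if i = 0 then R 0 1 - a 1 *\<^sub>R u 0 else R i 0"] exI[of _ a] allI impI)
qed

lemma parallel_lines_through:
  fixes u w :: space
  assumes "norm u = 1" "norm w = 1" "u \<times> w = 0"
  shows "pline x u = pline x w"
proof -
  have "(u \<bullet> w) *\<^sub>R u - w = 0"
    using assms Lagrange[of u u w] by (simp add: norm_eq_1)
  then have w: "w = (u \<bullet> w) *\<^sub>R u" by simp
  then have "u \<bullet> w \<noteq> 0" using assms(2) by auto
  then show ?thesis using pline_scale[of "u \<bullet> w" x u] w by simp
qed

lemma cross_parallel_nonzero:
  fixes n x y :: space
  assumes "n \<noteq> 0" "n \<bullet> x = 0" "n \<bullet> y = 0"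
  obtains s where "x \<times> y = s *\<^sub>R n"
proof -
  have "x \<times> y = ((x \<times> y) \<bullet> sgn n) *\<^sub>R sgn n"
    using assms by (intro cross_parallel) (simp_all add: norm_sgn sgn_div_norm)
  then show ?thesis using that[of "((x \<times> y) \<bullet> sgn n) / norm n"] by (simp add: sgn_div_norm
    divide_inverse)
qed

text \<open>Two hinge directions on one body have a cross product along its line, and its length
  carries the triple product. This transfers skewness between poses.\<close>

lemma cross_cross_common: "(u \<times> v) \<times> (u \<times> x) = (u \<bullet> (v \<times> x)) *\<^sub>R u"
proof -
  have "(u \<times> v) \<bullet> x = u \<bullet> (v \<times> x)" by (simp add: cross3_simps)
  then show ?thesis by (simp add: Lagrange dot_cross_self)
qed

locale net_linkage =
  fixes g h :: "4 \<Rightarrow> space set" and I :: "4 \<Rightarrow> 4 \<Rightarrow> space set" and u w p q :: "4 \<Rightarrow> space"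
    and a b :: "4 \<Rightarrow> real" and R :: "4 \<Rightarrow> 4 \<Rightarrow> space"
  assumes unit: "norm (u i) = 1" "norm (w i) = 1" and inj: "inj a" "inj b"
    and R_g: "i \<noteq> k \<Longrightarrow> R i k = p i + a k *\<^sub>R u i" and R_h: "i \<noteq> k \<Longrightarrow> R i k = q k + b i *\<^sub>R w k"
    and g: "g i = pline (p i) (u i)" and h: "h k = pline (q k) (w k)"
    and hinge: "i \<noteq> k \<Longrightarrow> I i k = pline (R i k) (u i \<times> w k)"
    and cross: "i \<noteq> k \<Longrightarrow> u i \<times> w k \<noteq> 0"
    and triple: "distinct [i, k, l] \<Longrightarrow> u i \<bullet> (w k \<times> w l) \<noteq> 0"

lemma eight_bar_net:
  assumes "eight_bar_linkage g h R I"
  shows "\<exists>u w p q a b. net_linkage g h I u w p q a b R"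
proof -
  note defs = assms[unfolded eight_bar_linkage_def]
  have line: "line (g i)" "line (h i)" for i using defs by blast+
  have incid: "g i \<noteq> h k" "R i k \<in> g i" "R i k \<in> h k" "line (I i k)" "R i k \<in> I i k"
    "meets_orthogonally (I i k) (g i)" "meets_orthogonally (I i k) (h k)" if "i \<noteq> k" for i k
    using defs that by blast+
  have benn: "bennett_isogram (loop R i l j k) (loop I i l j k)" if "distinct [i, j, k, l]" for i j k l
    using defs that unfolding four_distinct_iff by blast
  have "coherent_sides R" using defs by blast
  then obtain u w :: "4 \<Rightarrow> space" where uw: "\<forall>i. norm (u i) = 1 \<and> norm (w i) = 1"
    and coh: "\<forall>i j k l. {i, j, k, l} = UNIV \<longrightarrow>
      (\<exists>c. R i l - R i k = c *\<^sub>R u i \<and> R j l - R j k = c *\<^sub>R u j) \<and>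
      (\<exists>c. R j k - R i k = c *\<^sub>R w k \<and> R j l - R i l = c *\<^sub>R w l)"
    unfolding coherent_sides_def by (elim exE conjE)
  have unit: "norm (u i) = 1" "norm (w i) = 1" for i using uw by auto
  have opp: "\<exists>c. R i l - R i k = c *\<^sub>R u i \<and> R j l - R j k = c *\<^sub>R u j"
      "\<exists>c. R j k - R i k = c *\<^sub>R w k \<and> R j l - R i l = c *\<^sub>R w l" if "distinct [i, j, k, l]" for i j k l
    using coh that unfolding four_distinct_iff[symmetric] by blast+
  have nz: "u i \<noteq> 0" "w i \<noteq> 0" for i using unit[of i] by auto
  obtain p a where R_g: "R i k = p i + a k *\<^sub>R u i" if "i \<noteq> k" for i k
    using signed_coordinates[of u R, OF nz(1) opp(1)] by blast
  have "\<exists>c. R l i - R k i = c *\<^sub>R w i \<and> R l j - R k j = c *\<^sub>R w j" if "distinct [i, j, k, l]" for i j k l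
    by (rule opp(2)) (use that in auto)
  then obtain q b where R_h: "R i k = q k + b i *\<^sub>R w k" if "i \<noteq> k" for i k
    using signed_coordinates[of w "\<lambda>k i. R i k", OF nz(2)] by metis
  have side_ne: "loop R i l j k m \<noteq> loop R i l j k (m + 1)" if "distinct [i, j, k, l]" for i j k l m
    using benn[OF that] unfolding bennett_isogram_def by blast
  have a_ne: "a k \<noteq> a l" if kl: "k \<noteq> l" for k l
  proof -
    obtain i j where "distinct [k, l, i, j]" using kl by (rule third_fourth_index)
    then have d: "distinct [i, j, k, l]" and ne: "i \<noteq> k" "i \<noteq> l" by auto
    show ?thesis using side_ne[OF d, of 0] R_g[OF ne(1)] R_g[OF ne(2)] by (auto simp: loop_def
      quad_simps)
  qed
  have b_ne: "b i \<noteq> b j" if ij: "i \<noteq> j" for i j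
  proof -
    obtain k l where d: "distinct [i, j, k, l]" using ij by (rule third_fourth_index)
    then have ne: "i \<noteq> l" "j \<noteq> l" by auto
    have "(1::4) + 1 = 2" by simp
    then show ?thesis using side_ne[OF d, of 1] R_h[OF ne(1)] R_h[OF ne(2)] by (auto simp:
      loop_def quad_simps)
  qed
  have g: "g i = pline (p i) (u i)" for i
  proof -
    have "i \<noteq> i + 1" by simp
    then obtain k l where "distinct [i, i + 1, k, l]" by (rule third_fourth_index)
    then have ne: "i \<noteq> k" "i \<noteq> l" "k \<noteq> l" by auto
    have Rl: "R i l - R i k = (a l - a k) *\<^sub>R u i" using R_g[OF ne(1)] R_g[OF ne(2)] by (simp add:
      algebra_simps)
    have a: "a l - a k \<noteq> 0" using a_ne[OF ne(3)] by simp
    then have "R i k \<noteq> R i l" using Rl nz(1)[of i] by auto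
    then have "g i = pline (R i k) ((a l - a k) *\<^sub>R u i)"
      using line_two_points[OF line(1) incid(2)[OF ne(1)] incid(2)[OF ne(2)]] Rl by simp
    also have "\<dots> = pline (R i k) (u i)" by (rule pline_scale[OF a])
    also have "\<dots> = pline (p i) (u i)" using R_g[OF ne(1)] by (intro pline_shift[symmetric] mem_plineI)
    finally show ?thesis .
  qed
  have h: "h i = pline (q i) (w i)" for i
  proof -
    have "i \<noteq> i + 1" by simp
    then obtain k l where "distinct [i, i + 1, k, l]" by (rule third_fourth_index)
    then have ne: "k \<noteq> i" "l \<noteq> i" "k \<noteq> l" by auto
    have Rl: "R l i - R k i = (b l - b k) *\<^sub>R w i" using R_h[OF ne(1)] R_h[OF ne(2)] by (simp add:
      algebra_simps)
    have b: "b l - b k \<noteq> 0" using b_ne[OF ne(3)] by simp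
    then have "R k i \<noteq> R l i" using Rl nz(2)[of i] by auto
    then have "h i = pline (R k i) ((b l - b k) *\<^sub>R w i)"
      using line_two_points[OF line(2) incid(3)[OF ne(1)] incid(3)[OF ne(2)]] Rl by simp
    also have "\<dots> = pline (R k i) (w i)" by (rule pline_scale[OF b])
    also have "\<dots> = pline (q i) (w i)" using R_h[OF ne(1)] by (intro pline_shift[symmetric] mem_plineI)
    finally show ?thesis .
  qed
  have cross: "u i \<times> w k \<noteq> 0" if ik: "i \<noteq> k" for i k
  proof
    assume 0: "u i \<times> w k = 0"
    have "g i = pline (R i k) (u i)" using incid(2)[OF ik] unfolding g by (rule pline_shift)
    moreover have "h k = pline (R i k) (w k)" using incid(3)[OF ik] unfolding h by (rule pline_shift)
    ultimately show False using parallel_lines_through[OF unit 0] incid(1)[OF ik] by simp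
  qed
  have hinge: "I i k = pline (R i k) (u i \<times> w k)" if ik: "i \<noteq> k" for i k
  proof -
    obtain c where c: "norm c = 1" "I i k = pline (R i k) c"
      using incid(4,5)[OF ik] by (rule line_pline_through)
    have "c \<bullet> u i = 0" "c \<bullet> w k = 0"
      using incid(6,7)[OF ik] unfolding c(2) g h meets_orthogonally_pline by auto
    then have eq: "u i \<times> w k = ((u i \<times> w k) \<bullet> c) *\<^sub>R c" by (rule cross_parallel[OF c(1)])
    then have "(u i \<times> w k) \<bullet> c \<noteq> 0" using cross[OF ik] by auto
    then show ?thesis using pline_scale[of "(u i \<times> w k) \<bullet> c" "R i k" c] eq c(2) by simp
  qed
  have triple: "u i \<bullet> (w k \<times> w l) \<noteq> 0" if d: "distinct [i, k, l]" for i k l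
  proof
    assume 0: "u i \<bullet> (w k \<times> w l) = 0"
    obtain j where "distinct [i, k, l, j]" using d by (rule fourth_index)
    then have d: "distinct [i, j, k, l]" by auto
    then have ne: "i \<noteq> k" "i \<noteq> l" "j \<noteq> k" "j \<noteq> l" by auto
    let ?P = "loop R i l j k" and ?m = "u i \<times> w k"
    have m: "?m \<bullet> u i = 0" "?m \<bullet> w k = 0" "?m \<bullet> w l = 0"
      using 0 by (simp_all add: dot_cross_self) (simp add: cross3_simps)
    have R: "R i l = R i k + (a l - a k) *\<^sub>R u i" "R j k = R i k + (b j - b i) *\<^sub>R w k"
      using R_g[OF ne(1)] R_g[OF ne(2)] R_h[OF ne(1)] R_h[OF ne(3)] by (simp_all add: algebra_simps)
    have R': "R j l = R i l + (b j - b i) *\<^sub>R w l"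
      using R_h[OF ne(2)] R_h[OF ne(4)] by (simp add: algebra_simps)
    \<comment> \<open>With vanishing triple product all vertices would lie in the plane through
      \<open>R i k\<close> with normal \<open>?m\<close>, against dimension 3.\<close>
    have "?m \<bullet> ?P n = ?m \<bullet> R i k" for n
      using exhaust_mod4[of n] m unfolding loop_def
      by (auto simp: quad_simps R' R inner_add_right)
    then have "range ?P \<subseteq> {x. ?m \<bullet> x = ?m \<bullet> R i k}" by auto
    then have "aff_dim (range ?P) \<le> aff_dim {x. ?m \<bullet> x = ?m \<bullet> R i k}" by (rule aff_dim_subset)
    also have "\<dots> = 2" using aff_dim_hyperplane[OF cross[OF ne(1)]] by simp
    finally show False using benn[OF d] unfolding bennett_isogram_def by simp
  qed
  have inj: "inj a" "inj b" using a_ne b_ne by (auto simp: inj_def)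
  have "net_linkage g h I u w p q a b R"
    by (rule net_linkage.intro) (fact unit inj g h | rule R_g R_h hinge cross triple, assumption)+
  then show ?thesis by blast
qed

text \<open>Non-alignment makes the cross product of meeting lines a nonzero multiple of the moved
  hinge direction. The hinges of one body keep their mutual position, so by
  \<open>cross_cross_common\<close> its sides stay skew.\<close>

lemma (in net_linkage) pose_skew_net:
  assumes pose: "pose I (A, B)" and na: "non_aligned g h (A, B)"
  shows "skew_net (\<lambda>i. lin (A i) (u i)) (\<lambda>i. lin (B i) (w i)) a b (\<lambda>i. A i (p i)) (\<lambda>i. B i (q i))
    (\<lambda>i k. A i ` I i k)"
    and "A i ` g i = pline (A i (p i)) (lin (A i) (u i))" "B i ` h i = pline (B i (q i)) (lin (B
      i) (w i))"
    and "i \<noteq> k \<Longrightarrow> A i (R i k) = A i (p i) + a k *\<^sub>R lin (A i) (u i)"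
proof -
  have rig: "rigid_motion (A i)" "rigid_motion (B i)" for i using pose by (auto simp: pose_def)
  have agree: "A i x = B k x" if "i \<noteq> k" "x \<in> I i k" for i k x using pose that by (auto simp: pose_def)
  have scale: "lin f (c *\<^sub>R v) = c *\<^sub>R lin f v" if "rigid_motion f" for f c v
    using linear_scale[OF lin_linear[OF that]] .
  let ?u = "\<lambda>i. lin (A i) (u i)" and ?w = "\<lambda>i. lin (B i) (w i)"
  show ga: "A i ` g i = pline (A i (p i)) (?u i)" and hb: "B i ` h i = pline (B i (q i)) (?w i)" for i
    unfolding g h by (rule rigid_motion_image_pline[OF rig(1)], rule rigid_motion_image_pline[OF rig(2)])
  show Ra: "A i (R i k) = A i (p i) + a k *\<^sub>R ?u i" if "i \<noteq> k" for i k
    unfolding R_g[OF that] rigid_motion_eq[OF rig(1)] scale[OF rig(1)] ..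
  have Rb: "B k (R i k) = B k (q k) + b i *\<^sub>R ?w k" if "i \<noteq> k" for i k
    unfolding R_h[OF that] rigid_motion_eq[OF rig(2)] scale[OF rig(2)] ..
  have AB: "A i (R i k) = B k (R i k)" if "i \<noteq> k" for i k
    by (rule agree[OF that]) (simp add: hinge[OF that])
  have net: "A i (p i) + a k *\<^sub>R ?u i = B k (q k) + b i *\<^sub>R ?w k" if "i \<noteq> k" for i k
    using AB[OF that] unfolding Ra[OF that] Rb[OF that] .
  have lin_hinge: "lin (A i) (u i \<times> w k) = lin (B k) (u i \<times> w k)" if "i \<noteq> k" for i k
  proof -
    have "R i k + u i \<times> w k \<in> I i k" unfolding hinge[OF that] by (rule mem_plineI[of _ _ 1]) simp
    then have "A i (R i k + u i \<times> w k) = B k (R i k + u i \<times> w k)" by (rule agree[OF that])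
    then show ?thesis using AB[OF that] unfolding rigid_motion_eq[OF rig(1)] rigid_motion_eq[OF
      rig(2)] by simp
  qed
  have unit': "norm (?u i) = 1" "norm (?w i) = 1" for i
    by (simp_all add: lin_norm[OF rig(1)] lin_norm[OF rig(2)] unit)
  have cross': "?u i \<times> ?w k \<noteq> 0" if "i \<noteq> k" for i k
  proof
    assume 0: "?u i \<times> ?w k = 0"
    have "A i ` g i = pline (A i (R i k)) (?u i)"
      unfolding ga by (rule pline_shift) (rule mem_plineI[OF Ra[OF that]])
    moreover have "B k ` h k = pline (A i (R i k)) (?w k)"
      unfolding hb AB[OF that] by (rule pline_shift) (rule mem_plineI[OF Rb[OF that]])
    ultimately have "A i ` g i = B k ` h k" using parallel_lines_through[OF unit' 0] by simp
    then show False using na that unfolding non_aligned_def by blast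
  qed
  have hinge': "\<exists>s. s \<noteq> 0 \<and> ?u i \<times> ?w k = s *\<^sub>R lin (A i) (u i \<times> w k)" if "i \<noteq> k" for i k
  proof -
    let ?n = "lin (A i) (u i \<times> w k)"
    have "norm ?n \<noteq> 0" unfolding lin_norm[OF rig(1)] using cross[OF that] by simp
    then have "?n \<noteq> 0" by simp
    moreover have "?n \<bullet> ?u i = 0" unfolding lin_inner[OF rig(1)] by (simp add: dot_cross_self)
    moreover have "?n \<bullet> ?w k = 0" unfolding lin_hinge[OF that] lin_inner[OF rig(2)] by (simp add:
      dot_cross_self)
    ultimately obtain s where s: "?u i \<times> ?w k = s *\<^sub>R ?n" by (rule cross_parallel_nonzero)
    then show ?thesis using cross'[OF that] by auto
  qed
  show "skew_net ?u ?w a b (\<lambda>i. A i (p i)) (\<lambda>i. B i (q i)) (\<lambda>i k. A i ` I i k)"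
  proof (intro skew_net.intro skew_directions.intro isogram_directions.intro
    skew_directions_axioms.intro skew_net_axioms.intro)
    show "?u i \<bullet> ?u i = 1" "?w i \<bullet> ?w i = 1" for i using unit' by (simp_all add: norm_eq_1)
    show "(a l - a k) *\<^sub>R (?u i - ?u j) = (b j - b i) *\<^sub>R (?w k - ?w l)" if "distinct [i, j, k,
      l]" for i j k l
      by (rule net_closing[where p = "\<lambda>i. A i (p i)" and q = "\<lambda>i. B i (q i)" and u = ?u and w =
        ?w, OF net that])
    show "?u i \<bullet> (?w k \<times> ?w l) \<noteq> 0" if "distinct [i, k, l]" for i k l
    proof -
      have ne: "i \<noteq> k" "i \<noteq> l" using that by auto
      obtain s t where s: "s \<noteq> 0" "?u i \<times> ?w k = s *\<^sub>R lin (A i) (u i \<times> w k)"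
        and t: "t \<noteq> 0" "?u i \<times> ?w l = t *\<^sub>R lin (A i) (u i \<times> w l)" using hinge'[OF ne(1)]
          hinge'[OF ne(2)] by blast
      have "(?u i \<times> ?w k) \<times> (?u i \<times> ?w l) = (s * t) *\<^sub>R lin (A i) ((u i \<times> w k) \<times> (u i \<times> w l))"
        unfolding s t lin_cross[OF rig(1)[of i], of "u i \<times> w k"] by (simp add: cross_mult_left
          cross_mult_right mult.commute)
      also have "\<dots> = (s * t * (u i \<bullet> (w k \<times> w l))) *\<^sub>R ?u i"
        unfolding cross_cross_common scale[OF rig(1)] by simp
      finally have "(?u i \<bullet> (?w k \<times> ?w l)) *\<^sub>R ?u i = (s * t * (u i \<bullet> (w k \<times> w l))) *\<^sub>R ?u i"
        unfolding cross_cross_common .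
      moreover have "?u i \<noteq> 0" using unit'(1)[of i] by auto
      ultimately show ?thesis using s(1) t(1) triple[OF that] by simp
    qed
    show "A i (p i) + a k *\<^sub>R ?u i = B k (q k) + b i *\<^sub>R ?w k" if "i \<noteq> k" for i k by (rule net[OF that])
    show "A i ` I i k = pline (A i (p i) + a k *\<^sub>R ?u i) (?u i \<times> ?w k)" if ik: "i \<noteq> k" for i k
    proof -
      obtain s where s: "s \<noteq> 0" "?u i \<times> ?w k = s *\<^sub>R lin (A i) (u i \<times> w k)" using hinge'[OF ik] by blast
      show ?thesis
        unfolding hinge[OF ik] rigid_motion_image_pline[OF rig(1)] s(2) pline_scale[OF s(1)] Ra[OF ik] ..
    qed
  qed (rule inj)+
qed

lemma unit_direction_cases:
  assumes "orientation_of L G" "L = pline p d" "norm d = 1"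
  obtains c where "c \<noteq> 0" "G = (L, c *\<^sub>R d)"
proof -
  have "fst G = L" "snd G = d \<or> snd G = - d"
    using assms unit_direction_pline[of d p "snd G"] by (auto simp: orientation_of_def)
  then have "G = (L, 1 *\<^sub>R d) \<or> G = (L, (-1) *\<^sub>R d)" by (auto simp: prod_eq_iff)
  then show ?thesis using that[of 1] that[of "-1"] by auto
qed

text \<open>The reversal in the orientation rule cancels the sign in \<open>lin T d = - d'\<close>,
  so all lines of a family inherit the same scalar \<open>c\<close>.\<close>

lemma orient_by_halfturn:
  assumes "reversed G' = move_oline T (L, c *\<^sub>R d)" "rigid_motion T" "lin T d = - d'"
    "orientation_of L' G'"
  shows "G' = (L', c *\<^sub>R d')"
proof -
  have "- snd G' = lin T (c *\<^sub>R d)" using assms(1) by (simp add: reversed_def move_oline_def lin_def)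
  also have "\<dots> = - (c *\<^sub>R d')" using linear_scale[OF lin_linear[OF assms(2)]] assms(3) by simp
  finally show ?thesis using assms(4) by (simp add: orientation_of_def prod_eq_iff)
qed

theorem theorem2:
  fixes g h :: "4 \<Rightarrow> space set" and R :: "4 \<Rightarrow> 4 \<Rightarrow> space" and I :: "4 \<Rightarrow> 4 \<Rightarrow> space set"
    and A B :: "4 \<Rightarrow> space \<Rightarrow> space"
    and g' h' :: "4 \<Rightarrow> space set" and R' :: "4 \<Rightarrow> 4 \<Rightarrow> space" and I' :: "4 \<Rightarrow> 4 \<Rightarrow> space set"
    and s1 s2 s3 s4 s5 s6 :: "space set"
  assumes linkage: "eight_bar_linkage g h R I"
    and pose: "pose I (A, B)" "non_aligned g h (A, B)"
    and lines_in_pose: "\<And>i. g' i = A i ` g i" "\<And>j. h' j = B j ` h j"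
    and hinges_in_pose: "\<And>i j. R' i j = A i (R i j)" "\<And>i j. I' i j = A i ` I i j"
    and axes: "s1 = isogram_axis (loop R' 0 1 3 2) (loop I' 0 1 3 2)"
      "s2 = isogram_axis (loop R' 0 2 1 3) (loop I' 0 2 1 3)"
      "s3 = isogram_axis (loop R' 0 1 2 3) (loop I' 0 1 2 3)"
      "s4 = isogram_axis (loop R' 1 3 2 0) (loop I' 1 3 2 0)"
      "s5 = isogram_axis (loop R' 2 1 3 0) (loop I' 2 1 3 0)"
      "s6 = isogram_axis (loop R' 1 2 3 0) (loop I' 1 2 3 0)"
  shows "continuously_flexible I (A, B) \<and> poses_locally_one_dimensional I (A, B) \<and>
    (\<exists>n. line n \<and>
      (\<forall>s \<in> {s1, s2, s3, s4, s5, s6}. line s \<and> meets_orthogonally n s) \<and>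
      (\<forall>G H. (\<forall>i. orientation_of (g' i) (G i) \<and> orientation_of (h' i) (H i)) \<and>
         reversed (G 3) = move_oline (halfturn s1) (G 0) \<and>
         reversed (G 1) = move_oline (halfturn s2) (G 0) \<and>
         reversed (G 2) = move_oline (halfturn s3) (G 0) \<and>
         reversed (H 2) = move_oline (halfturn s1) (H 1) \<and>
         reversed (H 3) = move_oline (halfturn s3) (H 1) \<and>
         reversed (H 0) = move_oline (halfturn s5) (H 1) \<longrightarrow>
         (\<forall>i \<in> {1, 2, 3}.
            (\<exists>!D. helical_displacement n D \<and> move_oline D (G 0) = G i) \<and>
            (\<forall>D. helical_displacement n D \<and> move_oline D (G 0) = G i \<longrightarrow>
               move_oline D (H i) = H 0))) \<and>
      (\<exists>t. line t \<and>
         (\<forall>i. halfturn t ` common_perpendicular n (g' i) = common_perpendicular n (h' i) \<and>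
              halfturn t ` common_perpendicular n (h' i) = common_perpendicular n (g' i))))"
proof -
  obtain u w p q a b where L: "net_linkage g h I u w p q a b R" using eight_bar_net[OF linkage] by blast
  interpret L: net_linkage g h I u w p q a b R by (rule L)
  have A0: "rigid_motion (A 0)" using pose(1) by (simp add: pose_def)
  have rel: "pose I (\<lambda>i. inv (A 0) \<circ> A i, \<lambda>i. inv (A 0) \<circ> B i)"
    by (rule pose_left_compose[OF pose(1) rigid_motion_inv[OF A0]])
  have inj: "inj (inv (A 0))" by (rule bij_is_inj[OF rigid_motion_bij[OF rigid_motion_inv[OF A0]]])
  have "(inv (A 0) \<circ> A i) ` g i \<noteq> (inv (A 0) \<circ> B j) ` h j" if "i \<noteq> j" for i j
    using pose(2) that by (simp only: image_comp[symmetric] inj_image_eq_iff[OF inj]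
      non_aligned_def prod.case) blast
  then have "non_aligned g h (\<lambda>i. inv (A 0) \<circ> A i, \<lambda>i. inv (A 0) \<circ> B i)"
    by (simp only: non_aligned_def prod.case) blast
  from flexible_at_skew_net[OF pose(1) L.pose_skew_net(1)[OF rel this]]
  have flex: "continuously_flexible I (A, B)" "poses_locally_one_dimensional I (A, B)" .
  define u' where "u' i = lin (A i) (u i)" for i
  define w' where "w' i = lin (B i) (w i)" for i
  note net = L.pose_skew_net[OF pose, folded u'_def w'_def lines_in_pose]
  have rig: "rigid_motion (A i)" "rigid_motion (B i)" for i using pose(1) by (auto simp: pose_def)
  have unit: "norm (u' i) = 1" "norm (w' i) = 1" for i
    by (simp_all add: u'_def w'_def lin_norm[OF rig(1)] lin_norm[OF rig(2)] L.unit)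
  interpret S: skew_net u' w' a b "\<lambda>i. A i (p i)" "\<lambda>i. B i (q i)" "\<lambda>i k. A i ` I i k"
    using net(1) unfolding u'_def w'_def .
  interpret Sd: skew_directions w' u' b a by (rule S.dual_skew)
  have gh: "(\<lambda>i. pline (A i (p i)) (u' i)) = g'" "(\<lambda>i. pline (B i (q i)) (w' i)) = h'"
    using net(2,3) by auto
  obtain e f cn rho sig mu nu d d' z H where X: "axial_net e f cn rho sig mu nu d d' z H u' w' g' h'"
    using S.axial_net_exists unfolding gh by blast
  interpret X: axial_net e f cn rho sig mu nu d d' z H u' w' g' h' by (rule X)
  have R_on: "R' i k \<in> g' i \<and> R' i k \<in> h' k" if ik: "i \<noteq> k" for i k
  proof -
    have R': "R' i k = A i (p i) + a k *\<^sub>R u' i" unfolding hinges_in_pose by (rule net(4)[OF ik])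
    have "R' i k \<in> g' i" unfolding net(2) by (rule mem_plineI[OF R'])
    moreover have "R' i k \<in> h' k" unfolding net(3) by (rule mem_plineI[OF trans[OF R' S.net[OF ik]]])
    ultimately show ?thesis by simp
  qed
  have hinge: "I' i k = pline (R' i k) (u' i \<times> w' k)" if ik: "i \<noteq> k" for i k
    unfolding hinges_in_pose net(4)[OF ik] by (rule S.hinge[OF ik])
  have ne: "R' i k + R' j l \<noteq> R' i l + R' j k" if dist: "distinct [i, j, k, l]" for i j k l
  proof
    assume eq: "R' i k + R' j l = R' i l + R' j k"
    have "i \<noteq> k" "j \<noteq> l" "i \<noteq> l" "j \<noteq> k" using dist by auto
    then have "(a l - a k) *\<^sub>R (u' i - u' j) = R' i l + R' j k - (R' i k + R' j l)"
      \<comment> \<open>A parallelogram would force \<open>u' i = u' j\<close>, which skewness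
        forbids; hence the midpoints that determine the axis are distinct.\<close>
      unfolding hinges_in_pose by (simp add: net(4) algebra_simps)
    then have "(a l - a k) *\<^sub>R (u' i - u' j) = 0" unfolding eq by simp
    moreover have "a l - a k \<noteq> 0" by (rule S.a_diff_nonzero) (use dist in simp)
    ultimately have "u' i = u' j" by simp
    then show False using Sd.skew[of k i j] dist by auto
  qed
  have axis: "isogram_axis (loop R' i l j k) (loop I' i l j k) = X.sym_axis i j" if dist:
    "distinct [i, j, k, l]" for i j k l
    by (rule X.isogram_axis_sym_axis[OF dist R_on hinge S.cross_nonzero ne[OF dist]])
  have s: "s1 = X.sym_axis 0 3" "s2 = X.sym_axis 0 1" "s3 = X.sym_axis 0 2"
    "s4 = X.sym_axis 1 2" "s5 = X.sym_axis 2 3" "s6 = X.sym_axis 1 3"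
    unfolding axes by (rule axis; simp)+
  let ?n = "pline cn (e \<times> f)"
  have sn: "\<forall>s \<in> {s1, s2, s3, s4, s5, s6}. line s \<and> meets_orthogonally ?n s"
    unfolding s using X.line_sym_axis X.axis_meets_sym_axis by simp
  have hel: "\<forall>i \<in> {1, 2, 3}. (\<exists>!D. helical_displacement ?n D \<and> move_oline D (G 0) = G i) \<and>
            (\<forall>D. helical_displacement ?n D \<and> move_oline D (G 0) = G i \<longrightarrow> move_oline D (H i) = H 0)"
    if or: "\<forall>i. orientation_of (g' i) (G i) \<and> orientation_of (h' i) (H i)"
      and G: "reversed (G 3) = move_oline (halfturn s1) (G 0)" "reversed (G 1) = move_oline
        (halfturn s2) (G 0)"
        "reversed (G 2) = move_oline (halfturn s3) (G 0)"
      and H: "reversed (H 2) = move_oline (halfturn s1) (H 1)" "reversed (H 3) = move_oline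
        (halfturn s3) (H 1)"
        "reversed (H 0) = move_oline (halfturn s5) (H 1)" for G H
  proof -
    have og: "orientation_of (g' i) (G i)" and oh: "orientation_of (h' i) (H i)" for i using or by auto
    obtain c1 where c1: "c1 \<noteq> 0" "G 0 = (g' 0, c1 *\<^sub>R u' 0)" by (rule unit_direction_cases[OF og
      net(2) unit(1)])
    obtain c2 where c2: "c2 \<noteq> 0" "H 1 = (h' 1, c2 *\<^sub>R w' 1)" by (rule unit_direction_cases[OF oh
      net(3) unit(2)])
    have rs: "rigid_motion (halfturn s1)" "rigid_motion (halfturn s2)" "rigid_motion (halfturn
      s3)" "rigid_motion (halfturn s5)"
      unfolding s by (rule X.halfturn_sym_axis_rigid; simp)+
    have "G 3 = (g' 3, c1 *\<^sub>R u' 3)" "G 1 = (g' 1, c1 *\<^sub>R u' 1)" "G 2 = (g' 2, c1 *\<^sub>R u' 2)"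
      by (rule orient_by_halfturn[OF G(1)[unfolded c1(2)] rs(1) _ og] orient_by_halfturn[OF
        G(2)[unfolded c1(2)] rs(2) _ og]
          orient_by_halfturn[OF G(3)[unfolded c1(2)] rs(3) _ og]; unfold s; rule X.sym_axis_g; simp)+
    then have Gi: "G i = (g' i, c1 *\<^sub>R u' i)" for i using exhaust_mod4[of i] c1(2) by auto
    have "H 2 = (h' 2, c2 *\<^sub>R w' 2)" "H 3 = (h' 3, c2 *\<^sub>R w' 3)" "H 0 = (h' 0, c2 *\<^sub>R w' 0)"
      by (rule orient_by_halfturn[OF H(1)[unfolded c2(2)] rs(1) _ oh] orient_by_halfturn[OF
        H(2)[unfolded c2(2)] rs(3) _ oh]
          orient_by_halfturn[OF H(3)[unfolded c2(2)] rs(4) _ oh]; unfold s; rule X.sym_axis_h; simp)+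
    then have Hi: "H i = (h' i, c2 *\<^sub>R w' i)" for i using exhaust_mod4[of i] c2(2) by auto
    show ?thesis unfolding Gi Hi using X.axis_helical[OF c1(1)] by blast
  qed
  have sym: "\<exists>t. line t \<and>
      (\<forall>i. halfturn t ` common_perpendicular ?n (g' i) = common_perpendicular ?n (h' i) \<and>
           halfturn t ` common_perpendicular ?n (h' i) = common_perpendicular ?n (g' i))"
    by (rule exI[of _ "pline cn e"]) (intro conjI allI X.transversal_symmetry)
  show ?thesis
    by (intro conjI flex, rule exI[of _ ?n], intro conjI X.line_axis sn sym allI impI)
      (elim conjE, rule hel, assumption+)
qed

end
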